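(* Let $G$ be a triangle-free graph with $n\ge 4$ vertices, and write $n=4t+r$ with $t$ a positive integer and $r\in\{0,1,2,3\}$. Then $\phi(G)\le 6^t$ if $r=0$; $\phi(G)\le 8\cdot 6^{t-1}$ if $r=1$; $\phi(G)\le 11\cdot 6^{t-1}$ if $r=2$; $\phi(G)\le 3\cdot 6^{t}$ if $r=3$. Equality holds if and only if $G\cong tC_4$ (for $r=0$), $G\cong K_{2,3}\cup(t-1)C_4$ (for $r=1$), $G\cong K_{3,3}\cup(t-1)C_4$ (for $r=2$), $G\cong P_3\cup tC_4$ (for $r=3$).
   Context: A subset $F$ of vertices of a graph $G$ is a dissociation set if $G[F]$ has maximum degree at most $1$; a maximal dissociation set is one not properly contained in another dissociation set; $\phi(G)$ is the number of maximal dissociation sets of $G$. $\ell H$ denotes the disjoint union of $\ell$ copies of $H$ and $\cup$ denotes disjoint union; $P_3$ is the path on 3 vertices, $C_4$ the 4-cycle, $K_{a,b}$ the complete bipartite graph. *)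

theory Defs
  imports Main
begin

definition graph :: "'a set \<Rightarrow> 'a set set \<Rightarrow> bool" where
  "graph V E \<longleftrightarrow> finite V \<and> (\<forall>e\<in>E. \<exists>u v. e = {u, v} \<and> u \<noteq> v \<and> u \<in> V \<and> v \<in> V)"

definition triangle_free :: "'a set set \<Rightarrow> bool" where
  "triangle_free E \<longleftrightarrow> \<not> (\<exists>a b c. {a, b} \<in> E \<and> {b, c} \<in> E \<and> {a, c} \<in> E)"

definition dissociation_set :: "'a set \<Rightarrow> 'a set set \<Rightarrow> 'a set \<Rightarrow> bool" where
  "dissociation_set V E F \<longleftrightarrow> F \<subseteq> V \<and> (\<forall>v\<in>F. card {u\<in>F. {u, v} \<in> E} \<le> 1)"

definition maximal_dissociation_set :: "'a set \<Rightarrow> 'a set set \<Rightarrow> 'a set \<Rightarrow> bool" where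
  "maximal_dissociation_set V E F \<longleftrightarrow> dissociation_set V E F \<and>
     (\<forall>F'. dissociation_set V E F' \<and> F \<subseteq> F' \<longrightarrow> F' = F)"

definition phi :: "'a set \<Rightarrow> 'a set set \<Rightarrow> nat" where
  "phi V E = card {F. maximal_dissociation_set V E F}"

definition graph_iso :: "'a set \<Rightarrow> 'a set set \<Rightarrow> 'b set \<Rightarrow> 'b set set \<Rightarrow> bool" where
  "graph_iso V1 E1 V2 E2 \<longleftrightarrow> (\<exists>f. bij_betw f V1 V2 \<and>
     (\<forall>u\<in>V1. \<forall>v\<in>V1. {u, v} \<in> E1 \<longleftrightarrow> {f u, f v} \<in> E2))"

definition P3_V :: "nat set" where "P3_V = {0, 1, 2}"
definition P3_E :: "nat set set" where "P3_E = {{0, 1}, {1, 2}}"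

definition C4_V :: "nat set" where "C4_V = {0, 1, 2, 3}"
definition C4_E :: "nat set set" where "C4_E = {{0, 1}, {1, 2}, {2, 3}, {3, 0}}"

definition Kbip_V :: "nat \<Rightarrow> nat \<Rightarrow> nat set" where "Kbip_V a b = {0..<a + b}"
definition Kbip_E :: "nat \<Rightarrow> nat \<Rightarrow> nat set set" where
  "Kbip_E a b = {{i, j} | i j. i < a \<and> a \<le> j \<and> j < a + b}"

definition copies_V :: "nat \<Rightarrow> 'a set \<Rightarrow> (nat \<times> 'a) set" where
  "copies_V l V = {(i, v). i < l \<and> v \<in> V}"
definition copies_E :: "nat \<Rightarrow> 'a set set \<Rightarrow> (nat \<times> 'a) set set" where
  "copies_E l E = {{(i, u), (i, v)} | i u v. i < l \<and> {u, v} \<in> E}"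

definition dunion_V :: "'a set \<Rightarrow> 'b set \<Rightarrow> ('a + 'b) set" where
  "dunion_V V1 V2 = Inl ` V1 \<union> Inr ` V2"
definition dunion_E :: "'a set set \<Rightarrow> 'b set set \<Rightarrow> ('a + 'b) set set" where
  "dunion_E E1 E2 = (\<lambda>e. Inl ` e) ` E1 \<union> (\<lambda>e. Inr ` e) ` E2"

end

theory Submission
  imports Defs Complex_Main
begin

text \<open>The bound \<open>g n\<close> is proved by induction over the induced subgraphs. A maximal dissociation set
  containing a vertex \<open>v\<close> either has \<open>v\<close> isolated, or matches \<open>v\<close> to exactly one neighbour \<open>u\<close>; in both
  cases it is determined by its restriction to the graph without the closed neighbourhoods of the
  chosen vertices, which by triangle-freeness loses \<open>deg v + 1\<close> or \<open>deg v + deg u\<close> vertices. Together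
  with the sets avoiding \<open>v\<close> this bounds the count by a sum of smaller values of \<open>g\<close>. The sum is below
  \<open>g n\<close> for all graphs without a component among \<open>K\<^sub>1\<close>, \<open>K\<^sub>2\<close>, \<open>P\<^sub>3\<close>, \<open>C\<^sub>4 = K\<^bsub>2,2\<^esub>\<close>, \<open>K\<^bsub>2,3\<^esub>\<close>,
  \<open>K\<^bsub>3,3\<^esub>\<close>, when the branching vertex is chosen according to the degrees and to \<open>n mod 4\<close>; the cubic
  graphs with \<open>n\<close> congruent to 2 need a finer analysis. Components of the listed kinds are split off
  by multiplicativity.\<close>

section \<open>Maximal dissociation sets\<close>

text \<open>The expensive summand of a branching at \<open>v\<close> is the one for the sets
  avoiding \<open>v\<close>, at first only bounded by \<open>g (n - 1)\<close>. The ratio of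
  \<open>g (n - 1)\<close> to \<open>g n\<close> is 1/2, 3/4, 8/11, 11/18 in the residues 0, 1, 2,
  3. In residue 0 this leaves room for plain branching at a vertex of degree at least 3 in a graph
  of minimum degree 2. Elsewhere the summand has to be improved: the deletion of \<open>v\<close>
  changes the residue and creates vertices of small degree, so a bound with a fixed factor below 1
  can be applied to the smaller graph. This is why many auxiliary bounds carry a factor such as
  25/36 or 275/288 instead of a strict inequality. For cubic graphs of residue 2 the plain sum is
  8/11 + 1/6 + 3/11 = 7/6 of \<open>g n\<close>. There the sets avoiding a vertex are split further
  by what blocks that vertex: two of its neighbours, or one neighbour that already has a partner.
  Several configurations of residue 2 come out at exactly \<open>g n\<close> on the first estimate,
  which explains the hunt for one more deleted vertex.\<close>

locale sym_graph =
  fixes adj :: "'a \<Rightarrow> 'a \<Rightarrow> bool"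
  assumes sym: "adj x y \<Longrightarrow> adj y x"
begin

definition nb :: "'a set \<Rightarrow> 'a \<Rightarrow> 'a set" where
  "nb V v = {u \<in> V. adj v u}"

abbreviation deg :: "'a set \<Rightarrow> 'a \<Rightarrow> nat" where
  "deg V v \<equiv> card (nb V v)"

text \<open>Maximum degree at most 1 is phrased as uniqueness of the partner; this avoids
  cardinalities and is visibly hereditary.\<close>

definition dissoc :: "'a set \<Rightarrow> bool" where
  "dissoc F \<longleftrightarrow> (\<forall>v\<in>F. \<forall>x\<in>F. \<forall>y\<in>F. adj v x \<and> adj v y \<longrightarrow> x = y)"

text \<open>Maximality is tested against one added vertex only; as \<open>dissoc\<close> is
  hereditary, this agrees with maximality under inclusion.\<close>

definition mds :: "'a set \<Rightarrow> 'a set \<Rightarrow> bool" where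
  "mds V F \<longleftrightarrow> F \<subseteq> V \<and> dissoc F \<and> (\<forall>x\<in>V - F. \<not> dissoc (insert x F))"

definition num_mds :: "'a set \<Rightarrow> nat" where
  "num_mds V = card {F. mds V F}"

definition count_mds :: "'a set \<Rightarrow> ('a set \<Rightarrow> bool) \<Rightarrow> nat" where
  "count_mds V P = card {F. mds V F \<and> P F}"

lemma nb_iff: "u \<in> nb V v \<longleftrightarrow> u \<in> V \<and> adj v u"
  by (simp add: nb_def)

lemma finite_nb [simp]: "finite V \<Longrightarrow> finite (nb V v)"
  by (simp add: nb_def)

lemma nb_subset: "nb V v \<subseteq> V"
  by (auto simp: nb_def)

lemma nb_sym: "u \<in> nb V v \<Longrightarrow> v \<in> V \<Longrightarrow> v \<in> nb V u"
  by (auto simp: nb_def sym)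

lemma nb_Diff: "nb (V - A) v = nb V v - A"
  by (auto simp: nb_def)

lemma dissoc_mono: "dissoc G \<Longrightarrow> F \<subseteq> G \<Longrightarrow> dissoc F"
  unfolding dissoc_def by blast

lemma mds_subset: "mds V F \<Longrightarrow> F \<subseteq> V"
  by (simp add: mds_def)

lemma finite_mds [simp]: "finite V \<Longrightarrow> finite {F. mds V F}"
  by (rule finite_subset[of _ "Pow V"]) (auto simp: mds_def)

lemma mds_empty: "mds {} F \<longleftrightarrow> F = {}"
  by (auto simp: mds_def dissoc_def)

lemma num_mds_empty: "num_mds {} = 1"
  by (simp add: num_mds_def mds_empty)

lemma mds_pair:
  assumes "mds V F" "v \<in> F" "w \<in> F" "adj v w"
  shows "nb V v \<inter> F = {w}"
  using assms unfolding mds_def dissoc_def nb_def by blast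

lemma mds_unique:
  "mds V F \<Longrightarrow> v \<in> F \<Longrightarrow> x \<in> F \<Longrightarrow> y \<in> F \<Longrightarrow> adj v x \<Longrightarrow> adj v y \<Longrightarrow> x = y"
  unfolding mds_def dissoc_def by blast

text \<open>No edge joins \<open>S\<close> to a vertex outside \<open>A\<close>, so a vertex outside
  \<open>A\<close> that could be added to \<open>F - A\<close> could be added to \<open>F\<close> as
  well. The vertices of \<open>A\<close> outside \<open>S\<close> may have neighbours anywhere, but
  they are not in \<open>F\<close>.\<close>

lemma mds_restrict:
  assumes F: "mds V F" and S: "F \<inter> A = S" and cl: "\<And>s. s \<in> S \<Longrightarrow> nb V s \<subseteq> A"
  shows "mds (V - A) (F - A)"
proof -
  have sub: "F - A \<subseteq> V - A" using F by (auto simp: mds_def)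
  have d: "dissoc (F - A)" using F dissoc_mono[of F "F - A"] by (auto simp: mds_def)
  have nd: "\<not> dissoc (insert x (F - A))" if x: "x \<in> (V - A) - (F - A)" for x
  proof
    assume dx: "dissoc (insert x (F - A))"
    have nadj: "\<not> adj s y \<and> \<not> adj y s" if "s \<in> S" "y \<in> insert x (F - A)" for s y
    proof -
      have "y \<in> V" "y \<notin> A" using that(2) x F by (auto simp: mds_def)
      then show ?thesis using cl[OF that(1)] sym[of y s] by (auto simp: nb_def)
    qed
    have dF: "dissoc F" using F by (simp add: mds_def)
    have "dissoc (insert x F)"
      unfolding dissoc_def
    proof (intro ballI impI, elim conjE)
      fix v p q
      assume v: "v \<in> insert x F" and p: "p \<in> insert x F" and q: "q \<in> insert x F"
        and a: "adj v p" "adj v q"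
      show "p = q"
      proof (cases "v \<in> S")
        case True
        then have "p \<in> S" "q \<in> S" using nadj[of v p] nadj[of v q] p q a S by auto
        then show ?thesis using dF True a S unfolding dissoc_def by blast
      next
        case False
        then have v': "v \<in> insert x (F - A)" using v S by auto
        then have "p \<notin> S" "q \<notin> S" using nadj[of p v] nadj[of q v] a by auto
        then have "p \<in> insert x (F - A)" "q \<in> insert x (F - A)" using p q S by auto
        then show ?thesis using dx v' a unfolding dissoc_def by blast
      qed
    qed
    moreover have "x \<in> V - F" using x by auto
    ultimately show False using F by (auto simp: mds_def)
  qed
  then show ?thesis unfolding mds_def by (intro conjI ballI sub d nd)
qed

text \<open>\<open>F\<close> is recovered as the union of \<open>F - A\<close> and the fixed set
  \<open>S\<close>, so the restriction is injective.\<close>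

lemma count_mds_restrict:
  assumes fin: "finite V"
    and S: "\<And>F. mds V F \<Longrightarrow> P F \<Longrightarrow> F \<inter> A = S"
    and cl: "\<And>s. s \<in> S \<Longrightarrow> nb V s \<subseteq> A"
    and Q: "\<And>F. mds V F \<Longrightarrow> P F \<Longrightarrow> Q (F - A)"
  shows "count_mds V P \<le> count_mds (V - A) Q"
  unfolding count_mds_def
proof (rule card_inj_on_le[where f = "\<lambda>F. F - A"])
  show "inj_on (\<lambda>F. F - A) {F. mds V F \<and> P F}"
  proof (rule inj_onI)
    fix F G assume F: "F \<in> {F. mds V F \<and> P F}" and G: "G \<in> {F. mds V F \<and> P F}" and "F - A = G - A"
    moreover have "F \<inter> A = G \<inter> A" using S[of F] S[of G] F G by simp
    ultimately show "F = G" by blast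
  qed
  show "(\<lambda>F. F - A) ` {F. mds V F \<and> P F} \<subseteq> {F. mds (V - A) F \<and> Q F}"
  proof
    fix G assume "G \<in> (\<lambda>F. F - A) ` {F. mds V F \<and> P F}"
    then obtain F where F: "mds V F" "P F" "G = F - A" by auto
    show "G \<in> {F. mds (V - A) F \<and> Q F}"
      using mds_restrict[OF F(1) S[OF F(1,2)] cl] Q[OF F(1,2)] F(3) by simp
  qed
  show "finite {F. mds (V - A) F \<and> Q F}" using fin by simp
qed

lemma count_mds_True: "count_mds V (\<lambda>F. True) = num_mds V"
  by (simp add: count_mds_def num_mds_def)

lemma count_mds_mono:
  assumes "finite V" "\<And>F. mds V F \<Longrightarrow> P F \<Longrightarrow> Q F"
  shows "count_mds V P \<le> count_mds V Q"
  unfolding count_mds_def by (rule card_mono) (use assms in auto)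

lemma count_mds_zero: "(\<And>F. mds V F \<Longrightarrow> P F \<Longrightarrow> False) \<Longrightarrow> count_mds V P = 0"
  unfolding count_mds_def by (metis (mono_tags, lifting) Collect_empty_eq card.empty)

text \<open>As a predicate, the bound lets a case distinction on \<open>F\<close>, written as a
  nested disjunction, be turned into a sum of bounds by \<open>intro\<close> with
  \<open>count_le_or\<close> and \<open>count_le_ex\<close>. The cases may overlap.\<close>

definition count_le :: "'a set \<Rightarrow> ('a set \<Rightarrow> bool) \<Rightarrow> real \<Rightarrow> bool" where
  "count_le V P x \<longleftrightarrow> real (count_mds V P) \<le> x"

lemma count_le_or:
  assumes "count_le V P x" "count_le V Q y" "finite V"
  shows "count_le V (\<lambda>F. P F \<or> Q F) (x + y)"
proof -
  have "{F. mds V F \<and> (P F \<or> Q F)} = {F. mds V F \<and> P F} \<union> {F. mds V F \<and> Q F}" by blast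
  then have "count_mds V (\<lambda>F. P F \<or> Q F) \<le> count_mds V P + count_mds V Q"
    unfolding count_mds_def by (simp add: card_Un_le)
  then show ?thesis using assms unfolding count_le_def by linarith
qed

lemma count_le_mono:
  assumes "count_le V Q x" "\<And>F. mds V F \<Longrightarrow> P F \<Longrightarrow> Q F" "x \<le> y" "finite V"
  shows "count_le V P y"
proof -
  have "count_mds V P \<le> count_mds V Q"
    by (rule count_mds_mono[OF assms(4)]) (rule assms(2))
  then have "real (count_mds V P) \<le> real (count_mds V Q)" by (rule of_nat_mono)
  also have "\<dots> \<le> x" using assms(1) by (simp only: count_le_def)
  finally show ?thesis using assms(3) unfolding count_le_def by (rule order_trans)
qed

lemma count_le_zero: "(\<And>F. mds V F \<Longrightarrow> P F \<Longrightarrow> False) \<Longrightarrow> 0 \<le> x \<Longrightarrow> count_le V P x"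
  unfolding count_le_def by (subst count_mds_zero) auto

lemma count_le_ex:
  assumes "finite I" "\<And>i. i \<in> I \<Longrightarrow> count_le V (P i) (x i)" "finite V"
  shows "count_le V (\<lambda>F. \<exists>i\<in>I. P i F) (\<Sum>i\<in>I. x i)"
  using assms(1,2)
proof (induction I rule: finite_induct)
  case empty
  then show ?case by (simp add: count_le_zero)
next
  case (insert j I)
  have "count_le V (\<lambda>F. P j F \<or> (\<exists>i\<in>I. P i F)) (x j + (\<Sum>i\<in>I. x i))"
    using insert assms(3) by (intro count_le_or) auto
  then show ?case using insert by simp
qed

lemma count_le_num_mds: "count_le V P x \<Longrightarrow> (\<And>F. mds V F \<Longrightarrow> P F) \<Longrightarrow> finite V \<Longrightarrow> real (num_mds V) \<le> x"
  unfolding count_mds_True[symmetric] count_le_def[symmetric] by (erule count_le_mono) auto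

lemma count_le_restrict:
  assumes fin: "finite V"
    and S: "\<And>F. mds V F \<Longrightarrow> P F \<Longrightarrow> F \<inter> A = S"
    and cl: "\<And>s. s \<in> S \<Longrightarrow> nb V s \<subseteq> A"
  shows "count_le V P (num_mds (V - A))"
proof -
  have "count_mds V P \<le> count_mds (V - A) (\<lambda>_. True)"
    by (rule count_mds_restrict[where S = S]) (rule fin | erule (1) S | erule cl | rule TrueI)+
  then show ?thesis by (simp add: count_le_def count_mds_True)
qed

text \<open>Maximal dissociation sets containing the pairwise matched vertices \<open>J\<close> and the isolated
  vertices \<open>I\<close>, and avoiding \<open>O'\<close>, restrict injectively to the graph without
  \<open>O'\<close> and the closed neighbourhoods of \<open>I\<close> and \<open>J\<close>.\<close>

lemma count_le_cell:
  assumes fin: "finite V"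
    and P: "\<And>F. mds V F \<Longrightarrow> P F \<Longrightarrow> I \<subseteq> F \<and> J \<subseteq> F \<and> O' \<inter> F = {} \<and> (\<forall>v\<in>I. nb V v \<inter> F = {})"
    and J: "\<And>v. v \<in> J \<Longrightarrow> \<exists>w\<in>J. adj v w"
  shows "count_le V P (num_mds (V - (O' \<union> I \<union> J \<union> (\<Union>v\<in>I \<union> J. nb V v))))"
proof (rule count_le_restrict[where S = "I \<union> J", OF fin])
  fix F assume F: "mds V F" "P F"
  note p = P[OF F]
  have 1: "nb V v \<inter> F \<subseteq> I \<union> J" if v: "v \<in> J" for v
  proof -
    obtain w where w: "w \<in> J" "adj v w" using J[OF v] by (elim bexE) rule
    have "nb V v \<inter> F = {w}" by (rule mds_pair[OF F(1)]) (use p v w in auto)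
    then show ?thesis using w(1) by auto
  qed
  show "F \<inter> (O' \<union> I \<union> J \<union> (\<Union>v\<in>I \<union> J. nb V v)) = I \<union> J"
    using p 1 by auto
qed auto

end

locale tf_graph = sym_graph +
  assumes irrefl: "\<not> adj x x"
    and tri: "adj x y \<Longrightarrow> adj y z \<Longrightarrow> \<not> adj x z"
begin

text \<open>The vertex that gets two neighbours in \<open>insert x F\<close> is either a neighbour
  of \<open>x\<close> that already has a partner, or \<open>x\<close> itself. The finer branchings
  use this to learn which vertices belong to \<open>F\<close> when \<open>x\<close> does
  not.\<close>

lemma mds_blocked:
  assumes F: "mds V F" and x: "x \<in> V" "x \<notin> F"
  shows "(\<exists>u\<in>nb V x \<inter> F. \<exists>w\<in>nb V u \<inter> F. w \<noteq> x) \<or>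
    (\<exists>u\<in>nb V x \<inter> F. \<exists>u'\<in>nb V x \<inter> F. u \<noteq> u')"
proof -
  have "\<not> dissoc (insert x F)" and dF: "dissoc F" and FV: "F \<subseteq> V" using F x by (auto simp: mds_def)
  then obtain v p q where v: "v \<in> insert x F" and p: "p \<in> insert x F" and q: "q \<in> insert x F"
    and a: "adj v p" "adj v q" "p \<noteq> q"
    unfolding dissoc_def by blast
  show ?thesis
  proof (cases "v = x")
    case True
    then have "p \<in> F" "q \<in> F" using p q a irrefl by auto
    then show ?thesis using a True FV unfolding nb_def by blast
  next
    case False
    then have vF: "v \<in> F" using v by auto
    have "p = x \<and> q \<in> F \<or> q = x \<and> p \<in> F"
      using dF vF p q a unfolding dissoc_def by blast
    then show ?thesis
    proof (elim disjE conjE)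
      assume "p = x" "q \<in> F"
      then have "v \<in> nb V x \<inter> F" "q \<in> nb V v \<inter> F" "q \<noteq> x"
        using vF a sym[of v x] FV x(2) by (auto simp: nb_def)
      then show ?thesis by blast
    next
      assume "q = x" "p \<in> F"
      then have "v \<in> nb V x \<inter> F" "p \<in> nb V v \<inter> F" "p \<noteq> x"
        using vF a sym[of v x] FV x(2) by (auto simp: nb_def)
      then show ?thesis by blast
    qed
  qed
qed

lemma mds_blocked':
  assumes F: "mds V F" and x: "x \<in> V" "x \<notin> F"
  shows "\<exists>u\<in>nb V x \<inter> F. (\<exists>w\<in>nb V u \<inter> F. w \<noteq> x) \<or> (\<exists>u'\<in>nb V x \<inter> F. u \<noteq> u')"
  using mds_blocked[OF assms] by blast

lemma nb_disjoint: "adj v w \<Longrightarrow> nb V v \<inter> nb V w = {}"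
  using tri[of v w] unfolding nb_def by (auto dest: sym)

lemma card_nb_Un:
  assumes "finite V" "adj v w"
  shows "card (nb V v \<union> nb V w) = deg V v + deg V w"
  using assms by (simp add: card_Un_disjoint nb_disjoint)

end

section \<open>The extremal function\<close>

text \<open>4/3 = 8/6 comes from K_{2,3}, 11/6 from K_{3,3} and 3 from P_3, measured against a
  factor of 6 per four vertices. Integer arguments with \<open>powi\<close> keep
  \<open>g (n - k)\<close> positive and its ratio to \<open>g n\<close> uniform even if
  \<open>k\<close> exceeds \<open>n\<close>. At 1 and 2 the values are not integers, so equality
  cannot occur there.\<close>

definition g :: "int \<Rightarrow> real" where
  "g z = (if z mod 4 = 0 then 1 else if z mod 4 = 1 then 4/3 else if z mod 4 = 2 then 11/6 else 3)
     * 6 powi (z div 4)"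

lemma g_pos: "0 < g z"
  by (simp add: g_def)

lemma g_eval:
  "g (4 * q) = 6 powi q" "g (4 * q + 1) = 4/3 * 6 powi q"
  "g (4 * q + 2) = 11/6 * 6 powi q" "g (4 * q + 3) = 3 * 6 powi q"
  by (simp_all add: g_def)

lemma g_less: "g z < g (z + 1)"
proof -
  obtain q :: int and r where "z = 4 * q + r" "0 \<le> r" "r < 4"
    using div_mult_mod_eq[of z 4] pos_mod_sign[of 4 z] pos_mod_bound[of 4 z] by (metis mult.commute zero_less_numeral)
  have p: "0 < (6::real) powi q" by simp
  from \<open>z = 4 * q + r\<close> \<open>0 \<le> r\<close> \<open>r < 4\<close> consider "z = 4 * q" | "z = 4 * q + 1" | "z = 4 * q + 2" | "z = 4 * q + 3" by linarith
  then show ?thesis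
  proof cases
    case 1
    then have "z + 1 = 4 * q + 1" by simp
    then have "g (z + 1) = 4/3 * 6 powi q" by (simp only: g_eval)
    moreover have "g z = 6 powi q" by (simp only: 1 g_eval)
    ultimately show ?thesis using p by linarith
  next
    case 2
    then have "z + 1 = 4 * q + 2" by simp
    then have "g (z + 1) = 11/6 * 6 powi q" by (simp only: g_eval)
    moreover have "g z = 4/3 * 6 powi q" by (simp only: 2 g_eval)
    ultimately show ?thesis using p by linarith
  next
    case 3
    then have "z + 1 = 4 * q + 3" by simp
    then have "g (z + 1) = 3 * 6 powi q" by (simp only: g_eval)
    moreover have "g z = 11/6 * 6 powi q" by (simp only: 3 g_eval)
    ultimately show ?thesis using p by linarith
  next
    case 4
    then have "z + 1 = 4 * (q + 1)" by simp
    then have "g (z + 1) = 6 powi (q + 1)" by (simp only: g_eval)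
    then have "g (z + 1) = 6 * 6 powi q" by (simp add: power_int_add)
    moreover have "g z = 3 * 6 powi q" by (simp only: 4 g_eval)
    ultimately show ?thesis using p by linarith
  qed
qed

lemma g_strict_mono: "z < w \<Longrightarrow> g z < g w"
proof (induction w rule: int_gr_induct)
  case base
  then show ?case by (rule g_less)
next
  case (step i)
  then show ?case using g_less[of i] by linarith
qed

lemma g_mono: "z \<le> w \<Longrightarrow> g z \<le> g w"
  using g_strict_mono[of z w] by (cases "z = w") auto

lemma g_minus4: "g (z - 4) = g z / 6"
proof -
  have "(z - 4) mod 4 = z mod 4" "(z - 4) div 4 = z div 4 - 1" by presburger+
  then show ?thesis by (simp add: g_def power_int_diff)
qed

text \<open>For a fixed residue each \<open>g (n - k)\<close> is a rational multiple of
  \<open>g n\<close>, so a branching inequality becomes linear in one positive number. Entries with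
  \<open>k > 4\<close> are earlier ones divided by 6.\<close>

lemma g_table0:
  assumes n: "n = 4 * q"
  shows "g (n - 1) = g n / 2" "g (n - 2) = g n * 11 / 36" "g (n - 3) = g n * 2 / 9" "g (n - 4) = g n / 6"
    "g (n - 5) = g n / 12" "g (n - 6) = g n * 11 / 216" "g (n - 7) = g n / 27" "g (n - 8) = g n / 36"
    "g (n - 9) = g n / 72" "g (n - 10) = g n * 11 / 1296" "g (n - 11) = g n / 162" "g (n - 12) = g n / 216"
proof -
  have p: "(6::real) powi (q - 1) = 6 powi q / 6" by (simp add: power_int_diff)
  have e0: "g n = 6 powi q" by (simp only: n g_eval)
  have "n - 1 = 4 * (q - 1) + 3" using n by simp
  then have e1: "g (n - 1) = 3 * 6 powi (q - 1)" by (simp only: g_eval)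
  have "n - 2 = 4 * (q - 1) + 2" using n by simp
  then have e2: "g (n - 2) = 11/6 * 6 powi (q - 1)" by (simp only: g_eval)
  have "n - 3 = 4 * (q - 1) + 1" using n by simp
  then have e3: "g (n - 3) = 4/3 * 6 powi (q - 1)" by (simp only: g_eval)
  show 1: "g (n - 1) = g n / 2" "g (n - 2) = g n * 11 / 36" "g (n - 3) = g n * 2 / 9" "g (n - 4) = g n / 6"
    unfolding g_minus4 e0 e1 e2 e3 p by simp_all
  have s: "n - 5 = n - 1 - 4" "n - 6 = n - 2 - 4" "n - 7 = n - 3 - 4" "n - 8 = n - 4 - 4" "n - 9 = n - 5 - 4" "n - 10 = n - 6 - 4" "n - 11 = n - 7 - 4" "n - 12 = n - 8 - 4" by auto
  show "g (n - 5) = g n / 12" "g (n - 6) = g n * 11 / 216" "g (n - 7) = g n / 27" "g (n - 8) = g n / 36" "g (n - 9) = g n / 72" "g (n - 10) = g n * 11 / 1296" "g (n - 11) = g n / 162" "g (n - 12) = g n / 216"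
    unfolding s g_minus4 1(1-3) by simp_all
qed

lemma g_table1:
  assumes n: "n = 4 * q + 1"
  shows "g (n - 1) = g n * 3 / 4" "g (n - 2) = g n * 3 / 8" "g (n - 3) = g n * 11 / 48" "g (n - 4) = g n / 6"
    "g (n - 5) = g n / 8" "g (n - 6) = g n / 16" "g (n - 7) = g n * 11 / 288" "g (n - 8) = g n / 36"
    "g (n - 9) = g n / 48" "g (n - 10) = g n / 96" "g (n - 11) = g n * 11 / 1728" "g (n - 12) = g n / 216"
proof -
  have p: "(6::real) powi (q - 1) = 6 powi q / 6" by (simp add: power_int_diff)
  have e0: "g n = 4/3 * 6 powi q" by (simp only: n g_eval)
  have "n - 1 = 4 * q" using n by simp
  then have e1: "g (n - 1) = 6 powi q" by (simp only: g_eval)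
  have "n - 2 = 4 * (q - 1) + 3" using n by simp
  then have e2: "g (n - 2) = 3 * 6 powi (q - 1)" by (simp only: g_eval)
  have "n - 3 = 4 * (q - 1) + 2" using n by simp
  then have e3: "g (n - 3) = 11/6 * 6 powi (q - 1)" by (simp only: g_eval)
  show 1: "g (n - 1) = g n * 3 / 4" "g (n - 2) = g n * 3 / 8" "g (n - 3) = g n * 11 / 48" "g (n - 4) = g n / 6"
    unfolding g_minus4 e0 e1 e2 e3 p by simp_all
  have s: "n - 5 = n - 1 - 4" "n - 6 = n - 2 - 4" "n - 7 = n - 3 - 4" "n - 8 = n - 4 - 4" "n - 9 = n - 5 - 4" "n - 10 = n - 6 - 4" "n - 11 = n - 7 - 4" "n - 12 = n - 8 - 4" by auto
  show "g (n - 5) = g n / 8" "g (n - 6) = g n / 16" "g (n - 7) = g n * 11 / 288" "g (n - 8) = g n / 36" "g (n - 9) = g n / 48" "g (n - 10) = g n / 96" "g (n - 11) = g n * 11 / 1728" "g (n - 12) = g n / 216"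
    unfolding s g_minus4 1(1-3) by simp_all
qed

lemma g_table2:
  assumes n: "n = 4 * q + 2"
  shows "g (n - 1) = g n * 8 / 11" "g (n - 2) = g n * 6 / 11" "g (n - 3) = g n * 3 / 11" "g (n - 4) = g n / 6"
    "g (n - 5) = g n * 4 / 33" "g (n - 6) = g n / 11" "g (n - 7) = g n / 22" "g (n - 8) = g n / 36"
    "g (n - 9) = g n * 2 / 99" "g (n - 10) = g n / 66" "g (n - 11) = g n / 132" "g (n - 12) = g n / 216"
proof -
  have p: "(6::real) powi (q - 1) = 6 powi q / 6" by (simp add: power_int_diff)
  have e0: "g n = 11/6 * 6 powi q" by (simp only: n g_eval)
  have "n - 1 = 4 * q + 1" using n by simp
  then have e1: "g (n - 1) = 4/3 * 6 powi q" by (simp only: g_eval)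
  have "n - 2 = 4 * q" using n by simp
  then have e2: "g (n - 2) = 6 powi q" by (simp only: g_eval)
  have "n - 3 = 4 * (q - 1) + 3" using n by simp
  then have e3: "g (n - 3) = 3 * 6 powi (q - 1)" by (simp only: g_eval)
  show 1: "g (n - 1) = g n * 8 / 11" "g (n - 2) = g n * 6 / 11" "g (n - 3) = g n * 3 / 11" "g (n - 4) = g n / 6"
    unfolding g_minus4 e0 e1 e2 e3 p by simp_all
  have s: "n - 5 = n - 1 - 4" "n - 6 = n - 2 - 4" "n - 7 = n - 3 - 4" "n - 8 = n - 4 - 4" "n - 9 = n - 5 - 4" "n - 10 = n - 6 - 4" "n - 11 = n - 7 - 4" "n - 12 = n - 8 - 4" by auto
  show "g (n - 5) = g n * 4 / 33" "g (n - 6) = g n / 11" "g (n - 7) = g n / 22" "g (n - 8) = g n / 36" "g (n - 9) = g n * 2 / 99" "g (n - 10) = g n / 66" "g (n - 11) = g n / 132" "g (n - 12) = g n / 216"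
    unfolding s g_minus4 1(1-3) by simp_all
qed

lemma g_table3:
  assumes n: "n = 4 * q + 3"
  shows "g (n - 1) = g n * 11 / 18" "g (n - 2) = g n * 4 / 9" "g (n - 3) = g n / 3" "g (n - 4) = g n / 6"
    "g (n - 5) = g n * 11 / 108" "g (n - 6) = g n * 2 / 27" "g (n - 7) = g n / 18" "g (n - 8) = g n / 36"
    "g (n - 9) = g n * 11 / 648" "g (n - 10) = g n / 81" "g (n - 11) = g n / 108" "g (n - 12) = g n / 216"
proof -
  have p: "(6::real) powi (q - 1) = 6 powi q / 6" by (simp add: power_int_diff)
  have e0: "g n = 3 * 6 powi q" by (simp only: n g_eval)
  have "n - 1 = 4 * q + 2" using n by simp
  then have e1: "g (n - 1) = 11/6 * 6 powi q" by (simp only: g_eval)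
  have "n - 2 = 4 * q + 1" using n by simp
  then have e2: "g (n - 2) = 4/3 * 6 powi q" by (simp only: g_eval)
  have "n - 3 = 4 * q" using n by simp
  then have e3: "g (n - 3) = 6 powi q" by (simp only: g_eval)
  show 1: "g (n - 1) = g n * 11 / 18" "g (n - 2) = g n * 4 / 9" "g (n - 3) = g n / 3" "g (n - 4) = g n / 6"
    unfolding g_minus4 e0 e1 e2 e3 p by simp_all
  have s: "n - 5 = n - 1 - 4" "n - 6 = n - 2 - 4" "n - 7 = n - 3 - 4" "n - 8 = n - 4 - 4" "n - 9 = n - 5 - 4" "n - 10 = n - 6 - 4" "n - 11 = n - 7 - 4" "n - 12 = n - 8 - 4" by auto
  show "g (n - 5) = g n * 11 / 108" "g (n - 6) = g n * 2 / 27" "g (n - 7) = g n / 18" "g (n - 8) = g n / 36" "g (n - 9) = g n * 11 / 648" "g (n - 10) = g n / 81" "g (n - 11) = g n / 108" "g (n - 12) = g n / 216"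
    unfolding s g_minus4 1(1-3) by simp_all
qed

lemma residue4_cases:
  fixes n :: int
  obtains q where "n = 4 * q" | q where "n = 4 * q + 1" | q where "n = 4 * q + 2" | q where "n = 4 * q + 3"
proof -
  have "n = 4 * (n div 4) + n mod 4" "n mod 4 \<in> {0,1,2,3}" by auto presburger?
  then show ?thesis using that by fastforce
qed

lemma g_ratio: "g (z - 1) \<le> 3/4 * g z"
  by (rule residue4_cases[of z]; drule g_table0 g_table1 g_table2 g_table3; insert g_pos[of z]; simp)

text \<open>Each step costs a factor of at most 3/4, and 3/4 (m + 1) \<le> m holds from m = 3 on. So
  in a branching sum a large degree may be replaced by the smallest one allowed.\<close>

lemma g_mult_decr:
  assumes "3 \<le> d" "d \<le> e"
  shows "real e * g (z - int e) \<le> real d * g (z - int d)"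
  using assms(2)
proof (induction e rule: dec_induct)
  case base
  show ?case by simp
next
  case (step m)
  have "real (Suc m) * g (z - int (Suc m)) \<le> real (Suc m) * (3/4 * g (z - int m))"
    using g_ratio[of "z - int m"] by (intro mult_left_mono) (auto simp: algebra_simps)
  also have "\<dots> \<le> real m * g (z - int m)"
    using step assms(1) g_pos[of "z - int m"] by (simp add: algebra_simps)
  finally show ?case using step by simp
qed

section \<open>Branching at a vertex\<close>

context tf_graph
begin

text \<open>The induction hypothesis in the form used for branching. It passes to subsets, so it
  stays available after deletions.\<close>

definition subsets_bounded :: "'a set \<Rightarrow> bool" where
  "subsets_bounded V \<longleftrightarrow> (\<forall>W. W \<subset> V \<longrightarrow> real (num_mds W) \<le> g (int (card W)))"

lemma subsets_bounded_subset: "subsets_bounded V \<Longrightarrow> W \<subseteq> V \<Longrightarrow> subsets_bounded W"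
  unfolding subsets_bounded_def by auto

text \<open>\<open>K\<close> is any part of the deleted set whose size can be counted; undercounting
  is harmless because \<open>g\<close> increases. \<open>0 < k\<close> makes the remaining set a
  proper subset.\<close>

lemma num_mds_Diff_le:
  assumes "finite V" "subsets_bounded V" "K \<subseteq> V" "K \<subseteq> A" "0 < k" "k \<le> card K"
  shows "real (num_mds (V - A)) \<le> g (int (card V) - int k)"
proof -
  have "K \<noteq> {}" using assms(5,6) by auto
  then have "V - A \<subset> V" using assms(3,4) by auto
  then have "real (num_mds (V - A)) \<le> g (int (card (V - A)))" using assms(2) by (simp add: subsets_bounded_def)
  also have "card (V - A) \<le> card (V - K)" using assms by (intro card_mono) auto
  then have "int (card (V - A)) \<le> int (card V) - int k"
    using card_Diff_subset[of K V] card_mono[of V K] assms finite_subset[of K V] by linarith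
  then have "g (int (card (V - A))) \<le> g (int (card V) - int k)" by (rule g_mono)
  finally show ?thesis .
qed

lemma count_le_num_mds_mono: "count_le V P (real x) \<Longrightarrow> real x \<le> y \<Longrightarrow> count_le V P y"
  by (simp add: count_le_def)

text \<open>One case of a branching: \<open>I\<close> lists members isolated in \<open>F\<close>,
  \<open>J\<close> members matched within \<open>J\<close>, and \<open>O'\<close> vertices outside
  \<open>F\<close>. \<open>K\<close> exhibits \<open>k\<close> distinct vertices whose membership in
  \<open>F\<close> is thereby decided.\<close>

lemma cell:
  assumes fin: "finite V" and h: "subsets_bounded V"
    and P: "\<And>F. mds V F \<Longrightarrow> P F \<Longrightarrow> I \<subseteq> F \<and> J \<subseteq> F \<and> O' \<inter> F = {} \<and> (\<forall>v\<in>I. nb V v \<inter> F = {})"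
    and J: "\<And>v. v \<in> J \<Longrightarrow> \<exists>w\<in>J. adj v w"
    and K: "K \<subseteq> V" "K \<subseteq> O' \<union> I \<union> J \<union> (\<Union>v\<in>I \<union> J. nb V v)" "0 < k" "k \<le> card K"
  shows "count_le V P (g (int (card V) - int k))"
proof (rule count_le_num_mds_mono)
  show "count_le V P (num_mds (V - (O' \<union> I \<union> J \<union> (\<Union>v\<in>I \<union> J. nb V v))))"
    by (rule count_le_cell[OF fin]) (erule (1) P, erule J)
  show "real (num_mds (V - (O' \<union> I \<union> J \<union> (\<Union>v\<in>I \<union> J. nb V v)))) \<le> g (int (card V) - int k)"
    by (rule num_mds_Diff_le[OF fin h K])
qed

text \<open>The two vertices lie in each other's neighbourhoods, and these are disjoint in a
  triangle-free graph.\<close>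

lemma cell_pair:
  assumes "finite V" "subsets_bounded V" "v \<in> V" "w \<in> V" "adj v w"
  shows "count_le V (\<lambda>F. v \<in> F \<and> w \<in> F) (g (int (card V) - int (deg V v + deg V w)))"
proof (rule cell[where I = "{}" and J = "{v,w}" and O' = "{}" and K = "nb V v \<union> nb V w"])
  have "w \<in> nb V v" using assms by (simp add: nb_iff)
  then show "0 < deg V v + deg V w" using assms(1) by (auto simp: card_gt_0_iff)
qed (use assms sym[OF assms(5)] in \<open>auto simp: card_nb_Un nb_iff\<close>)

lemma deg_eq_1_iff: "finite V \<Longrightarrow> v \<in> V \<Longrightarrow> v \<in> nb V l \<Longrightarrow> deg V l = 1 \<Longrightarrow> nb V l = {v}"
  by (metis card_1_singletonE singletonD)

lemma S_rule:
  assumes fin: "finite V" and v: "v \<in> V"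
  shows "real (num_mds V) \<le> real (num_mds (V - {v})) + real (num_mds (V - insert v (nb V v)))
    + (\<Sum>u\<in>nb V v. real (num_mds (V - (nb V u \<union> nb V v))))"
proof (rule count_le_num_mds)
  have 1: "count_le V (\<lambda>F. v \<notin> F) (num_mds (V - {v}))"
    by (rule count_le_restrict[OF fin, where S = "{}"]) auto
  have 2: "count_le V (\<lambda>F. v \<in> F \<and> nb V v \<inter> F = {}) (num_mds (V - insert v (nb V v)))"
    by (rule count_le_restrict[OF fin, where S = "{v}"]) auto
  have 3: "count_le V (\<lambda>F. v \<in> F \<and> u \<in> F) (num_mds (V - (nb V u \<union> nb V v)))" if u: "u \<in> nb V v" for u
  proof (rule count_le_restrict[OF fin, where S = "{u,v}"])
    fix F assume F: "mds V F" "v \<in> F \<and> u \<in> F"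
    have "nb V v \<inter> F = {u}" "nb V u \<inter> F = {v}"
      by (rule mds_pair[OF F(1)]; use u F(2) in \<open>auto simp: nb_iff intro: sym\<close>)+
    then show "F \<inter> (nb V u \<union> nb V v) = {u,v}" by auto
  qed auto
  show "count_le V (\<lambda>F. (v \<notin> F \<or> v \<in> F \<and> nb V v \<inter> F = {}) \<or> (\<exists>u\<in>nb V v. v \<in> F \<and> u \<in> F))
     (real (num_mds (V - {v})) + real (num_mds (V - insert v (nb V v)))
    + (\<Sum>u\<in>nb V v. real (num_mds (V - (nb V u \<union> nb V v)))))"
    by (intro count_le_or count_le_ex 1 2 3 fin finite_nb)
qed (use fin in auto)

text \<open>The summand for \<open>V - {v}\<close> is left as a count: it dominates, and it receives
  better estimates when the deletion of \<open>v\<close> leaves a leaf or a vertex of degree 2.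
  \<open>m\<close> collects lower bounds for the degrees.\<close>

lemma S_num:
  assumes fin: "finite V" and h: "subsets_bounded V" and v: "v \<in> V" and m: "\<And>u. u \<in> nb V v \<Longrightarrow> m u \<le> deg V u"
  shows "real (num_mds V) \<le> real (num_mds (V - {v})) + g (int (card V) - 1 - int (deg V v))
    + (\<Sum>u\<in>nb V v. g (int (card V) - int (m u) - int (deg V v)))"
proof -
  have vn: "v \<notin> nb V v" using irrefl by (simp add: nb_def)
  have "real (num_mds (V - insert v (nb V v))) \<le> g (int (card V) - int (1 + deg V v))"
    by (rule num_mds_Diff_le[OF fin h, where K = "insert v (nb V v)"]) (use v fin vn nb_subset in \<open>auto simp: nb_def\<close>)
  then have 1: "real (num_mds (V - insert v (nb V v))) \<le> g (int (card V) - 1 - int (deg V v))"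
    by (simp add: algebra_simps)
  have "real (num_mds (V - (nb V u \<union> nb V v))) \<le> g (int (card V) - int (m u) - int (deg V v))" if u: "u \<in> nb V v" for u
  proof -
    have a: "adj u v" using u sym by (auto simp: nb_iff)
    have "deg V v > 0" using u fin by (auto simp: card_gt_0_iff)
    then have "real (num_mds (V - (nb V u \<union> nb V v))) \<le> g (int (card V) - int (deg V u + deg V v))"
      by (intro num_mds_Diff_le[OF fin h, where K = "nb V u \<union> nb V v"])
        (use fin a in \<open>auto simp: card_nb_Un nb_iff\<close>)
    also have "\<dots> \<le> g (int (card V) - int (m u) - int (deg V v))" using m[OF u] by (intro g_mono) linarith
    finally show ?thesis .
  qed
  then have "(\<Sum>u\<in>nb V v. real (num_mds (V - (nb V u \<union> nb V v)))) \<le> (\<Sum>u\<in>nb V v. g (int (card V) - int (m u) - int (deg V v)))"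
    by (rule sum_mono)
  then show ?thesis using S_rule[OF fin v] 1 by linarith
qed

lemma S_num_const:
  assumes fin: "finite V" and h: "subsets_bounded V" and v: "v \<in> V" and m: "\<And>u. u \<in> nb V v \<Longrightarrow> m \<le> deg V u"
  shows "real (num_mds V) \<le> real (num_mds (V - {v})) + g (int (card V) - 1 - int (deg V v))
    + real (deg V v) * g (int (card V) - int m - int (deg V v))"
  using S_num[OF fin h v, of "\<lambda>_. m"] m by simp

text \<open>A leaf at \<open>v\<close> outside \<open>F\<close> can only be blocked by
  \<open>v\<close> having a partner. So if \<open>v\<close> is outside \<open>F\<close>, all of
  \<open>L\<close> is in \<open>F\<close>; and if \<open>v\<close> is in \<open>F\<close>, it has a
  partner. The gain over \<open>S_rule\<close> is that the case of an isolated \<open>v\<close>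
  disappears and the first summand shrinks.\<close>

lemma leaf_rule:
  assumes fin: "finite V" and h: "subsets_bounded V" and v: "v \<in> V"
    and L: "L = {x \<in> nb V v. deg V x = 1}" "L \<noteq> {}"
  shows "real (num_mds V) \<le> g (int (card V) - 1 - int (card L))
    + real (card L) * g (int (card V) - 1 - int (deg V v))
    + (\<Sum>w\<in>nb V v - L. g (int (card V) - int (deg V v) - int (deg V w)))"
proof -
  let ?n = "int (card V)"
  have finL: "finite L" "L \<subseteq> nb V v" using L(1) fin by auto
  have nbL: "nb V l = {v}" if "l \<in> L" for l
    using that L(1) v by (intro deg_eq_1_iff[OF fin v]) (auto simp: nb_def sym)
  have vL: "v \<notin> L" using L(1) irrefl by (auto simp: nb_def)
  define x where "x w = (if w \<in> L then g (?n - 1 - int (deg V v)) else g (?n - int (deg V v) - int (deg V w)))" for w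
  have LF: "L \<subseteq> F" if F: "mds V F" "v \<notin> F" for F
  proof
    fix l assume l: "l \<in> L"
    show "l \<in> F"
    proof (rule ccontr)
      assume "l \<notin> F"
      moreover have "l \<in> V" using l finL nb_subset by blast
      ultimately show False using mds_blocked'[OF F(1), of l] nbL[OF l] F(2) by auto
    qed
  qed
  have 1: "count_le V (\<lambda>F. v \<notin> F) (g (?n - int (1 + card L)))"
    by (rule cell[OF fin h, where I = L and J = "{}" and O' = "{v}" and K = "insert v L"])
      (use LF nbL v vL finL nb_subset in \<open>auto simp: nb_def\<close>)
  have 2: "count_le V (\<lambda>F. v \<in> F \<and> w \<in> F) (x w)" if w: "w \<in> nb V v" for w
  proof -
    have "count_le V (\<lambda>F. v \<in> F \<and> w \<in> F) (g (?n - int (deg V v + deg V w)))"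
      by (rule cell_pair[OF fin h v]) (use w in \<open>auto simp: nb_def\<close>)
    moreover have "g (?n - int (deg V v + deg V w)) = x w"
      using L(1) by (auto simp: x_def algebra_simps)
    ultimately show ?thesis by simp
  qed
  have "real (num_mds V) \<le> g (?n - int (1 + card L)) + (\<Sum>w\<in>nb V v. x w)"
  proof (rule count_le_num_mds)
    show "count_le V (\<lambda>F. v \<notin> F \<or> (\<exists>w\<in>nb V v. v \<in> F \<and> w \<in> F)) (g (?n - int (1 + card L)) + (\<Sum>w\<in>nb V v. x w))"
      by (intro count_le_or count_le_ex 1 2 fin finite_nb)
    fix F assume F: "mds V F"
    obtain l where l: "l \<in> L" using L(2) by auto
    have lV: "l \<in> V" "l \<in> nb V v" using l finL nb_subset by blast+
    show "v \<notin> F \<or> (\<exists>w\<in>nb V v. v \<in> F \<and> w \<in> F)"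
    proof (cases "l \<in> F")
      case True
      then show ?thesis using lV by auto
    next
      case False
      then show ?thesis using mds_blocked'[OF F lV(1)] nbL[OF l] by auto
    qed
  qed fact
  moreover have "(\<Sum>w\<in>nb V v. x w) = (\<Sum>w\<in>nb V v - L. x w) + (\<Sum>w\<in>L. x w)"
    using fin finL by (intro sum.subset_diff) auto
  moreover have "(\<Sum>w\<in>L. x w) = real (card L) * g (?n - 1 - int (deg V v))" by (simp add: x_def)
  moreover have "(\<Sum>w\<in>nb V v - L. x w) = (\<Sum>w\<in>nb V v - L. g (?n - int (deg V v) - int (deg V w)))"
    by (intro sum.cong) (auto simp: x_def)
  ultimately show ?thesis by (simp add: algebra_simps)
qed

lemma leaf_num:
  assumes fin: "finite V" and h: "subsets_bounded V" and v: "v \<in> V"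
    and L: "L = {x \<in> nb V v. deg V x = 1}" "L \<noteq> {}"
  shows "real (num_mds V) \<le> g (int (card V) - 1 - int (card L))
    + real (card L) * g (int (card V) - 1 - int (deg V v))
    + real (deg V v - card L) * g (int (card V) - 2 - int (deg V v))"
proof -
  have "g (int (card V) - int (deg V v) - int (deg V w)) \<le> g (int (card V) - 2 - int (deg V v))"
    if w: "w \<in> nb V v - L" for w
  proof -
    have "v \<in> nb V w" using w v nb_sym by auto
    then have "deg V w \<noteq> 0" using fin by auto
    then show ?thesis using w L(1) by (intro g_mono) auto
  qed
  then have "(\<Sum>w\<in>nb V v - L. g (int (card V) - int (deg V v) - int (deg V w)))
      \<le> real (card (nb V v - L)) * g (int (card V) - 2 - int (deg V v))"
    by (rule sum_bounded_above)
  moreover have "card (nb V v - L) = deg V v - card L"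
    using L(1) fin by (intro card_Diff_subset) auto
  ultimately show ?thesis using leaf_rule[OF assms] by simp
qed

lemma int_card_minus1: "finite V \<Longrightarrow> v \<in> V \<Longrightarrow> int (card (V - {v})) = int (card V) - 1"
  using card_Suc_Diff1[of V v] by linarith

lemma num_mds_minus1:
  assumes "finite V" "subsets_bounded V" "v \<in> V"
  shows "real (num_mds (V - {v})) \<le> g (int (card V) - 1)"
proof -
  have "V - {v} \<subset> V" using assms(3) by auto
  then show ?thesis using assms int_card_minus1[of V v] unfolding subsets_bounded_def by metis
qed

lemma isolated_num:
  assumes fin: "finite V" and h: "subsets_bounded V" and x: "x \<in> V" "deg V x = 0"
  shows "real (num_mds V) \<le> g (int (card V) - 1)"
proof (rule count_le_num_mds)
  have nb: "nb V x = {}" using x fin by simp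
  have "count_le V (\<lambda>F. x \<in> F) (g (int (card V) - int 1))"
    by (rule cell[OF fin h, where I = "{x}" and J = "{}" and O' = "{}" and K = "{x}"]) (use nb x in auto)
  then show "count_le V (\<lambda>F. x \<in> F) (g (int (card V) - 1))" by simp
  show "x \<in> F" if "mds V F" for F
    using mds_blocked'[OF that x(1)] nb by auto
qed fact

lemma leaf_set_card:
  assumes "finite V" "u \<in> nb V v" "deg V u = 1"
  shows "1 \<le> card {x \<in> nb V v. deg V x = 1}" "card {x \<in> nb V v. deg V x = 1} \<le> deg V v"
    "{x \<in> nb V v. deg V x = 1} \<noteq> {}"
proof -
  show ne: "{x \<in> nb V v. deg V x = 1} \<noteq> {}" using assms by auto
  then show "1 \<le> card {x \<in> nb V v. deg V x = 1}" using assms(1) by (simp add: Suc_le_eq card_gt_0_iff)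
  show "card {x \<in> nb V v. deg V x = 1} \<le> deg V v" using assms(1) by (intro card_mono) auto
qed

text \<open>\<open>g_mult_decr\<close> pushes the degree down to 4; the two terms of the maximum
  stand for one leaf and for at least two leaves.\<close>

lemma leaf_ge4:
  assumes fin: "finite V" and h: "subsets_bounded V" and v: "v \<in> V" and u: "u \<in> nb V v" "deg V u = 1"
    and d: "4 \<le> deg V v"
  shows "real (num_mds V) \<le> max (g (int (card V) - 2) + g (int (card V) - 5) + 3 * g (int (card V) - 6))
    (g (int (card V) - 3) + 4 * g (int (card V) - 5))"
proof -
  let ?n = "int (card V)"
  define L where "L = {x \<in> nb V v. deg V x = 1}"
  define d where "d = deg V v"
  note L = leaf_set_card[OF fin u, folded L_def d_def]
  have T: "real (num_mds V) \<le> g (?n - 1 - int (card L)) + real (card L) * g (?n - 1 - int d)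
      + real (d - card L) * g (?n - 2 - int d)"
    using leaf_num[OF fin h v L_def L(3)] by (simp add: d_def)
  have d4: "4 \<le> d" using d by (simp add: d_def)
  show ?thesis
  proof (cases "card L = 1")
    case True
    \<comment> \<open>With multiplier \<open>d - 1\<close> the argument must drop by
      \<open>d - 1\<close> from a fixed base for \<open>g_mult_decr\<close> to apply.\<close>
    have e: "?n - 3 - int (d - 1) = ?n - 2 - int d" using d4 by auto
    have "real (d - 1) * g (?n - 3 - int (d - 1)) \<le> real 3 * g (?n - 3 - int 3)"
      using d4 by (intro g_mult_decr) auto
    then have "real (d - 1) * g (?n - 2 - int d) \<le> 3 * g (?n - 6)" unfolding e by simp
    moreover have "g (?n - 1 - int d) \<le> g (?n - 5)" using d4 by (intro g_mono) auto
    moreover have "real (num_mds V) \<le> g (?n - 2) + 1 * g (?n - 1 - int d) + real (d - 1) * g (?n - 2 - int d)"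
      using T unfolding True by simp
    ultimately have "real (num_mds V) \<le> g (?n - 2) + g (?n - 5) + 3 * g (?n - 6)" by linarith
    then show ?thesis by (simp add: le_max_iff_disj)
  next
    case False
    then have l2: "2 \<le> card L" using L(1) by linarith
    have "g (?n - 1 - int (card L)) \<le> g (?n - 3)" using l2 by (intro g_mono) auto
    moreover have "real (d - card L) * g (?n - 2 - int d) \<le> real (d - card L) * g (?n - 1 - int d)"
      by (intro mult_left_mono g_mono) auto
    moreover have "real (card L) * g (?n - 1 - int d) + real (d - card L) * g (?n - 1 - int d) = real d * g (?n - 1 - int d)"
      using L(2) by (simp add: of_nat_diff algebra_simps)
    moreover have "real d * g (?n - 1 - int d) \<le> real 4 * g (?n - 1 - int 4)"
      using d4 by (intro g_mult_decr) auto
    ultimately show ?thesis using T by simp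
  qed
qed

lemma leaf_le3:
  assumes fin: "finite V" and h: "subsets_bounded V" and v: "v \<in> V" and u: "u \<in> nb V v" "deg V u = 1"
  obtains (one) "real (num_mds V) \<le> g (int (card V) - 2) + g (int (card V) - 1 - int (deg V v))
      + real (deg V v - 1) * g (int (card V) - 2 - int (deg V v))"
      "{x \<in> nb V v. deg V x = 1} = {u}"
  | (two) l where "2 \<le> l" "l \<le> deg V v" "real (num_mds V) \<le> g (int (card V) - 1 - int l) + real l * g (int (card V) - 1 - int (deg V v))
      + real (deg V v - l) * g (int (card V) - 2 - int (deg V v))"
proof -
  define L where "L = {x \<in> nb V v. deg V x = 1}"
  note L = leaf_set_card[OF fin u, folded L_def]
  note T = leaf_num[OF fin h v L_def L(3)]
  show ?thesis
  proof (cases "card L = 1")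
    case True
    then obtain z where "L = {z}" by (auto simp: card_1_singleton_iff)
    moreover have "u \<in> L" using u by (simp add: L_def)
    ultimately have "L = {u}" by auto
    moreover have "real (num_mds V) \<le> g (int (card V) - 2) + g (int (card V) - 1 - int (deg V v))
      + real (deg V v - 1) * g (int (card V) - 2 - int (deg V v))"
      using T unfolding True by simp
    ultimately show ?thesis using one unfolding L_def by blast
  next
    case False
    then have "2 \<le> card L" using L(1) by linarith
    then show ?thesis using two[of "card L"] L(2) T by blast
  qed
qed

text \<open>Each factor is the largest of the sums that arise. In residue 0 it comes from three
  leaves at a vertex of degree 3, namely 4/6; in the other residues from a single leaf at a vertex
  of degree 3, for instance 3/8 + 1/6 + 2/8 = 19/24.\<close>

lemma leaf3:
  assumes fin: "finite V" and h: "subsets_bounded V" and v: "v \<in> V" and u: "u \<in> nb V v" "deg V u = 1"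
    and d: "3 \<le> deg V v"
  shows "int (card V) = 4 * q \<Longrightarrow> real (num_mds V) \<le> 2/3 * g (int (card V))"
    and "int (card V) = 4 * q + 1 \<Longrightarrow> real (num_mds V) \<le> 19/24 * g (int (card V))"
    and "int (card V) = 4 * q + 2 \<Longrightarrow> real (num_mds V) \<le> 21/22 * g (int (card V))"
    and "int (card V) = 4 * q + 3 \<Longrightarrow> real (num_mds V) \<le> 22/27 * g (int (card V))"
proof -
  define n where "n = int (card V)"
  consider "real (num_mds V) \<le> max (g (n - 2) + g (n - 5) + 3 * g (n - 6)) (g (n - 3) + 4 * g (n - 5))"
    | "real (num_mds V) \<le> g (n - 2) + g (n - 4) + 2 * g (n - 5)"
    | "real (num_mds V) \<le> g (n - 3) + 2 * g (n - 4) + g (n - 5)"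
    | "real (num_mds V) \<le> g (n - 4) + 3 * g (n - 4)"
  proof (cases "deg V v = 3")
    case True
    show ?thesis
    proof (rule leaf_le3[OF fin h v u], goal_cases)
      case 1
      then show ?case using that(2) True by (simp add: n_def)
    next
      case (2 l)
      then have "l = 2 \<or> l = 3" using True by linarith
      then show ?case using that(3,4) 2(3) True by (auto simp: n_def)
    qed
  next
    case False
    then show ?thesis using leaf_ge4[OF fin h v u] d that(1) by (simp add: n_def)
  qed
  note c = this
  note p = g_pos[of n]
  show "real (num_mds V) \<le> 2/3 * g (int (card V))" if "int (card V) = 4 * q"
    unfolding n_def[symmetric]
    by (rule c; insert g_table0[OF that[folded n_def]] p; simp add: max_def split: if_splits)
  show "real (num_mds V) \<le> 19/24 * g (int (card V))" if "int (card V) = 4 * q + 1"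
    unfolding n_def[symmetric]
    by (rule c; insert g_table1[OF that[folded n_def]] p; simp add: max_def split: if_splits)
  show "real (num_mds V) \<le> 21/22 * g (int (card V))" if "int (card V) = 4 * q + 2"
    unfolding n_def[symmetric]
    by (rule c; insert g_table2[OF that[folded n_def]] p; simp add: max_def split: if_splits)
  show "real (num_mds V) \<le> 22/27 * g (int (card V))" if "int (card V) = 4 * q + 3"
    unfolding n_def[symmetric]
    by (rule c; insert g_table3[OF that[folded n_def]] p; simp add: max_def split: if_splits)
qed

lemma leaf2:
  assumes fin: "finite V" and h: "subsets_bounded V" and v: "v \<in> V" and nb: "nb V v = {u, w}" "u \<noteq> w"
    and u: "deg V u = 1" "deg V w \<noteq> 1"
  shows "real (num_mds V) \<le> g (int (card V) - 2) + g (int (card V) - 3) + g (int (card V) - 4)"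
proof -
  have d: "deg V v = 2" using nb by simp
  have "{x \<in> nb V v. deg V x = 1} = {u}" using nb u by auto
  then show ?thesis using leaf_num[OF fin h v, of "{u}"] d by simp
qed

section \<open>A vertex of degree at most one in residues 0 and 1\<close>

lemma low_cases:
  assumes fin: "finite V" and h: "subsets_bounded V" and x: "x \<in> V" "deg V x \<le> 1"
  obtains "real (num_mds V) \<le> g (int (card V) - 1)"
  | v where "v \<in> V" "x \<in> nb V v" "deg V x = 1" "3 \<le> deg V v"
  | "real (num_mds V) \<le> g (int (card V) - 2) + g (int (card V) - 3) + g (int (card V) - 4)"
  | "real (num_mds V) \<le> 3 * g (int (card V) - 3)"
  | "real (num_mds V) \<le> 2 * g (int (card V) - 2)"
proof (cases "deg V x = 0")
  case True
  then show ?thesis using isolated_num[OF fin h x(1)] that(1) by blast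
next
  case False
  then have d1: "deg V x = 1" using x by linarith
  then obtain v where nx: "nb V x = {v}" by (auto simp: card_1_singleton_iff)
  then have v: "v \<in> V" "x \<in> nb V v" using nb_sym[of v V x] x nb_subset[of V x] by auto
  have "deg V v \<noteq> 0" using v fin by auto
  then consider "deg V v = 1" | "deg V v = 2" | "3 \<le> deg V v" by linarith
  then show ?thesis
  proof cases
    case 1
    show ?thesis
      by (rule leaf_le3[OF fin h v d1]) (use 1 that(5) in auto)
  next
    case 2
    show ?thesis
    proof (rule leaf_le3[OF fin h v d1], goal_cases)
      case (2 l)
      then have "l = 2" using \<open>deg V v = 2\<close> by linarith
      then show ?case using 2 \<open>deg V v = 2\<close> that(4) by simp
    qed (use 2 that(3) in simp)
  next
    case 3
    then show ?thesis using that(2) v d1 by blast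
  qed
qed

text \<open>The worst case is a leaf whose neighbour has degree 2 and no second leaf: 11/36 + 2/9 +
  1/6 = 25/36. In residue 3, by contrast, a component P_3 can reach \<open>g n\<close>
  itself.\<close>

lemma low0:
  assumes fin: "finite V" and h: "subsets_bounded V" and x: "x \<in> V" "deg V x \<le> 1" and n: "int (card V) = 4 * q"
  shows "real (num_mds V) \<le> 25/36 * g (int (card V))"
proof -
  note t = g_table0[OF n] g_pos[of "int (card V)"]
  show ?thesis
    by (rule low_cases[OF fin h x]; (use t in simp)?) (use leaf3(1)[OF fin h _ _ _ _ n] t in fastforce)
qed

text \<open>The factor is that of \<open>leaf3\<close>; the other alternatives give at most
  37/48.\<close>

lemma low1:
  assumes fin: "finite V" and h: "subsets_bounded V" and x: "x \<in> V" "deg V x \<le> 1" and n: "int (card V) = 4 * q + 1"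
  shows "real (num_mds V) \<le> 19/24 * g (int (card V))"
proof -
  note t = g_table1[OF n] g_pos[of "int (card V)"]
  show ?thesis
    by (rule low_cases[OF fin h x]; (use t in simp)?) (use leaf3(2)[OF fin h _ _ _ _ n] t in fastforce)
qed

text \<open>Plain branching is enough since \<open>g (n - 1)\<close> is half of \<open>g n\<close>:
  1/2 + 1/6 + 3/12 = 11/12.\<close>

lemma S_residue0:
  assumes fin: "finite V" and h: "subsets_bounded V" and n: "int (card V) = 4 * q"
    and v: "v \<in> V" "3 \<le> deg V v" and d2: "\<And>x. x \<in> nb V v \<Longrightarrow> 2 \<le> deg V x"
  shows "real (num_mds V) \<le> 11/12 * g (int (card V))"
proof -
  let ?n = "int (card V)"
  note t = g_table0[OF n] g_pos[of ?n]
  have "real (num_mds (V - {v})) \<le> g (?n - 1)" by (rule num_mds_minus1[OF fin h v(1)])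
  moreover have "g (?n - 1 - int (deg V v)) \<le> g (?n - 4)" using v by (intro g_mono) auto
  moreover have "real (deg V v) * g (?n - 2 - int (deg V v)) \<le> real 3 * g (?n - 2 - int 3)"
    using v by (intro g_mult_decr) auto
  moreover have "real (num_mds V) \<le> real (num_mds (V - {v})) + g (?n - 1 - int (deg V v))
    + real (deg V v) * g (?n - int 2 - int (deg V v))"
    by (rule S_num_const[OF fin h v(1) d2])
  ultimately show ?thesis using t by simp
qed

text \<open>A new vertex contributes its degree once itself and once through its neighbours. The
  parity excludes cubic graphs in the residues 1 and 3.\<close>

lemma even_sum_deg:
  assumes "finite V"
  shows "even (\<Sum>v\<in>V. deg V v)"
  using assms
proof (induction V rule: finite_induct)
  case (insert x V)
  have "nb (insert x V) v = (if adj v x then insert x (nb V v) else nb V v)" for v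
    by (auto simp: nb_def)
  then have "deg (insert x V) v = deg V v + (if adj v x then 1 else 0)" for v
    using insert by (auto simp: card_insert_if nb_iff)
  then have "(\<Sum>v\<in>insert x V. deg (insert x V) v) = deg V x + (\<Sum>v\<in>V. deg V v) + (\<Sum>v\<in>V. if adj v x then 1 else 0)"
    using insert irrefl by (simp add: sum.distrib)
  also have "(\<Sum>v\<in>V. if adj v x then 1 else 0) = deg V x"
    using insert by (simp add: sum.If_cases nb_def Int_def) (metis (no_types, lifting) sym)
  finally show ?case using insert by simp
qed simp

lemma even_card_regular3:
  assumes "finite V" "\<And>v. v \<in> V \<Longrightarrow> deg V v = 3"
  shows "even (card V)"
  using even_sum_deg[OF assms(1)] assms(2) by simp

end

section \<open>Adjacent vertices of degree two\<close>

text \<open>The sum of \<open>path_rule\<close> for a path \<open>c\<close>, \<open>a\<close>,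
  \<open>v\<close>, \<open>b\<close> with inner vertices of degree 2 and non-adjacent ends:
  \<open>d\<close> and \<open>e\<close> are the degrees of \<open>c\<close> and \<open>b\<close>,
  and \<open>k\<close> counts their common neighbours. For \<open>d = e = 2\<close> it equals
  \<open>g n\<close> in residue 1 with \<open>k = 1\<close>, and is 67/66 of it in residue 2 with
  \<open>k = 0\<close>.\<close>

lemma path_numeric:
  fixes d e k :: nat
  assumes "2 \<le> d" "d \<le> 4" "2 \<le> e" "e \<le> 4" "\<not> (d = 2 \<and> e = 2)" "k \<le> e - 1" "k \<le> d - 1"
  shows "g (n - 4) + g (n - int (2 + d)) + g (n - int (2 + e)) + g (n - int (3 + e)) + g (n - int (3 + d))
      + (real (e - 1 - k) * g (n - int (e + 4)) + real k * g (n - int (e + 3)))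
      + (real (d - 1 - k) * g (n - int (d + 4)) + real k * g (n - int (d + 3)))
      + real (e - 1 - k) * (real (d - 1 - k) * g (n - int (d + e + 2 - k))) < g n" (is "?T d e k < g n")
proof -
  have r: "\<forall>d\<in>{2,3,4}. \<forall>e\<in>{2,3,4}. \<forall>k\<in>{0,1,2,3}. \<not> (d = 2 \<and> e = 2) \<longrightarrow> k \<le> e - 1 \<longrightarrow> k \<le> d - 1 \<longrightarrow> ?T d e k < g n"
  proof (cases n rule: residue4_cases)
    case (1 q)
    show ?thesis using g_pos[of n] by (simp add: g_table0[OF 1])
  next
    case (2 q)
    show ?thesis using g_pos[of n] by (simp add: g_table1[OF 2])
  next
    case (3 q)
    show ?thesis using g_pos[of n] by (simp add: g_table2[OF 3])
  next
    case (4 q)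
    show ?thesis using g_pos[of n] by (simp add: g_table3[OF 4])
  qed
  have "d \<in> {2,3,4}" "e \<in> {2,3,4}" "k \<in> {0,1,2,3}" using assms by auto
  then show ?thesis using r assms(5-7) by blast
qed

text \<open>The same with adjacent ends. For \<open>d = e = 2\<close> six summands
  \<open>g (n - 4)\<close> would remain, exactly \<open>g n\<close>: this is the 4-cycle
  component.\<close>

lemma path_adj_numeric:
  fixes d e :: nat
  assumes "2 \<le> d" "d \<le> 4" "2 \<le> e" "e \<le> 4" "\<not> (d = 2 \<and> e = 2)"
  shows "g (n - 4) + g (n - int (2 + d)) + g (n - int (2 + e)) + g (n - int (2 + e)) + g (n - int (2 + d))
      + real (e - 2) * g (n - int (e + 3)) + real (d - 2) * g (n - int (d + 3)) + g (n - int (e + d)) < g n" (is "?T d e < g n")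
proof -
  have r: "\<forall>d\<in>{2,3,4}. \<forall>e\<in>{2,3,4}. \<not> (d = 2 \<and> e = 2) \<longrightarrow> ?T d e < g n"
  proof (cases n rule: residue4_cases)
    case (1 q)
    show ?thesis using g_pos[of n] by (simp add: g_table0[OF 1])
  next
    case (2 q)
    show ?thesis using g_pos[of n] by (simp add: g_table1[OF 2])
  next
    case (3 q)
    show ?thesis using g_pos[of n] by (simp add: g_table2[OF 3])
  next
    case (4 q)
    show ?thesis using g_pos[of n] by (simp add: g_table3[OF 4])
  qed
  have "d \<in> {2,3,4}" "e \<in> {2,3,4}" using assms by auto
  then show ?thesis using r assms(5) by blast
qed

context tf_graph
begin

text \<open>Isolated in the subgraph induced by \<open>F\<close>, not in the graph on
  \<open>V\<close>.\<close>

abbreviation isolated :: "'a set \<Rightarrow> 'a set \<Rightarrow> 'a \<Rightarrow> bool" where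
  "isolated V F x \<equiv> x \<in> F \<and> nb V x \<inter> F = {}"

lemma sum_g_le:
  assumes "finite I" "card I = m" "\<And>i. i \<in> I \<Longrightarrow> y i \<le> z"
  shows "(\<Sum>i\<in>I. g (y i)) \<le> real m * g z"
  using sum_bounded_above[of I "\<lambda>i. g (y i)" "g z"] assms(2) g_mono[OF assms(3)] by simp

text \<open>If \<open>a\<close> is in \<open>F\<close> without a partner, then \<open>v\<close> can
  only be blocked through its other neighbour \<open>b\<close>, so \<open>b\<close> is in
  \<open>F\<close>; symmetrically for \<open>v\<close> and \<open>c\<close>. If neither
  \<open>a\<close> nor \<open>v\<close> is in \<open>F\<close>, then \<open>b\<close> and
  \<open>c\<close> are both in \<open>F\<close> with partners. The bounds \<open>x1\<close>,
  \<open>x2\<close>, \<open>z\<close> stay open because special cases improve them. The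
  \<open>if\<close> terms count \<open>c\<close> (or \<open>b\<close>), excluded by the isolation of
  \<open>a\<close> (or \<open>v\<close>), unless it is already among the deleted neighbours.\<close>

lemma path_rule:
  assumes fin: "finite V" and h: "subsets_bounded V" and V: "a \<in> V" "v \<in> V"
    and na: "nb V a = {c, v}" and nv: "nb V v = {a, b}" and ne: "a \<noteq> b" "c \<noteq> v" "b \<noteq> c"
    and x1: "count_le V (\<lambda>F. isolated V F a \<and> isolated V F b) x1" and x2: "count_le V (\<lambda>F. isolated V F v \<and> isolated V F c) x2"
    and z: "count_le V (\<lambda>F. a \<notin> F \<and> v \<notin> F \<and> b \<in> F \<and> c \<in> F \<and> (\<exists>b'\<in>nb V b. b' \<in> F) \<and> (\<exists>c'\<in>nb V c. c' \<in> F)) z"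
  shows "real (num_mds V) \<le> g (int (card V) - 4) + g (int (card V) - int (2 + deg V c)) + g (int (card V) - int (2 + deg V b))
    + x1 + x2
    + (\<Sum>b'\<in>nb V b - {v, c}. g (int (card V) - int (1 + (if c \<in> nb V b \<union> nb V b' then 0 else 1) + deg V b + deg V b')))
    + (\<Sum>c'\<in>nb V c - {a, b}. g (int (card V) - int (1 + (if b \<in> nb V c \<union> nb V c' then 0 else 1) + deg V c + deg V c')))
    + z"
proof (rule count_le_num_mds)
  let ?n = "int (card V)"
  have bc: "b \<in> V" "c \<in> V" using na nv nb_subset by blast+
  have adj: "adj a c" "adj a v" "adj v a" "adj v b" using na nv by (auto simp: nb_def)
  have nbr: "a \<in> nb V c" "v \<in> nb V b" using nb_sym na nv V by blast+
  have nab: "a \<notin> nb V b" using nb_sym[of a V b] bc na ne adj irrefl by auto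
  have nvc: "v \<notin> nb V c" using nb_sym[of v V c] bc nv ne adj irrefl by auto
  have nbb: "b \<notin> nb V b" "c \<notin> nb V c" using irrefl by (auto simp: nb_def)
  have d2: "deg V a = 2" "deg V v = 2" using na nv ne by auto
  have 1: "count_le V (\<lambda>F. a \<in> F \<and> v \<in> F) (g (?n - 4))"
    using cell_pair[OF fin h V adj(2)] d2 by simp
  have 2: "count_le V (\<lambda>F. a \<in> F \<and> c \<in> F) (g (?n - int (2 + deg V c)))"
    using cell_pair[OF fin h V(1) bc(2) adj(1)] d2 by simp
  have 3: "count_le V (\<lambda>F. v \<in> F \<and> b \<in> F) (g (?n - int (2 + deg V b)))"
    using cell_pair[OF fin h V(2) bc(1) adj(4)] d2 by simp
  have 4: "count_le V (\<lambda>F. isolated V F a \<and> b \<in> F \<and> b' \<in> F)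
      (g (?n - int (1 + (if c \<in> nb V b \<union> nb V b' then 0 else 1) + deg V b + deg V b')))"
    if b': "b' \<in> nb V b - {v, c}" for b'
  proof (rule cell[OF fin h, where I = "{a}" and J = "{b,b'}" and O' = "{}"
        and K = "insert a (if c \<in> nb V b \<union> nb V b' then nb V b \<union> nb V b' else insert c (nb V b \<union> nb V b'))"])
    have a: "adj b b'" "b' \<in> V" using b' by (auto simp: nb_def)
    have nab': "a \<notin> nb V b'" using nb_sym[of a V b'] a na b' by auto
    have ac: "a \<noteq> c" using adj irrefl by auto
    show "1 + (if c \<in> nb V b \<union> nb V b' then 0 else 1) + deg V b + deg V b' \<le>
      card (insert a (if c \<in> nb V b \<union> nb V b' then nb V b \<union> nb V b' else insert c (nb V b \<union> nb V b')))"
      using fin a nab nab' ac by (simp add: card_nb_Un)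
    fix x assume "x \<in> {b,b'}"
    then show "\<exists>w\<in>{b,b'}. adj x w" using a sym by auto
  qed (use V bc na nb_subset in auto)
  have 5: "count_le V (\<lambda>F. isolated V F v \<and> c \<in> F \<and> c' \<in> F)
      (g (?n - int (1 + (if b \<in> nb V c \<union> nb V c' then 0 else 1) + deg V c + deg V c')))"
    if c': "c' \<in> nb V c - {a, b}" for c'
  proof (rule cell[OF fin h, where I = "{v}" and J = "{c,c'}" and O' = "{}"
        and K = "insert v (if b \<in> nb V c \<union> nb V c' then nb V c \<union> nb V c' else insert b (nb V c \<union> nb V c'))"])
    have a: "adj c c'" "c' \<in> V" using c' by (auto simp: nb_def)
    have nvc': "v \<notin> nb V c'" using nb_sym[of v V c'] a nv c' by auto
    have ac: "v \<noteq> b" using adj irrefl by auto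
    show "1 + (if b \<in> nb V c \<union> nb V c' then 0 else 1) + deg V c + deg V c' \<le>
      card (insert v (if b \<in> nb V c \<union> nb V c' then nb V c \<union> nb V c' else insert b (nb V c \<union> nb V c')))"
      using fin a nvc nvc' ac by (simp add: card_nb_Un)
    fix x assume "x \<in> {c,c'}"
    then show "\<exists>w\<in>{c,c'}. adj x w" using a sym by auto
  qed (use V bc nv nb_subset in auto)
  let ?P = "\<lambda>F. ((((((a \<in> F \<and> v \<in> F \<or> a \<in> F \<and> c \<in> F) \<or> v \<in> F \<and> b \<in> F) \<or> isolated V F a \<and> isolated V F b) \<or> isolated V F v \<and> isolated V F c)
    \<or> (\<exists>b'\<in>nb V b - {v, c}. isolated V F a \<and> b \<in> F \<and> b' \<in> F))
    \<or> (\<exists>c'\<in>nb V c - {a, b}. isolated V F v \<and> c \<in> F \<and> c' \<in> F))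
    \<or> (a \<notin> F \<and> v \<notin> F \<and> b \<in> F \<and> c \<in> F \<and> (\<exists>b'\<in>nb V b. b' \<in> F) \<and> (\<exists>c'\<in>nb V c. c' \<in> F))"
  show "count_le V ?P (g (?n - 4) + g (?n - int (2 + deg V c)) + g (?n - int (2 + deg V b)) + x1 + x2
    + (\<Sum>b'\<in>nb V b - {v, c}. g (?n - int (1 + (if c \<in> nb V b \<union> nb V b' then 0 else 1) + deg V b + deg V b')))
    + (\<Sum>c'\<in>nb V c - {a, b}. g (?n - int (1 + (if b \<in> nb V c \<union> nb V c' then 0 else 1) + deg V c + deg V c')))
    + z)"
    by (intro count_le_or count_le_ex 1 2 3 4 5 x1 x2 z fin finite_nb finite_Diff)
  fix F assume F: "mds V F"
  note blk = mds_blocked'[OF F V(1)] mds_blocked'[OF F V(2)]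
  show "?P F"
  proof (cases "a \<in> F")
    case aF: True
    show ?thesis
    proof (cases "v \<in> F \<or> c \<in> F")
      case False
      then have ia: "isolated V F a" using aF na by auto
      have "b \<in> F" using blk(2) False na nv aF by auto
      moreover have "(\<exists>b'\<in>nb V b - {v, c}. b' \<in> F) \<or> nb V b \<inter> F = {}" using False by auto
      ultimately show ?thesis using ia by blast
    qed (use aF in auto)
  next
    case aF: False
    show ?thesis
    proof (cases "v \<in> F")
      case vF: True
      show ?thesis
      proof (cases "b \<in> F")
        case False
        then have ia: "isolated V F v" using aF vF nv by auto
        have "c \<in> F" using blk(1) aF False na nv vF by auto
        moreover have "(\<exists>c'\<in>nb V c - {a, b}. c' \<in> F) \<or> nb V c \<inter> F = {}" using False aF by auto
        ultimately show ?thesis using ia by blast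
      qed (use vF in auto)
    next
      case vF: False
      have "c \<in> F" "\<exists>c'\<in>nb V c. c' \<in> F" using blk(1) aF vF na nv by auto
      moreover have "b \<in> F" "\<exists>b'\<in>nb V b. b' \<in> F" using blk(2) aF vF na nv by auto
      ultimately show ?thesis using aF vF by blast
    qed
  qed
qed fact


text \<open>The two numerical lemmas settle all degrees up to 4 except \<open>d = e = 2\<close>.
  Adjacent ends of degree 2 would close a 4-cycle component, excluded by \<open>nc4\<close>; for
  non-adjacent ends the next vertices of the path decide.\<close>

lemma path_less:
  assumes fin: "finite V" and h: "subsets_bounded V" and V: "a \<in> V" "v \<in> V"
    and na: "nb V a = {c, v}" and nv: "nb V v = {a, b}" and ne: "a \<noteq> b" "c \<noteq> v" "b \<noteq> c"
    and d2: "\<And>x. x \<in> V \<Longrightarrow> 2 \<le> deg V x"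
    and d4: "deg V b \<le> 4" "deg V c \<le> 4"
    and nc4: "\<not> (deg V b = 2 \<and> deg V c = 2 \<and> c \<in> nb V b)"
  shows "real (num_mds V) < g (int (card V))"
proof -
  define n where "n = int (card V)"
  define d where "d = deg V c"
  define e where "e = deg V b"
  define C where "C = nb V b \<inter> nb V c"
  define k where "k = card C"
  have bc: "b \<in> V" "c \<in> V" using na nv nb_subset by blast+
  have adj: "adj a c" "adj a v" "adj v a" "adj v b" using na nv by (auto simp: nb_def)
  have nbr: "a \<in> nb V c" "v \<in> nb V b" using nb_sym na nv V by blast+
  have nbv: "b \<noteq> v" "c \<noteq> a" using adj irrefl by auto
  have nab: "a \<notin> nb V b" using nb_sym[of a V b] bc na ne nbv by auto
  have nvc: "v \<notin> nb V c" using nb_sym[of v V c] bc nv ne nbv by auto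
  have nbb: "b \<notin> nb V b" "c \<notin> nb V c" using irrefl by (auto simp: nb_def)
  have de: "2 \<le> d" "d \<le> 4" "2 \<le> e" "e \<le> 4" using d2[OF bc(1)] d2[OF bc(2)] d4 by (auto simp: d_def e_def)
  note [simp] = fin
  note rule = path_rule[OF fin h V na nv ne, folded n_def, folded d_def e_def]
  have num: ?thesis if "\<And>q. n = 4 * q \<Longrightarrow> real (num_mds V) < g n" "\<And>q. n = 4 * q + 1 \<Longrightarrow> real (num_mds V) < g n"
    "\<And>q. n = 4 * q + 2 \<Longrightarrow> real (num_mds V) < g n" "\<And>q. n = 4 * q + 3 \<Longrightarrow> real (num_mds V) < g n"
    using residue4_cases[of n] that unfolding n_def by metis
  show ?thesis
  proof (cases "c \<in> nb V b")
    case cb: True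
    then have bcn: "b \<in> nb V c" using nb_sym bc by auto
    have x1: "count_le V (\<lambda>F. isolated V F a \<and> isolated V F b) (g (n - int (2 + e)))"
      unfolding n_def
      by (rule cell[OF fin h, where I = "{a,b}" and J = "{}" and O' = "{}" and K = "{a,b} \<union> nb V b"])
        (use V bc nb_subset nab nbb ne in \<open>auto simp: e_def card_insert_if\<close>)
    have x2: "count_le V (\<lambda>F. isolated V F v \<and> isolated V F c) (g (n - int (2 + d)))"
      unfolding n_def
      by (rule cell[OF fin h, where I = "{v,c}" and J = "{}" and O' = "{}" and K = "{v,c} \<union> nb V c"])
        (use V bc nb_subset nvc nbb ne in \<open>auto simp: d_def card_insert_if\<close>)
    have "count_le V (\<lambda>F. b \<in> F \<and> c \<in> F) (g (n - int (e + d)))"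
      unfolding n_def d_def e_def by (rule cell_pair[OF fin h bc]) (use cb in \<open>simp add: nb_def\<close>)
    then have z: "count_le V (\<lambda>F. a \<notin> F \<and> v \<notin> F \<and> b \<in> F \<and> c \<in> F \<and> (\<exists>b'\<in>nb V b. b' \<in> F) \<and> (\<exists>c'\<in>nb V c. c' \<in> F)) (g (n - int (e + d)))"
      by (rule count_le_mono) auto
    have s1: "(\<Sum>b'\<in>nb V b - {v, c}. g (n - int (1 + (if c \<in> nb V b \<union> nb V b' then 0 else 1) + e + deg V b')))
        \<le> real (e - 2) * g (n - int (e + 3))"
    proof -
      have "card (nb V b - {v, c}) = e - 2" using nbr cb ne by (simp add: e_def card_Diff_subset)
      moreover have dd: "2 \<le> deg V b'" if "b' \<in> nb V b" for b' using d2 that nb_subset by blast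
      ultimately show ?thesis by (intro sum_g_le) (use dd cb in force)+
    qed
    have s2: "(\<Sum>c'\<in>nb V c - {a, b}. g (n - int (1 + (if b \<in> nb V c \<union> nb V c' then 0 else 1) + d + deg V c')))
        \<le> real (d - 2) * g (n - int (d + 3))"
    proof -
      have "card (nb V c - {a, b}) = d - 2" using nbr bcn ne by (simp add: d_def card_Diff_subset)
      moreover have dd: "2 \<le> deg V b'" if "b' \<in> nb V c" for b' using d2 that nb_subset by blast
      ultimately show ?thesis by (intro sum_g_le) (use dd bcn in force)+
    qed
    have T: "real (num_mds V) \<le> g (n - 4) + g (n - int (2 + d)) + g (n - int (2 + e)) + g (n - int (2 + e)) + g (n - int (2 + d))
      + real (e - 2) * g (n - int (e + 3)) + real (d - 2) * g (n - int (d + 3)) + g (n - int (e + d))"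
      using rule[OF x1 x2 z] s1 s2 by linarith
    have "\<not> (d = 2 \<and> e = 2)" using nc4 cb unfolding d_def e_def by blast
    then show ?thesis using T path_adj_numeric[OF de, of n] unfolding n_def by linarith
  next
    case cb: False
    then have bcn: "b \<notin> nb V c" using nb_sym[of b V c] bc by auto
    have vC: "v \<notin> C" "a \<notin> C" using nvc nab by (auto simp: C_def)
    have finC: "finite C" "C \<subseteq> nb V b - {v}" "C \<subseteq> nb V c - {a}" using vC by (auto simp: C_def)
    have cardb: "card (nb V b - {v} - C) = e - 1 - k" "card (nb V c - {a} - C) = d - 1 - k"
      using finC nbr by (simp_all add: card_Diff_subset e_def d_def k_def)
    have kle: "k \<le> e - 1" "k \<le> d - 1"
      using card_mono[OF _ finC(2)] card_mono[OF _ finC(3)] nbr by (simp_all add: k_def e_def d_def card_Diff_subset)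
    have x1: "count_le V (\<lambda>F. isolated V F a \<and> isolated V F b) (g (n - int (3 + e)))"
      unfolding n_def
      by (rule cell[OF fin h, where I = "{a,b}" and J = "{}" and O' = "{}" and K = "{a,b,c} \<union> nb V b"])
        (use V bc nb_subset nab nbb ne nbv cb na in \<open>auto simp: e_def card_insert_if\<close>)
    have x2: "count_le V (\<lambda>F. isolated V F v \<and> isolated V F c) (g (n - int (3 + d)))"
      unfolding n_def
      by (rule cell[OF fin h, where I = "{v,c}" and J = "{}" and O' = "{}" and K = "{v,c,b} \<union> nb V c"])
        (use V bc nb_subset nvc nbb ne nbv bcn nv in \<open>auto simp: d_def card_insert_if\<close>)
    have Cb: "c \<in> nb V b' \<longleftrightarrow> b' \<in> C" if "b' \<in> nb V b" for b'
      using that bc nb_sym[of b' V c] nb_sym[of c V b'] nb_subset[of V b] by (auto simp: C_def)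
    have Cc: "b \<in> nb V c' \<longleftrightarrow> c' \<in> C" if "c' \<in> nb V c" for c'
      using that bc nb_sym[of c' V b] nb_sym[of b V c'] nb_subset[of V c] by (auto simp: C_def)
    \<comment> \<open>A common neighbour of \<open>b\<close> and \<open>c\<close> cannot be the
      partner of either, because both are in \<open>F\<close>.\<close>
    have ZC: "b' \<notin> C \<and> c' \<notin> C" if F: "mds V F" "b \<in> F" "c \<in> F" "b' \<in> nb V b \<inter> F" "c' \<in> nb V c \<inter> F" for F b' c'
    proof -
      have "b' \<notin> C" using mds_unique[OF F(1), of b' b c] F(2-5) ne sym by (auto simp: C_def nb_def)
      moreover have "c' \<notin> C" using mds_unique[OF F(1), of c' b c] F(2-5) ne sym by (auto simp: C_def nb_def)
      ultimately show ?thesis by simp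
    qed
    have z1: "count_le V (\<lambda>F. a \<notin> F \<and> v \<notin> F \<and> b \<in> F \<and> c \<in> F \<and> b' \<in> F \<and> c' \<in> F) (g (n - int (d + e + 2 - k)))"
      if b': "b' \<in> nb V b" and c': "c' \<in> nb V c" for b' c'
      unfolding n_def
    proof (rule cell[OF fin h, where I = "{}" and J = "{b,b',c,c'}" and O' = "{a,v}" and K = "insert b (insert c (nb V b \<union> nb V c))"])
      have "card (nb V b \<union> nb V c) = d + e - k"
        using card_Un_Int[of "nb V b" "nb V c"] by (simp add: d_def e_def k_def C_def)
      then show "d + e + 2 - k \<le> card (insert b (insert c (nb V b \<union> nb V c)))"
        using nbb bcn cb ne by (simp add: card_insert_if)
      show "0 < d + e + 2 - k" using kle de by auto
      have "adj b b'" "adj c c'" using b' c' by (auto simp: nb_def)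
      then show "\<exists>w\<in>{b,b',c,c'}. adj x w" if "x \<in> {b,b',c,c'}" for x using that sym by auto
    qed (use bc nb_subset in auto)
    have z: "count_le V (\<lambda>F. a \<notin> F \<and> v \<notin> F \<and> b \<in> F \<and> c \<in> F \<and> (\<exists>b'\<in>nb V b. b' \<in> F) \<and> (\<exists>c'\<in>nb V c. c' \<in> F))
        (real (e - 1 - k) * (real (d - 1 - k) * g (n - int (d + e + 2 - k))))"
    proof (rule count_le_mono)
      show "count_le V (\<lambda>F. \<exists>b'\<in>nb V b - {v} - C. \<exists>c'\<in>nb V c - {a} - C. a \<notin> F \<and> v \<notin> F \<and> b \<in> F \<and> c \<in> F \<and> b' \<in> F \<and> c' \<in> F)
          (\<Sum>b'\<in>nb V b - {v} - C. \<Sum>c'\<in>nb V c - {a} - C. g (n - int (d + e + 2 - k)))"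
        by (intro count_le_ex z1 fin finite_Diff finite_nb) auto
      show "(\<Sum>b'\<in>nb V b - {v} - C. \<Sum>c'\<in>nb V c - {a} - C. g (n - int (d + e + 2 - k)))
          \<le> real (e - 1 - k) * (real (d - 1 - k) * g (n - int (d + e + 2 - k)))"
        using cardb by simp
      fix F assume F: "mds V F" and Z: "a \<notin> F \<and> v \<notin> F \<and> b \<in> F \<and> c \<in> F \<and> (\<exists>b'\<in>nb V b. b' \<in> F) \<and> (\<exists>c'\<in>nb V c. c' \<in> F)"
      then obtain b' c' where "b' \<in> nb V b" "b' \<in> F" "c' \<in> nb V c" "c' \<in> F" by blast
      then show "\<exists>b'\<in>nb V b - {v} - C. \<exists>c'\<in>nb V c - {a} - C. a \<notin> F \<and> v \<notin> F \<and> b \<in> F \<and> c \<in> F \<and> b' \<in> F \<and> c' \<in> F"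
        using ZC[OF F, of b' c'] Z by (intro bexI[of _ b'] bexI[of _ c']) auto
    qed (rule fin)
    define s1 where "s1 = (\<Sum>b'\<in>nb V b - {v, c}. g (n - int (1 + (if c \<in> nb V b \<union> nb V b' then 0 else 1) + e + deg V b')))"
    define s2 where "s2 = (\<Sum>c'\<in>nb V c - {a, b}. g (n - int (1 + (if b \<in> nb V c \<union> nb V c' then 0 else 1) + d + deg V c')))"
    have s1: "s1 = (\<Sum>b'\<in>nb V b - {v} - C. g (n - int (2 + e + deg V b'))) + (\<Sum>b'\<in>C. g (n - int (1 + e + deg V b')))"
    proof -
      have "nb V b - {v, c} = nb V b - {v}" using cb by auto
      then have "s1 = (\<Sum>b'\<in>nb V b - {v} - C. g (n - int (1 + (if c \<in> nb V b \<union> nb V b' then 0 else 1) + e + deg V b')))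
        + (\<Sum>b'\<in>C. g (n - int (1 + (if c \<in> nb V b \<union> nb V b' then 0 else 1) + e + deg V b')))"
        unfolding s1_def using finC by (simp add: sum.subset_diff)
      also have "(\<Sum>b'\<in>nb V b - {v} - C. g (n - int (1 + (if c \<in> nb V b \<union> nb V b' then 0 else 1) + e + deg V b')))
          = (\<Sum>b'\<in>nb V b - {v} - C. g (n - int (2 + e + deg V b')))"
        by (intro sum.cong) (use Cb cb in auto)
      also have "(\<Sum>b'\<in>C. g (n - int (1 + (if c \<in> nb V b \<union> nb V b' then 0 else 1) + e + deg V b')))
          = (\<Sum>b'\<in>C. g (n - int (1 + e + deg V b')))"
        by (intro sum.cong) (use Cb cb C_def in auto)
      finally show ?thesis .
    qed
    have s2: "s2 = (\<Sum>b'\<in>nb V c - {a} - C. g (n - int (2 + d + deg V b'))) + (\<Sum>b'\<in>C. g (n - int (1 + d + deg V b')))"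
    proof -
      have "nb V c - {a, b} = nb V c - {a}" using bcn by auto
      then have "s2 = (\<Sum>b'\<in>nb V c - {a} - C. g (n - int (1 + (if b \<in> nb V c \<union> nb V b' then 0 else 1) + d + deg V b')))
        + (\<Sum>b'\<in>C. g (n - int (1 + (if b \<in> nb V c \<union> nb V b' then 0 else 1) + d + deg V b')))"
        unfolding s2_def using finC by (simp add: sum.subset_diff)
      also have "(\<Sum>b'\<in>nb V c - {a} - C. g (n - int (1 + (if b \<in> nb V c \<union> nb V b' then 0 else 1) + d + deg V b')))
          = (\<Sum>b'\<in>nb V c - {a} - C. g (n - int (2 + d + deg V b')))"
        by (intro sum.cong) (use Cc bcn in auto)
      also have "(\<Sum>b'\<in>C. g (n - int (1 + (if b \<in> nb V c \<union> nb V b' then 0 else 1) + d + deg V b')))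
          = (\<Sum>b'\<in>C. g (n - int (1 + d + deg V b')))"
        by (intro sum.cong) (use Cc bcn C_def in auto)
      finally show ?thesis .
    qed
    have dd: "2 \<le> deg V b'" if "b' \<in> nb V b \<union> nb V c" for b' using d2 that nb_subset by blast
    have t1: "(\<Sum>b'\<in>nb V b - {v} - C. g (n - int (2 + e + deg V b'))) \<le> real (e - 1 - k) * g (n - int (e + 4))"
      by (intro sum_g_le cardb) (use dd in force)+
    have t2: "(\<Sum>b'\<in>nb V c - {a} - C. g (n - int (2 + d + deg V b'))) \<le> real (d - 1 - k) * g (n - int (d + 4))"
      by (intro sum_g_le cardb) (use dd in force)+
    have t3: "(\<Sum>b'\<in>C. g (n - int (1 + e + deg V b'))) \<le> real k * g (n - int (e + 3))"
      by (intro sum_g_le finC(1) k_def[symmetric]) (use dd C_def in force)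
    have t4: "(\<Sum>b'\<in>C. g (n - int (1 + d + deg V b'))) \<le> real k * g (n - int (d + 3))"
      by (intro sum_g_le finC(1) k_def[symmetric]) (use dd C_def in force)
    have T: "real (num_mds V) \<le> g (n - 4) + g (n - int (2 + d)) + g (n - int (2 + e)) + y1 + y2
      + (real (e - 1 - k) * g (n - int (e + 4)) + real k * g (n - int (e + 3)))
      + (real (d - 1 - k) * g (n - int (d + 4)) + real k * g (n - int (d + 3))) + y3"
      if "count_le V (\<lambda>F. isolated V F a \<and> isolated V F b) y1" "count_le V (\<lambda>F. isolated V F v \<and> isolated V F c) y2"
        "count_le V (\<lambda>F. a \<notin> F \<and> v \<notin> F \<and> b \<in> F \<and> c \<in> F \<and> (\<exists>b'\<in>nb V b. b' \<in> F) \<and> (\<exists>c'\<in>nb V c. c' \<in> F)) y3"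
      for y1 y2 y3
      using rule[OF that] s1 s2 t1 t2 t3 t4 unfolding s1_def s2_def by linarith
    show ?thesis
    proof (cases "d = 2 \<and> e = 2")
      case False
      show ?thesis using T[OF x1 x2 z] path_numeric[OF de False kle, of n] unfolding n_def by linarith
    next
      case True
      then have "card (nb V b - {v}) = 1" "card (nb V c - {a}) = 1" using nbr by (simp_all add: d_def e_def)
      then obtain b2 c2 where "nb V b - {v} = {b2}" "nb V c - {a} = {c2}" by (auto simp: card_1_singleton_iff)
      then have nbb2: "nb V b = {v, b2}" "v \<noteq> b2" and ncc2: "nb V c = {a, c2}" "a \<noteq> c2" using nbr by blast+
      have b2V: "b2 \<in> V" "c2 \<in> V" using nbb2 ncc2 nb_subset by blast+
      show ?thesis
      proof (cases "b2 = c2")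
        case False
        then have k0: "k = 0" using nbb2 ncc2 nvc nab by (auto simp: k_def C_def)
        \<comment> \<open>Six deleted vertices for \<open>z\<close> give 67/66 in residue 2, so a
          seventh is sought: a neighbour \<open>y\<close> of \<open>b2\<close> other than
          \<open>b\<close>. If \<open>y\<close> is \<open>c2\<close>, then \<open>b2\<close> would
          have two neighbours in \<open>F\<close>, and the case is empty.\<close>
        have "\<not> nb V b2 \<subseteq> {b}" using d2[OF b2V(1)] card_mono[of "{b}" "nb V b2"] by auto
        then obtain y where y: "y \<in> nb V b2" "y \<noteq> b" by auto
        have yV: "y \<in> V" and by2: "b2 \<in> nb V y" using y nb_subset nb_sym b2V by blast+
        have y': "y \<noteq> c" "y \<noteq> a" "y \<noteq> v"
          using by2 ncc2 na nv nab nbb2 False cb nbb by auto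
        have z7: "count_le V (\<lambda>F. a \<notin> F \<and> v \<notin> F \<and> b \<in> F \<and> c \<in> F \<and> (\<exists>b'\<in>nb V b. b' \<in> F) \<and> (\<exists>c'\<in>nb V c. c' \<in> F)) (g (n - int 7))"
        proof (cases "y = c2")
          case True
          have "b2 \<in> nb V b" using nbb2(1) by simp
          then have "adj b2 b" "adj b2 c2" using y True sym by (auto simp: nb_iff)
          moreover have "c2 \<noteq> b" using ncc2(1) bcn by auto
          ultimately have "\<not> (b \<in> F \<and> b2 \<in> F \<and> c2 \<in> F)" if F: "mds V F" for F
            using mds_unique[OF F, of b2 b c2] by auto
          moreover have "0 \<le> g (n - int 7)" using g_pos[of "n - int 7"] by simp
          ultimately show ?thesis using nbb2(1) ncc2(1) by (intro count_le_zero) auto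
        next
          case False2: False
          show ?thesis
            unfolding n_def
          proof (rule cell[OF fin h, where I = "{}" and J = "{b,b2,c,c2}" and O' = "{a,v}" and K = "{a,v,b,b2,c,c2,y}"])
            have "adj b b2" "adj c c2" using nbb2 ncc2 by (auto simp: nb_def)
            then show "\<exists>w\<in>{b,b2,c,c2}. adj x w" if "x \<in> {b,b2,c,c2}" for x using that sym by auto
            have "b2 \<noteq> a" "b2 \<noteq> b" "b2 \<noteq> c" "c2 \<noteq> v" "c2 \<noteq> c" "c2 \<noteq> b" "y \<noteq> b2" "a \<noteq> v"
              using nab nbb cb nvc bcn nbb2 ncc2 y irrefl adj by (auto simp: nb_iff)
            then show "7 \<le> card {a,v,b,b2,c,c2,y}"
              using False False2 y y' nbb2 ncc2 ne nbv by simp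
          qed (use V bc b2V yV y nbb2(1) ncc2(1) in auto)
        qed
        note T' = T[OF x1 x2 z7]
        show ?thesis
        proof (rule num)
          fix q
          show "real (num_mds V) < g n" if "n = 4 * q"
            using True k0 T' g_table0[OF that] g_pos[of n] by auto
          show "real (num_mds V) < g n" if "n = 4 * q + 1"
            using True k0 T' g_table1[OF that] g_pos[of n] by auto
          show "real (num_mds V) < g n" if "n = 4 * q + 2"
            using True k0 T' g_table2[OF that] g_pos[of n] by auto
          show "real (num_mds V) < g n" if "n = 4 * q + 3"
            using True k0 T' g_table3[OF that] g_pos[of n] by auto
        qed
      next
        case b2c2: True
        \<comment> \<open>Now \<open>c\<close>, \<open>a\<close>, \<open>v\<close>,
          \<open>b\<close>, \<open>b2\<close> form a 5-cycle. In residue 1 the sum is exactly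
          \<open>g n\<close>, so that residue is treated separately.\<close>
        have C1: "C = {b2}" using nbb2 ncc2 b2c2 nvc nab by (auto simp: C_def)
        then have k1: "k = 1" by (simp add: k_def)
        note T' = T[OF x1 x2 z]
        show ?thesis
        proof (rule num)
          fix q
          show "real (num_mds V) < g n" if "n = 4 * q"
            using True k1 T' g_table0[OF that] g_pos[of n] by auto
          show "real (num_mds V) < g n" if "n = 4 * q + 2"
            using True k1 T' g_table2[OF that] g_pos[of n] by auto
          show "real (num_mds V) < g n" if "n = 4 * q + 3"
            using True k1 T' g_table3[OF that] g_pos[of n] by auto
          show "real (num_mds V) < g n" if n1: "n = 4 * q + 1"
          proof (cases "deg V b2 = 2")
            case False
            then have "3 \<le> deg V b2" using d2[OF b2V(1)] by linarith
            then have "s1 \<le> g (n - 6)" "s2 \<le> g (n - 6)"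
              unfolding s1 s2 using nbb2 ncc2 b2c2 C1 True by (auto intro!: g_mono)
            then have "real (num_mds V) \<le> g (n - 4) + g (n - int (2 + d)) + g (n - int (2 + e)) + g (n - int (3 + e)) + g (n - int (3 + d))
              + g (n - 6) + g (n - 6) + (real (e - 1 - k) * (real (d - 1 - k) * g (n - int (d + e + 2 - k))))"
              using rule[OF x1 x2 z] unfolding s1_def s2_def by linarith
            then show ?thesis using True k1 g_table1[OF n1] g_pos[of n] by auto
          next
            case deg2: True
            have "b \<in> nb V b2" "c \<in> nb V b2" using nbb2(1) ncc2(1) b2c2 nb_sym[of b2 V b] nb_sym[of b2 V c] bc by auto
            then have nb2: "nb V b2 = {b, c}" using deg2 ne card_subset_eq[of "nb V b2" "{b,c}"] by simp
            \<comment> \<open>The 5-cycle is now a component. With \<open>a\<close> and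
              \<open>b\<close> isolated in \<open>F\<close>, both \<open>b2\<close> and
              \<open>c\<close> are outside \<open>F\<close> and \<open>b\<close> has no partner, so
              nothing would block \<open>b2\<close>.\<close>
            have y1: "count_le V (\<lambda>F. isolated V F a \<and> isolated V F b) 0"
            proof (rule count_le_zero)
              fix F assume F: "mds V F" "isolated V F a \<and> isolated V F b"
              then have "b2 \<notin> F" "c \<notin> F" using nbb2(1) na by auto
              then show False using mds_blocked'[OF F(1) b2V(1)] nb2 F(2) by auto
            qed simp
            have y2: "count_le V (\<lambda>F. isolated V F v \<and> isolated V F c) 0"
            proof (rule count_le_zero)
              fix F assume F: "mds V F" "isolated V F v \<and> isolated V F c"
              then have "b2 \<notin> F" "b \<notin> F" using ncc2(1) nv b2c2 by auto
              then show False using mds_blocked'[OF F(1) b2V(1)] nb2 F(2) by auto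
            qed simp
            show ?thesis using True k1 T[OF y1 y2 z] g_table1[OF n1] g_pos[of n] by auto
          qed
        qed
      qed
    qed
  qed
qed

section \<open>A vertex of degree two with two neighbours of degree three\<close>

text \<open>If \<open>u\<close> is outside \<open>F\<close>, something blocks it: \<open>a\<close>
  has a partner; or \<open>a\<close> is outside \<open>F\<close> and \<open>b\<close> has a partner;
  or \<open>a\<close> is isolated in \<open>F\<close>, and then \<open>b\<close> is in
  \<open>F\<close> too, isolated or with a partner that is no neighbour of \<open>a\<close>. In the
  second case \<open>a\<close> is one more deleted vertex unless the partner is adjacent to it; in
  the last one the new neighbours of \<open>w\<close> count as well.\<close>

lemma B_rule:
  assumes fin: "finite V" and h: "subsets_bounded V" and u: "u \<in> V" and nu: "nb V u = {a, b}" and ab: "a \<noteq> b"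
    and x0: "count_le V (\<lambda>F. isolated V F u) x0" and x1: "count_le V (\<lambda>F. isolated V F a \<and> isolated V F b) x1"
  shows "real (num_mds V) \<le> x0 + g (int (card V) - int (2 + deg V a)) + g (int (card V) - int (2 + deg V b))
    + (\<Sum>w\<in>nb V a - {u}. g (int (card V) - int (deg V a + deg V w)))
    + (\<Sum>w\<in>nb V b - {u}. g (int (card V) - int (deg V b + deg V w + (if w \<in> nb V a then 0 else 1))))
    + x1
    + (\<Sum>w\<in>nb V b - nb V a. g (int (card V) - int (deg V a + deg V b + 2 - card (nb V a \<inter> nb V b) + card (nb V w - nb V a - {b}))))"
proof (rule count_le_num_mds)
  let ?n = "int (card V)"
  let ?k = "\<lambda>w. deg V a + deg V b + 2 - card (nb V a \<inter> nb V b) + card (nb V w - nb V a - {b})"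
  have V: "a \<in> V" "b \<in> V" using nu nb_subset by blast+
  have adj: "adj u a" "adj u b" using nu by (auto simp: nb_def)
  have d2: "deg V u = 2" using nu ab by simp
  have nab: "a \<notin> nb V b" "b \<notin> nb V a" using adj tri[of u a b] tri[of u b a] by (auto simp: nb_def)
  have nbb: "b \<notin> nb V b" "a \<notin> nb V a" using irrefl by (auto simp: nb_def)
  have cardU: "card (nb V a \<union> nb V b) = deg V a + deg V b - card (nb V a \<inter> nb V b)"
    using card_Un_Int[of "nb V a" "nb V b"] fin by simp
  have cardI: "card (nb V a \<inter> nb V b) \<le> deg V a" using fin by (intro card_mono) auto
  have 1: "count_le V (\<lambda>F. u \<in> F \<and> a \<in> F) (g (?n - int (2 + deg V a)))"
    using cell_pair[OF fin h u V(1) adj(1)] d2 by simp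
  have 2: "count_le V (\<lambda>F. u \<in> F \<and> b \<in> F) (g (?n - int (2 + deg V b)))"
    using cell_pair[OF fin h u V(2) adj(2)] d2 by simp
  have 3: "count_le V (\<lambda>F. a \<in> F \<and> w \<in> F) (g (?n - int (deg V a + deg V w)))" if "w \<in> nb V a - {u}" for w
    using that by (intro cell_pair[OF fin h V(1)]) (auto simp: nb_def)
  have 4: "count_le V (\<lambda>F. a \<notin> F \<and> b \<in> F \<and> w \<in> F) (g (?n - int (deg V b + deg V w + (if w \<in> nb V a then 0 else 1))))"
    if w: "w \<in> nb V b - {u}" for w
  proof (rule cell[OF fin h, where I = "{}" and J = "{b,w}" and O' = "{a}"
        and K = "if w \<in> nb V a then nb V b \<union> nb V w else insert a (nb V b \<union> nb V w)"])
    have bw: "adj b w" "w \<in> V" using w by (auto simp: nb_def)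
    have naw: "w \<notin> nb V a \<Longrightarrow> a \<notin> nb V w" using nb_sym bw by blast
    show "deg V b + deg V w + (if w \<in> nb V a then 0 else 1) \<le>
        card (if w \<in> nb V a then nb V b \<union> nb V w else insert a (nb V b \<union> nb V w))"
      using fin bw nab naw by (simp add: card_nb_Un)
    have "u \<in> nb V b" using nb_sym nu u by blast
    then show "0 < deg V b + deg V w + (if w \<in> nb V a then 0 else 1)"
      using fin by (auto simp: card_gt_0_iff)
    show "\<exists>y\<in>{b,w}. adj x y" if "x \<in> {b,w}" for x using that bw sym by auto
  qed (use V nb_subset in auto)
  have 5: "count_le V (\<lambda>F. isolated V F a \<and> b \<in> F \<and> w \<in> F) (g (?n - int (?k w)))" if w: "w \<in> nb V b - nb V a" for w
  proof (rule cell[OF fin h, where I = "{a}" and J = "{b,w}" and O' = "{}"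
        and K = "insert a (insert b (nb V a \<union> nb V b)) \<union> (nb V w - nb V a - {b})"])
    have bw: "adj b w" "w \<in> V" using w by (auto simp: nb_def)
    have naw: "a \<notin> nb V w" using nb_sym[of a V w] bw w by auto
    have disj: "insert a (insert b (nb V a \<union> nb V b)) \<inter> (nb V w - nb V a - {b}) = {}"
      using naw nb_disjoint[OF bw(1)] by auto
    have "card (insert a (insert b (nb V a \<union> nb V b)) \<union> (nb V w - nb V a - {b}))
        = card (insert a (insert b (nb V a \<union> nb V b))) + card (nb V w - nb V a - {b})"
      by (rule card_Un_disjoint[OF _ _ disj]) (use fin in auto)
    also have "card (insert a (insert b (nb V a \<union> nb V b))) = 2 + card (nb V a \<union> nb V b)"
      using fin nab nbb ab by simp
    finally show "?k w \<le> card (insert a (insert b (nb V a \<union> nb V b)) \<union> (nb V w - nb V a - {b}))"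
      using cardU cardI by simp
    show "0 < ?k w" using cardI by simp
    show "\<exists>y\<in>{b,w}. adj x y" if "x \<in> {b,w}" for x using that bw sym by auto
  qed (use V nb_subset in auto)
  let ?P = "\<lambda>F. (((((isolated V F u \<or> u \<in> F \<and> a \<in> F) \<or> u \<in> F \<and> b \<in> F) \<or> (\<exists>w\<in>nb V a - {u}. a \<in> F \<and> w \<in> F))
    \<or> (\<exists>w\<in>nb V b - {u}. a \<notin> F \<and> b \<in> F \<and> w \<in> F)) \<or> isolated V F a \<and> isolated V F b)
    \<or> (\<exists>w\<in>nb V b - nb V a. isolated V F a \<and> b \<in> F \<and> w \<in> F)"
  show "count_le V ?P (x0 + g (int (card V) - int (2 + deg V a)) + g (int (card V) - int (2 + deg V b))
    + (\<Sum>w\<in>nb V a - {u}. g (int (card V) - int (deg V a + deg V w)))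
    + (\<Sum>w\<in>nb V b - {u}. g (int (card V) - int (deg V b + deg V w + (if w \<in> nb V a then 0 else 1))))
    + x1 + (\<Sum>w\<in>nb V b - nb V a. g (?n - int (?k w))))"
    by (intro count_le_or count_le_ex 1 2 3 4 5 x0 x1 fin finite_nb finite_Diff)
  fix F assume F: "mds V F"
  show "?P F"
  proof (cases "u \<in> F")
    case uF: False
    note blk = mds_blocked'[OF F u uF] 
    show ?thesis
    proof (cases "a \<in> F")
      case aF: True
      show ?thesis
      proof (cases "nb V a \<inter> F = {}")
        case ia: True
        have "b \<in> F" using blk nu ia by auto
        then show ?thesis using aF ia by blast
      next
        case False
        then show ?thesis using aF uF by blast
      qed
    next
      case aF: False
      then have "b \<in> F" "\<exists>w\<in>nb V b \<inter> F. w \<noteq> u" using blk nu by auto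
      then show ?thesis using aF by blast
    qed
  qed (use nu in auto)
qed fact

lemma B_iso_pair:
  assumes fin: "finite V" and h: "subsets_bounded V" and V: "a \<in> V" "b \<in> V" and ab: "a \<noteq> b" "a \<notin> nb V b"
  shows "count_le V (\<lambda>F. isolated V F a \<and> isolated V F b) (g (int (card V) - int (2 + card (nb V a \<union> nb V b))))"
proof (rule cell[OF fin h, where I = "{a,b}" and J = "{}" and O' = "{}" and K = "{a,b} \<union> (nb V a \<union> nb V b)"])
  have "a \<notin> nb V a" "b \<notin> nb V b" using irrefl by (auto simp: nb_def)
  moreover have "b \<notin> nb V a" using ab nb_sym V by blast
  ultimately show "2 + card (nb V a \<union> nb V b) \<le> card ({a,b} \<union> (nb V a \<union> nb V b))" using fin ab by simp
qed (use V nb_subset in auto)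

lemma count_le_iso:
  assumes fin: "finite V" and h: "subsets_bounded V" and u: "u \<in> V"
  shows "count_le V (\<lambda>F. isolated V F u) (g (int (card V) - int (1 + deg V u)))"
proof (rule cell[OF fin h, where I = "{u}" and J = "{}" and O' = "{}" and K = "insert u (nb V u)"])
  have "u \<notin> nb V u" using irrefl by (auto simp: nb_def)
  then show "1 + deg V u \<le> card (insert u (nb V u))" using fin by simp
qed (use u nb_subset in auto)

lemma count_le_iso_restrict:
  assumes fin: "finite V"
  shows "count_le V (\<lambda>F. isolated V F u) (num_mds (V - insert u (nb V u)))"
  by (rule count_le_restrict[OF fin, where S = "{u}"]) auto

text \<open>No neighbour of the twin \<open>w\<close> is in \<open>F\<close>, so nothing blocks
  \<open>w\<close>. In the counts this gains one deleted vertex.\<close>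

lemma iso_twin:
  assumes F: "mds V F" "isolated V F u" and w: "w \<in> V" "nb V w = nb V u"
  shows "isolated V F w"
proof -
  have "w \<in> F" using mds_blocked'[OF F(1) w(1)] F(2) w(2) by auto
  then show ?thesis using F(2) w(2) by simp
qed

lemma count_le_iso_twin_restrict:
  assumes fin: "finite V" and w: "w \<in> V" "nb V w = nb V u"
  shows "count_le V (\<lambda>F. isolated V F u) (num_mds (V - insert u (insert w (nb V u))))"
proof (rule count_le_restrict[OF fin, where S = "{u,w}"])
  fix F assume F: "mds V F" "isolated V F u"
  note iso_twin[OF F w]
  then show "F \<inter> insert u (insert w (nb V u)) = {u,w}" using F(2) by auto
qed (use w in auto)

lemma count_le_iso_twin:
  assumes fin: "finite V" and h: "subsets_bounded V" and u: "u \<in> V" and w: "w \<in> V" "nb V w = nb V u" "u \<noteq> w"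
  shows "count_le V (\<lambda>F. isolated V F u) (g (int (card V) - int (2 + deg V u)))"
proof (rule count_le_num_mds_mono[OF count_le_iso_twin_restrict[OF fin w(1,2)]])
  have "u \<notin> nb V u" "w \<notin> nb V u" using irrefl w(2)[symmetric] by (auto simp: nb_def)
  then show "real (num_mds (V - insert u (insert w (nb V u)))) \<le> g (int (card V) - int (2 + deg V u))"
    using w u nb_subset fin
    by (intro num_mds_Diff_le[OF fin h, where K = "insert u (insert w (nb V u))"]) auto
qed

text \<open>A component P_3 would give \<open>3 * g (n - 3)\<close>, which is \<open>g n\<close> in
  this residue; the condition \<open>y\<close> rules it out. The worst remaining case is 4/9 + 1/3 +
  1/6 = 17/18.\<close>

lemma leaf_residue3:
  assumes fin: "finite V" and h: "subsets_bounded V" and n: "int (card V) = 4 * q + 3" and v: "v \<in> V"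
    and u: "u \<in> nb V v" "deg V u = 1" and d: "2 \<le> deg V v"
    and y: "\<And>y. deg V v = 2 \<Longrightarrow> y \<in> nb V v - {u} \<Longrightarrow> deg V y \<noteq> 1"
  shows "real (num_mds V) \<le> 17/18 * g (int (card V))"
proof (cases "3 \<le> deg V v")
  case True
  then show ?thesis using leaf3(4)[OF fin h v u True n] g_pos[of "int (card V)"] by simp
next
  case False
  then have d2: "deg V v = 2" using d by simp
  then have "card (nb V v - {u}) = 1" using u fin by simp
  then obtain w where w: "nb V v - {u} = {w}" by (auto simp: card_1_singleton_iff)
  then have "nb V v = {u,w}" "u \<noteq> w" using u by auto
  then show ?thesis using leaf2[OF fin h v _ _ u(2), of w] y[OF d2, of w] w g_table3[OF n] by simp
qed

text \<open>Bundles the local picture at \<open>u\<close> with the situation left once adjacent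
  vertices of degree 2 have been handled, so that it can be invoked for other vertices and for
  induced subgraphs.\<close>

definition deg_2_3_3 :: "'a set \<Rightarrow> 'a \<Rightarrow> 'a \<Rightarrow> 'a \<Rightarrow> bool" where
  "deg_2_3_3 V u a b \<longleftrightarrow> finite V \<and> subsets_bounded V \<and> u \<in> V \<and> nb V u = {a, b} \<and> a \<noteq> b \<and> deg V a = 3 \<and> deg V b = 3 \<and>
    (\<forall>x\<in>V. 2 \<le> deg V x) \<and> (\<forall>x\<in>V. \<forall>y\<in>nb V x. \<not> (deg V x = 2 \<and> deg V y = 2))"

lemma deg_2_3_3_swap: "deg_2_3_3 V u a b \<Longrightarrow> deg_2_3_3 V u b a"
  by (auto simp: deg_2_3_3_def)

lemma cfgD:
  assumes "deg_2_3_3 V u a b"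
  shows "finite V" "subsets_bounded V" "u \<in> V" "a \<in> V" "b \<in> V" "nb V u = {a,b}" "a \<noteq> b" "deg V a = 3" "deg V b = 3"
    "u \<in> nb V a" "u \<in> nb V b" "deg V u = 2" "a \<notin> nb V b" "b \<notin> nb V a" "a \<noteq> u" "b \<noteq> u"
    "\<And>x. x \<in> V \<Longrightarrow> 2 \<le> deg V x"
    "\<And>x y. x \<in> V \<Longrightarrow> y \<in> nb V x \<Longrightarrow> deg V x = 2 \<Longrightarrow> deg V y = 2 \<Longrightarrow> False"
    "u \<notin> nb V u" "a \<notin> nb V a" "b \<notin> nb V b"
proof -
  show *: "finite V" "subsets_bounded V" "u \<in> V" "nb V u = {a,b}" "a \<noteq> b" "deg V a = 3" "deg V b = 3"
    "\<And>x. x \<in> V \<Longrightarrow> 2 \<le> deg V x" "\<And>x y. x \<in> V \<Longrightarrow> y \<in> nb V x \<Longrightarrow> deg V x = 2 \<Longrightarrow> deg V y = 2 \<Longrightarrow> False"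
    using assms by (auto simp: deg_2_3_3_def)
  show "a \<in> V" "b \<in> V" using *(4) nb_subset by blast+
  show "u \<in> nb V a" "u \<in> nb V b" using nb_sym *(3,4) by blast+
  show "deg V u = 2" using *(4,5) by simp
  have adj: "adj u a" "adj u b" using *(4) by (auto simp: nb_def)
  show "a \<notin> nb V b" "b \<notin> nb V a" using adj tri[of u a b] tri[of u b a] by (auto simp: nb_def)
  show "a \<noteq> u" "b \<noteq> u" using adj irrefl by auto
  show "u \<notin> nb V u" "a \<notin> nb V a" "b \<notin> nb V b" using irrefl by (auto simp: nb_def)
qed

lemma deg_2_3_3_x0: "deg_2_3_3 V u a b \<Longrightarrow> count_le V (\<lambda>F. isolated V F u) (g (int (card V) - 3))"
  using count_le_iso[of V u] cfgD(1-3,12)[of V u a b] by fastforce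

text \<open>The digit in \<open>cfg3\<close>, \<open>cfg2\<close>, \<open>cfg1\<close> is the number
  of common neighbours of \<open>a\<close> and \<open>b\<close>, counting \<open>u\<close>. With
  three, every neighbour of \<open>b\<close> is one of \<open>a\<close>, so the last sum of
  \<open>B_rule\<close> is empty.\<close>

lemma cfg3:
  assumes c: "deg_2_3_3 V u a b" and na: "nb V a = {u,w,w'}" and nb: "nb V b = {u,w,w'}"
    and x0: "count_le V (\<lambda>F. isolated V F u) x0" and x1: "count_le V (\<lambda>F. isolated V F a \<and> isolated V F b) x1"
  shows "real (num_mds V) \<le> x0 + 2 * g (int (card V) - 5) + 2 * g (int (card V) - 3 - int (deg V w))
    + 2 * g (int (card V) - 3 - int (deg V w')) + x1"
proof -
  note d = cfgD[OF c]
  have "w \<noteq> w'" "w \<noteq> u" "w' \<noteq> u" using d(8) na by (auto simp: card_insert_if split: if_splits)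
  then show ?thesis using B_rule[OF d(1-3,6,7) x0 x1] d(8,9) na nb by (simp add: insert_Diff_if algebra_simps)
qed

text \<open>The asymmetric hypothesis \<open>dd\<close> provides a neighbour of \<open>w2\<close>
  that is not yet counted, which turns the last summand into \<open>g (n - 7)\<close>.\<close>

lemma cfg2:
  assumes c: "deg_2_3_3 V u a b" and na: "nb V a = {u,w,w1}" and nb: "nb V b = {u,w,w2}" and w12: "w1 \<noteq> w2"
    and x0: "count_le V (\<lambda>F. isolated V F u) x0"
    and dd: "deg V w2 = 2 \<Longrightarrow> deg V w1 = 2"
  shows "real (num_mds V) \<le> x0 + 2 * g (int (card V) - 5) + 2 * g (int (card V) - 3 - int (deg V w))
    + g (int (card V) - 3 - int (deg V w1)) + g (int (card V) - 4 - int (deg V w2)) + g (int (card V) - 6)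
    + g (int (card V) - 7)"
proof -
  note d = cfgD[OF c]
  have ne: "w \<noteq> w1" "w \<noteq> u" "w1 \<noteq> u" using d(8) na by (auto simp: card_insert_if split: if_splits)
  have ne2: "w \<noteq> w2" "w2 \<noteq> u" using d(9) nb by (auto simp: card_insert_if split: if_splits)
  have U: "nb V a \<union> nb V b = {u,w,w1,w2}" "nb V a \<inter> nb V b = {u,w}" using na nb ne ne2 w12 by auto
  have x1: "count_le V (\<lambda>F. isolated V F a \<and> isolated V F b) (g (int (card V) - 6))"
    using B_iso_pair[OF d(1,2,4,5,7,13)] U ne ne2 w12 by simp
  have "w2 \<in> nb V b" "w \<in> nb V a" "w1 \<in> nb V a" using nb na by auto
  then have w2V: "w2 \<in> V" "b \<in> nb V w2" "w \<in> V" "w1 \<in> V" "adj b w2"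
    using nb_sym[of w2 V b] d(5) by (auto simp: nb_iff)
  have nbw2: "w \<notin> nb V w2" "u \<notin> nb V w2"
    using nb_disjoint[OF w2V(5), of V] nb by auto
  \<comment> \<open>Otherwise \<open>w2\<close> is joined to \<open>b\<close> and \<open>w1\<close>
    only. It then has degree 2, hence so has \<open>w1\<close> by \<open>dd\<close>, but adjacent
    vertices of degree 2 are excluded.\<close>
  have core_C4_union: "1 \<le> card (nb V w2 - nb V a - {b})"
  proof (rule ccontr)
    assume "\<not> ?thesis"
    then have "nb V w2 - nb V a - {b} = {}" using d(1) by (simp add: not_le)
    then have sub: "nb V w2 \<subseteq> {b, w1}" using na nbw2 by auto
    then have "deg V w2 \<le> 2" using card_mono[OF _ sub] by (simp add: card_insert_if split: if_splits)
    then have d2: "deg V w2 = 2" using d(17)[OF w2V(1)] by simp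
    have "w1 \<in> nb V w2"
    proof (rule ccontr)
      assume "w1 \<notin> nb V w2"
      then have "nb V w2 \<subseteq> {b}" using sub by auto
      then show False using card_mono[of "{b}" "nb V w2"] d2 by simp
    qed
    then show False using d(18)[OF w2V(1)] d2 dd by blast
  qed
  have "real (num_mds V) \<le> x0 + g (int (card V) - 5) + g (int (card V) - 5)
      + (g (int (card V) - 3 - int (deg V w)) + g (int (card V) - 3 - int (deg V w1)))
      + (g (int (card V) - 3 - int (deg V w)) + g (int (card V) - 4 - int (deg V w2)))
      + g (int (card V) - 6) + g (int (card V) - int (6 + card (nb V w2 - nb V a - {b})))"
    using B_rule[OF d(1-3,6,7) x0 x1] d(8,9) U(2) na nb ne ne2 w12 by (simp add: insert_Diff_if algebra_simps)
  also have "g (int (card V) - int (6 + card (nb V w2 - nb V a - {b}))) \<le> g (int (card V) - 7)"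
    using core_C4_union by (intro g_mono) simp
  finally show ?thesis by simp
qed

text \<open>The new neighbours of \<open>w3\<close> and \<open>w4\<close> remain as cardinalities,
  since their number depends on the surroundings.\<close>

lemma cfg1:
  assumes c: "deg_2_3_3 V u a b" and na: "nb V a = {u,w1,w2}" and nb: "nb V b = {u,w3,w4}"
    and w12: "{w1,w2} \<inter> {w3,w4} = {}"
    and x0: "count_le V (\<lambda>F. isolated V F u) x0"
  shows "real (num_mds V) \<le> x0 + 2 * g (int (card V) - 5)
    + g (int (card V) - 3 - int (deg V w1)) + g (int (card V) - 3 - int (deg V w2))
    + g (int (card V) - 4 - int (deg V w3)) + g (int (card V) - 4 - int (deg V w4)) + g (int (card V) - 7)
    + g (int (card V) - 7 - int (card (nb V w3 - {b,w1,w2}))) + g (int (card V) - 7 - int (card (nb V w4 - {b,w1,w2})))"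
proof -
  note d = cfgD[OF c]
  have ne: "w2 \<noteq> w1" "w2 \<noteq> u" "w1 \<noteq> u" using d(8) na by (auto simp: card_insert_if split: if_splits)
  have ne2: "w3 \<noteq> w4" "w4 \<noteq> u" "w3 \<noteq> u" using d(9) nb by (auto simp: card_insert_if split: if_splits)
  have ne3: "w1 \<noteq> w3" "w1 \<noteq> w4" "w2 \<noteq> w3" "w2 \<noteq> w4" "w3 \<noteq> w1" "w4 \<noteq> w1" "w3 \<noteq> w2" "w4 \<noteq> w2" using w12 by auto
  have U: "nb V a \<union> nb V b = {u,w1,w2,w3,w4}" "nb V a \<inter> nb V b = {u}" using na nb ne ne2 w12 by auto
  have x1: "count_le V (\<lambda>F. isolated V F a \<and> isolated V F b) (g (int (card V) - 7))"
    using B_iso_pair[OF d(1,2,4,5,7,13)] U ne ne2 ne3 by simp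
  have "u \<notin> nb V w3" "u \<notin> nb V w4" using nb_sym[of u V w3] nb_sym[of u V w4] nb nb_subset[of V b] d(6,13,21) by auto
  then have e: "nb V w3 - {u, w1, w2} - {b} = nb V w3 - {b,w1,w2}" "nb V w4 - {u, w1, w2} - {b} = nb V w4 - {b,w1,w2}" by auto
  have "nb V b - nb V a = {w3,w4}" "nb V a - {u} = {w1,w2}" "nb V b - {u} = {w3,w4}" using na nb ne ne2 ne3 by auto
  then show ?thesis using B_rule[OF d(1-3,6,7) x0 x1] d(8,9) U(2) ne ne2 ne3 e na by (simp add: algebra_simps)
qed

lemma nbD: "u \<in> nb V v \<Longrightarrow> v \<in> V \<Longrightarrow> u \<in> V \<and> v \<in> nb V u \<and> adj v u \<and> adj u v"
  by (auto simp: nb_def sym)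

lemma nb_triangle: "x \<in> nb V y \<Longrightarrow> z \<in> nb V y \<Longrightarrow> y \<in> V \<Longrightarrow> x \<notin> nb V z"
  using tri[of y x z] tri[of y z x] by (auto simp: nb_def)

text \<open>A common neighbour of degree 2 is thus a twin of any other one, which makes
  \<open>iso_twin\<close> applicable.\<close>

lemma twin_nb:
  assumes "finite V" "w \<in> nb V a" "w \<in> nb V b" "a \<in> V" "b \<in> V" "a \<noteq> b" "deg V w = 2"
  shows "nb V w = {a,b}"
proof -
  have "{a,b} \<subseteq> nb V w" using assms nb_sym by auto
  then show ?thesis using card_subset_eq[of "nb V w" "{a,b}"] assms by auto
qed

text \<open>The symmetries, exchanging \<open>a\<close> with \<open>b\<close> and renaming their
  neighbours, are used up here once and for all: degree 2 is pushed to fixed positions, so that few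
  degree patterns remain.\<close>

lemma deg_2_3_3_cases:
  assumes c: "deg_2_3_3 V u a b"
  obtains (c3) w w' where "nb V a = {u,w,w'}" "nb V b = {u,w,w'}"
  | (c2) a' b' w w1 w2 where "deg_2_3_3 V u a' b'" "nb V a' = {u,w,w1}" "nb V b' = {u,w,w2}" "w1 \<noteq> w2"
      "deg V w2 = 2 \<Longrightarrow> deg V w1 = 2" "{a',b'} = {a,b}"
  | (c1) a' b' w1 w2 w3 w4 where "deg_2_3_3 V u a' b'" "nb V a' = {u,w1,w2}" "nb V b' = {u,w3,w4}"
      "{w1,w2} \<inter> {w3,w4} = {}" "deg V w2 = 2 \<Longrightarrow> deg V w1 = 2" "deg V w4 = 2 \<Longrightarrow> deg V w3 = 2"
      "deg V w3 = 2 \<Longrightarrow> deg V w1 = 2" "deg V w4 = 2 \<Longrightarrow> deg V w2 = 2" "{a',b'} = {a,b}"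
proof -
  note d = cfgD[OF c]
  have "card (nb V a - {u}) = 2" "card (nb V b - {u}) = 2" using d(8-11) d(1) by simp_all
  then obtain p q r s where pq: "nb V a - {u} = {p,q}" "p \<noteq> q" and rs: "nb V b - {u} = {r,s}" "r \<noteq> s"
    by (auto simp: card_2_iff)
  have A: "nb V a = {u,p,q}" and B: "nb V b = {u,r,s}" using pq rs d(10,11) by auto
  show ?thesis
  proof (cases "{p,q} \<inter> {r,s} = {}")
    case True
    \<comment> \<open>With the degree-2 neighbours listed first on both sides, each side is
      described by how many there are. These numbers are comparable, and a side with no more than
      the other is named \<open>b'\<close>.\<close>
    have sorted: ?thesis if A: "nb V a = {u,p,q}" and B: "nb V b = {u,r,s}" and D: "{p,q} \<inter> {r,s} = {}"
      and o: "deg V q = 2 \<Longrightarrow> deg V p = 2" "deg V s = 2 \<Longrightarrow> deg V r = 2" for p q r s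
    proof (cases "(deg V r = 2 \<longrightarrow> deg V p = 2) \<and> (deg V s = 2 \<longrightarrow> deg V q = 2)")
      case True
      then show ?thesis using c1[OF c A B D] o by blast
    next
      case False
      then have "(deg V p = 2 \<longrightarrow> deg V r = 2) \<and> (deg V q = 2 \<longrightarrow> deg V s = 2)" using o by blast
      then show ?thesis using c1[OF deg_2_3_3_swap[OF c] B A] D o by blast
    qed
    have A': "nb V a = {u,q,p}" "nb V b = {u,s,r}" using A B by auto
    consider "(deg V q = 2 \<longrightarrow> deg V p = 2) \<and> (deg V s = 2 \<longrightarrow> deg V r = 2)"
      | "(deg V q = 2 \<longrightarrow> deg V p = 2) \<and> (deg V r = 2 \<longrightarrow> deg V s = 2)"
      | "(deg V p = 2 \<longrightarrow> deg V q = 2) \<and> (deg V s = 2 \<longrightarrow> deg V r = 2)"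
      | "(deg V p = 2 \<longrightarrow> deg V q = 2) \<and> (deg V r = 2 \<longrightarrow> deg V s = 2)" by blast
    then show ?thesis
    proof cases
      case 1 then show ?thesis using sorted[OF A B] True by blast
    next
      case 2 then show ?thesis using sorted[OF A A'(2)] True by blast
    next
      case 3 then show ?thesis using sorted[OF A'(1) B] True by blast
    next
      case 4 then show ?thesis using sorted[OF A'(1) A'(2)] True by blast
    qed
  next
    case False
    have two: ?thesis if A: "nb V a = {u,w,w1}" and B: "nb V b = {u,w,w2}" for w w1 w2
    proof (cases "w1 = w2")
      case True
      then show ?thesis using c3 A B by blast
    next
      case False
      show ?thesis
      proof (cases "deg V w2 = 2 \<longrightarrow> deg V w1 = 2")
        case True
        then show ?thesis using c2[OF c A B False] by blast
      next
        case f2: False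
        then show ?thesis using c2[OF deg_2_3_3_swap[OF c] B A] False by blast
      qed
    qed
    have A': "nb V a = {u,q,p}" "nb V b = {u,s,r}" using A B by auto
    consider "p = r" | "p = s" | "q = r" | "q = s" using False by auto
    then show ?thesis
      using two[of p q s] two[of p q r] two[of q p s] two[of q p r] A B A' by cases auto
  qed
qed

text \<open>Since \<open>w\<close> is a twin of \<open>u\<close>, isolating \<open>u\<close> puts
  \<open>w\<close> into \<open>F\<close> too, so four vertices are deleted instead of three.\<close>

lemma cfg3_twin:
  assumes c: "deg_2_3_3 V u a b" and na: "nb V a = {u,w,w'}" and nb: "nb V b = {u,w,w'}" and w: "deg V w = 2"
  shows "real (num_mds V) \<le> g (int (card V) - 4) + 5 * g (int (card V) - 5) + 2 * g (int (card V) - 3 - int (deg V w'))"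
proof -
  note d = cfgD[OF c]
  have wu: "u \<noteq> w" "u \<noteq> w'" "w \<noteq> w'" using d(8) na by (auto simp: card_insert_if split: if_splits)
  have w': "w \<in> nb V a" "w \<in> nb V b" using na nb by auto
  then have nw: "nb V w = nb V u" using twin_nb[OF d(1) w' d(4,5,7) w] d(6) by simp
  have x0: "count_le V (\<lambda>F. isolated V F u) (g (int (card V) - 4))"
    using count_le_iso_twin[OF d(1-3), of w] nw w' wu d(12) nbD[OF w'(1) d(4)] by simp
  have x1: "count_le V (\<lambda>F. isolated V F a \<and> isolated V F b) (g (int (card V) - 5))"
    using B_iso_pair[OF d(1,2,4,5,7,13)] na nb wu by simp
  show ?thesis using cfg3[OF c na nb x0 x1] w by simp
qed

lemma cfg3_x1:
  assumes c: "deg_2_3_3 V u a b" and na: "nb V a = {u,w,w'}" and nb: "nb V b = {u,w,w'}"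
  shows "count_le V (\<lambda>F. isolated V F a \<and> isolated V F b) (g (int (card V) - 5))"
proof -
  note d = cfgD[OF c]
  have wu: "u \<noteq> w" "u \<noteq> w'" "w \<noteq> w'" using d(8) na by (auto simp: card_insert_if split: if_splits)
  show ?thesis using B_iso_pair[OF d(1,2,4,5,7,13)] na nb wu by simp
qed

lemma cfg2_twin:
  assumes c: "deg_2_3_3 V u a b" and na: "nb V a = {u,w,w1}" and nb: "nb V b = {u,w,w2}" and w: "deg V w = 2"
  shows "nb V w = nb V u" "w \<in> V" "count_le V (\<lambda>F. isolated V F u) (g (int (card V) - 4))"
proof -
  note d = cfgD[OF c]
  have wu: "u \<noteq> w" using d(8) na by (auto simp: card_insert_if split: if_splits)
  have w': "w \<in> nb V a" "w \<in> nb V b" using na nb by auto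
  then show nw: "nb V w = nb V u" using twin_nb[OF d(1) w' d(4,5,7) w] d(6) by simp
  show wV: "w \<in> V" using nbD[OF w'(1) d(4)] by simp
  show "count_le V (\<lambda>F. isolated V F u) (g (int (card V) - 4))"
    using count_le_iso_twin[OF d(1-3) wV nw wu] d(12) by simp
qed

lemma core_C4_union_ge1:
  assumes "finite V" "2 \<le> deg V w" "w1 \<notin> nb V w" "w2 \<notin> nb V w"
  shows "1 \<le> card (nb V w - {b,w1,w2})"
proof -
  have "nb V w - {b,w1,w2} = nb V w - {b}" using assms by auto
  then show ?thesis using assms(1,2) card_Diff1_le[of "nb V w" b] by (cases "b \<in> nb V w") auto
qed

lemma deg_2_3_3_nbr_deg:
  assumes c: "deg_2_3_3 V u a b" and "w \<in> nb V a \<or> w \<in> nb V b"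
  shows "2 \<le> deg V w" "w \<in> V"
  using assms(2) nbD[of w V a] nbD[of w V b] cfgD[OF c] by auto

text \<open>The largest case is two common neighbours with \<open>w\<close> of degree 2: 1/6 + 5/8 +
  2/16 + 11/288 = 275/288. A fixed factor is required because the bound is applied to
  \<open>V - {v}\<close> for a graph of residue 2. The excluded configuration is a component
  K_{2,3}.\<close>

lemma B_residue1:
  assumes c: "deg_2_3_3 V u a b" and n: "int (card V) = 4 * q + 1"
    and no: "\<not> (nb V a = nb V b \<and> (\<forall>x\<in>nb V a. deg V x = 2))"
  shows "real (num_mds V) \<le> 275/288 * g (int (card V))"
proof -
  define n where "n = int (card V)"
  note t = g_table1[OF n, folded n_def] g_pos[of n]
  have gd: "g (n - k - int (deg V w)) \<le> g (n - k - int j)" if "j \<le> deg V w" for k w j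
    using that by (intro g_mono) auto
  show ?thesis unfolding n_def[symmetric]
  proof (cases rule: deg_2_3_3_cases[OF c])
    case (1 w w')
    have dw: "2 \<le> deg V w" "2 \<le> deg V w'" using deg_2_3_3_nbr_deg(1)[OF c] 1 by auto
    consider "deg V w = 2" "3 \<le> deg V w'" | "deg V w' = 2" "3 \<le> deg V w" | "3 \<le> deg V w" "3 \<le> deg V w'"
      using no 1 cfgD(12)[OF c] dw by fastforce
    then show "real (num_mds V) \<le> 275/288 * g n"
    proof cases
      case a: 1
      then show ?thesis using cfg3_twin[OF c 1 a(1), folded n_def] gd[OF a(2), of 3] t by simp
    next
      case a: 2
      have p1: "nb V a = {u,w',w}" "nb V b = {u,w',w}" using 1 by auto
      show ?thesis using cfg3_twin[OF c p1 a(1), folded n_def] gd[OF a(2), of 3] t by simp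
    next
      case a: 3
      show ?thesis using cfg3[OF c 1 deg_2_3_3_x0[OF c] cfg3_x1[OF c 1], folded n_def] gd[OF a(1), of 3] gd[OF a(2), of 3] t by simp
    qed
  next
    case (2 a' b' w w1 w2)
    have dw: "2 \<le> deg V w" "2 \<le> deg V w1" "2 \<le> deg V w2" using deg_2_3_3_nbr_deg(1)[OF 2(1)] 2(2,3) by auto
    show "real (num_mds V) \<le> 275/288 * g n"
    proof (cases "deg V w = 2")
      case True
      note T = cfg2[OF 2(1-4) cfg2_twin(3)[OF 2(1-3) True] 2(5), folded n_def]
      show ?thesis using T True gd[OF dw(2), of 3] gd[OF dw(3), of 4] t by simp
    next
      case False
      then have "3 \<le> deg V w" using dw by simp
      note T = cfg2[OF 2(1-4) deg_2_3_3_x0[OF 2(1)] 2(5), folded n_def]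
      show ?thesis using T gd[OF \<open>3 \<le> deg V w\<close>, of 3] gd[OF dw(2), of 3] gd[OF dw(3), of 4] t by simp
    qed
  next
    case (3 a' b' w1 w2 w3 w4)
    have dw: "2 \<le> deg V w1" "2 \<le> deg V w2" "2 \<le> deg V w3" "2 \<le> deg V w4"
      and V: "w3 \<in> V" "w4 \<in> V" using deg_2_3_3_nbr_deg[OF 3(1)] 3(2,3) by auto
    note d = cfgD[OF 3(1)]
    note T = cfg1[OF 3(1-4) deg_2_3_3_x0[OF 3(1)], folded n_def]
    show "real (num_mds V) \<le> 275/288 * g n"
    proof (cases "deg V w4 = 2")
      case True
      then have all: "deg V w3 = 2" "deg V w1 = 2" "deg V w2 = 2" using 3 by auto
      have "1 \<le> card (nb V w3 - {b',w1,w2})" "1 \<le> card (nb V w4 - {b',w1,w2})"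
        using core_C4_union_ge1[OF d(1)] d(18)[OF V(1)] d(18)[OF V(2)] all True dw by blast+
      then have "g (n - 7 - int (card (nb V w3 - {b',w1,w2}))) \<le> g (n - 8)"
        "g (n - 7 - int (card (nb V w4 - {b',w1,w2}))) \<le> g (n - 8)" by (auto intro!: g_mono)
      then show ?thesis using T all True t by simp
    next
      case False
      then have w4: "3 \<le> deg V w4" using dw by simp
      have "g (n - 7 - int (card (nb V w3 - {b',w1,w2}))) \<le> g (n - 7)"
        "g (n - 7 - int (card (nb V w4 - {b',w1,w2}))) \<le> g (n - 7)" by (auto intro!: g_mono)
      then show ?thesis using T gd[OF dw(1), of 3] gd[OF dw(2), of 3] gd[OF dw(3), of 4] gd[OF w4, of 4] t by simp
    qed
  qed
qed

text \<open>The sets in which \<open>u\<close> is isolated restrict to \<open>H\<close>. Its count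
  improves on \<open>g (n - 3)\<close> when \<open>H\<close> has a vertex of small degree.\<close>

lemma deg_2_3_3_H:
  assumes c: "deg_2_3_3 V u a b"
  defines "H \<equiv> V - insert u (nb V u)"
  shows "finite H" "subsets_bounded H" "int (card H) = int (card V) - 3" "count_le V (\<lambda>F. isolated V F u) (num_mds H)"
    "\<And>x. nb H x = nb V x - {u,a,b}" "\<And>x. x \<in> H \<longleftrightarrow> x \<in> V \<and> x \<noteq> u \<and> x \<noteq> a \<and> x \<noteq> b"
proof -
  note d = cfgD[OF c]
  show "finite H" using d(1) by (simp add: H_def)
  show "subsets_bounded H" using subsets_bounded_subset[OF d(2)] by (auto simp: H_def)
  have "insert u (nb V u) = {u,a,b}" "{u,a,b} \<subseteq> V" using d by auto
  moreover have "card {u,a,b} = 3" using d(7,15,16) by auto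
  ultimately have "card H + 3 = card V"
    using card_Diff_subset[of "{u,a,b}" V] card_mono[of V "{u,a,b}"] d(1) unfolding H_def by simp
  then show "int (card H) = int (card V) - 3" by linarith
  show "count_le V (\<lambda>F. isolated V F u) (num_mds H)" unfolding H_def by (rule count_le_iso_restrict[OF d(1)])
  show "nb H x = nb V x - {u,a,b}" for x using d(6) by (auto simp: H_def nb_Diff)
  show "x \<in> H \<longleftrightarrow> x \<in> V \<and> x \<noteq> u \<and> x \<noteq> a \<and> x \<noteq> b" for x using d(6) by (auto simp: H_def)
qed

text \<open>\<open>H\<close> has residue 0, so \<open>low0\<close> gives the factor 25/36 for the
  sets with \<open>u\<close> isolated as soon as \<open>w1\<close> has degree 2: in \<open>H\<close>
  it has lost its neighbour \<open>a'\<close>.\<close>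

lemma B_residue3:
  assumes c: "deg_2_3_3 V u a b" and n: "int (card V) = 4 * q + 3"
  shows "real (num_mds V) < g (int (card V))"
proof -
  define n where "n = int (card V)"
  note t = g_table3[OF n, folded n_def] g_pos[of n]
  have gd: "g (n - k - int (deg V w)) \<le> g (n - k - int j)" if "j \<le> deg V w" for k w j
    using that by (intro g_mono) auto
  show ?thesis unfolding n_def[symmetric]
  proof (cases rule: deg_2_3_3_cases[OF c])
    case (1 w w')
    have dw: "2 \<le> deg V w" "2 \<le> deg V w'" using deg_2_3_3_nbr_deg(1)[OF c] 1 by auto
    have p1: "nb V a = {u,w',w}" "nb V b = {u,w',w}" using 1 by auto
    consider "deg V w = 2" | "deg V w' = 2" | "3 \<le> deg V w" "3 \<le> deg V w'" using dw by linarith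
    then show "real (num_mds V) < g n"
    proof cases
      case a: 1
      then show ?thesis using cfg3_twin[OF c 1 a(1), folded n_def] gd[OF dw(2), of 3] t by simp
    next
      case a: 2
      show ?thesis using cfg3_twin[OF c p1 a(1), folded n_def] gd[OF dw(1), of 3] t by simp
    next
      case a: 3
      show ?thesis using cfg3[OF c 1 deg_2_3_3_x0[OF c] cfg3_x1[OF c 1], folded n_def] gd[OF a(1), of 3] gd[OF a(2), of 3] t by simp
    qed
  next
    case (2 a' b' w w1 w2)
    have dw: "2 \<le> deg V w" "2 \<le> deg V w1" "2 \<le> deg V w2" using deg_2_3_3_nbr_deg(1)[OF 2(1)] 2(2,3) by auto
    show "real (num_mds V) < g n"
    proof (cases "deg V w = 2")
      case True
      note T = cfg2[OF 2(1-4) cfg2_twin(3)[OF 2(1-3) True] 2(5), folded n_def]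
      show ?thesis using T True gd[OF dw(2), of 3] gd[OF dw(3), of 4] t by simp
    next
      case False
      then have "3 \<le> deg V w" using dw by simp
      note T = cfg2[OF 2(1-4) deg_2_3_3_x0[OF 2(1)] 2(5), folded n_def]
      show ?thesis using T gd[OF \<open>3 \<le> deg V w\<close>, of 3] gd[OF dw(2), of 3] gd[OF dw(3), of 4] t by simp
    qed
  next
    case (3 a' b' w1 w2 w3 w4)
    have dw: "2 \<le> deg V w1" "2 \<le> deg V w2" "2 \<le> deg V w3" "2 \<le> deg V w4"
      and V: "w1 \<in> V" using deg_2_3_3_nbr_deg[OF 3(1)] 3(2,3) by auto
    note d = cfgD[OF 3(1)]
    have tail: "g (n - 7 - int (card (nb V w3 - {b',w1,w2}))) \<le> g (n - 7)"
      "g (n - 7 - int (card (nb V w4 - {b',w1,w2}))) \<le> g (n - 7)" by (auto intro!: g_mono)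
    show "real (num_mds V) < g n"
    proof (cases "deg V w1 = 2")
      case True
      let ?H = "V - insert u (nb V u)"
      note H = deg_2_3_3_H[OF 3(1)]
      have "w1 \<in> nb V a'" using 3(2) by simp
      then have "a' \<in> nb V w1" "w1 \<noteq> u" "w1 \<noteq> a'" "w1 \<noteq> b'"
        using nbD[OF _ d(4)] d 3(2) by (auto simp: card_insert_if split: if_splits)
      then have "w1 \<in> ?H" "nb ?H w1 \<subseteq> nb V w1 - {a'}" using H(5,6) V by auto
      moreover have "card (nb V w1 - {a'}) = 1" using True \<open>a' \<in> nb V w1\<close> d(1) by simp
      ultimately have "deg ?H w1 \<le> 1" using card_mono[of "nb V w1 - {a'}" "nb ?H w1"] d(1) by simp
      moreover have "int (card ?H) = 4 * q" using H(3) n by simp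
      ultimately have "real (num_mds ?H) \<le> 25/36 * g (n - 3)"
        using low0[OF H(1,2) \<open>w1 \<in> ?H\<close>] H(3) by (simp add: n_def)
      then have "count_le V (\<lambda>F. isolated V F u) (25/36 * g (n - 3))" using count_le_num_mds_mono[OF H(4)] by simp
      note T = cfg1[OF 3(1-4) this, folded n_def]
      show ?thesis using T tail gd[OF dw(1), of 3] gd[OF dw(2), of 3] gd[OF dw(3), of 4] gd[OF dw(4), of 4] t by simp
    next
      case False
      then have "deg V w2 \<noteq> 2" "deg V w3 \<noteq> 2" "deg V w4 \<noteq> 2" using 3 by auto
      then have w: "3 \<le> deg V w1" "3 \<le> deg V w2" "3 \<le> deg V w3" "3 \<le> deg V w4" using False dw by auto
      note T = cfg1[OF 3(1-4) deg_2_3_3_x0[OF 3(1)], folded n_def]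
      show ?thesis using T tail gd[OF w(1), of 3] gd[OF w(2), of 3] gd[OF w(3), of 4] gd[OF w(4), of 4] t by simp
    qed
  qed
qed

text \<open>In residue 2 the graph \<open>H\<close> has residue 3, where a leaf at a vertex of
  degree at least 3 gives the factor 22/27.\<close>

lemma deg_2_3_3_leaf3:
  assumes c: "deg_2_3_3 V u a b" and n: "int (card V) = 4 * q + 2"
    and x: "x \<in> V" "x \<notin> {u,a,b}" "nb V x - {u,a,b} = {z}" and z: "3 \<le> card (nb V z - {u,a,b})"
  shows "count_le V (\<lambda>F. isolated V F u) (22/27 * g (int (card V) - 3))"
proof -
  let ?H = "V - insert u (nb V u)"
  note H = deg_2_3_3_H[OF c]
  have zx: "z \<in> nb V x - {u,a,b}" using x(3) by auto
  then have "z \<in> ?H" using H(6) nb_subset[of V x] by auto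
  moreover have "x \<in> nb ?H z" using zx H(5) nbD[of z V x] x by auto
  moreover have "deg ?H x = 1" using H(5) x(3) by simp
  moreover have "3 \<le> deg ?H z" using H(5) z by simp
  ultimately have "real (num_mds ?H) \<le> 22/27 * g (int (card ?H))"
    by (rule leaf3(4)[OF H(1,2), where q = "q - 1"]) (use H(3) n in simp)
  then show ?thesis using count_le_num_mds_mono[OF H(4)] H(3) by simp
qed

text \<open>The weaker variant for a vertex \<open>z\<close> that may have degree 2 in
  \<open>H\<close>; the hypothesis \<open>y\<close> prevents a component P_3 there.\<close>

lemma deg_2_3_3_leaf2:
  assumes c: "deg_2_3_3 V u a b" and n: "int (card V) = 4 * q + 2"
    and x: "x \<in> V" "x \<notin> {u,a,b}" "nb V x - {u,a,b} = {z}" and z: "2 \<le> card (nb V z - {u,a,b})"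
    and y: "\<And>y. y \<in> nb V z - {u,a,b,x} \<Longrightarrow> 2 \<le> card (nb V y - {u,a,b})"
  shows "count_le V (\<lambda>F. isolated V F u) (17/18 * g (int (card V) - 3))"
proof -
  let ?H = "V - insert u (nb V u)"
  note H = deg_2_3_3_H[OF c]
  have zx: "z \<in> nb V x - {u,a,b}" using x(3) by auto
  then have zH: "z \<in> ?H" using H(6) nb_subset[of V x] by auto
  have xz: "x \<in> nb ?H z" using zx H(5) nbD[of z V x] x by auto
  have dx: "deg ?H x = 1" using H(5) x(3) by simp
  have dz: "2 \<le> deg ?H z" using H(5) z by simp
  have dy: "deg ?H y \<noteq> 1" if "y \<in> nb ?H z - {x}" for y using y[of y] that H(5) by force
  have "real (num_mds ?H) \<le> 17/18 * g (int (card ?H))"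
    by (rule leaf_residue3[OF H(1,2) _ zH xz dx dz, where q = "q - 1"]) (use H(3) n dy in auto)
  then show ?thesis using count_le_num_mds_mono[OF H(4)] H(3) by simp
qed

text \<open>If \<open>w\<close> and \<open>w'\<close> have degree 3, the sum of \<open>cfg3\<close>
  is exactly \<open>g n\<close>, so any saving suffices. It comes from the third neighbours
  \<open>y\<close> and \<open>y'\<close>: in \<open>H\<close> the vertex \<open>w\<close> is a leaf
  at \<open>y\<close>.\<close>

lemma B_residue2_twins:
  assumes c: "deg_2_3_3 V u a b" and n: "int (card V) = 4 * q + 2"
    and no: "\<not> (\<forall>x\<in>nb V a. deg V x = 2)" and na: "nb V a = {u,w,w'}" and nb: "nb V b = {u,w,w'}"
  shows "real (num_mds V) < g (int (card V))"
proof -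
  define n where "n = int (card V)"
  note t = g_table2[OF n, folded n_def] g_pos[of n]
  have gd: "g (n - k - int (deg V w)) \<le> g (n - k - int j)" if "j \<le> deg V w" for k w j
    using that by (intro g_mono) auto
  note d = cfgD[OF c]
  have wu: "u \<noteq> w" "u \<noteq> w'" "w \<noteq> w'" using d(8) na by (auto simp: card_insert_if split: if_splits)
  have na': "nb V a = {u,w',w}" and nb': "nb V b = {u,w',w}" using na nb by auto
  have dw: "2 \<le> deg V w" "2 \<le> deg V w'" and wV: "w \<in> V" "w' \<in> V" using deg_2_3_3_nbr_deg[OF c] na by auto
  have wn: "w \<in> nb V a" "w \<in> nb V b" "w' \<in> nb V a" "w' \<in> nb V b" using na nb by auto
  have abw: "a \<in> nb V w" "b \<in> nb V w" "a \<in> nb V w'" "b \<in> nb V w'" using nbD[OF wn(1) d(4)] nbD[OF wn(2) d(5)] nbD[OF wn(3) d(4)] nbD[OF wn(4) d(5)] by auto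
  have wab: "w \<notin> {u,a,b}" using wn wu d(20,21) by auto
  note x1 = cfg3_x1[OF c na nb, folded n_def]
  note x0 = deg_2_3_3_x0[OF c, folded n_def]
  show ?thesis unfolding n_def[symmetric]
  proof (cases "deg V w = 2 \<or> deg V w' = 2 \<or> 4 \<le> deg V w \<or> 4 \<le> deg V w'")
    case True
    then consider "deg V w = 2" "3 \<le> deg V w'" | "deg V w' = 2" "3 \<le> deg V w"
      | "3 \<le> deg V w" "3 \<le> deg V w'" "4 \<le> deg V w \<or> 4 \<le> deg V w'"
      using no na d(12) dw by fastforce
    then show "real (num_mds V) < g n"
    proof cases
      case 1
      then show ?thesis using cfg3_twin[OF c na nb 1(1), folded n_def] gd[OF 1(2), of 3] t by simp
    next
      case 2
      then show ?thesis using cfg3_twin[OF c na' nb' 2(1), folded n_def] gd[OF 2(2), of 3] t by simp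
    next
      case 3
      note T = cfg3[OF c na nb x0[unfolded n_def] x1[unfolded n_def], folded n_def]
      from 3(3) show ?thesis
      proof
        assume "4 \<le> deg V w"
        then show ?thesis using T gd[of 4 w 3] gd[OF 3(2), of 3] t by simp
      next
        assume "4 \<le> deg V w'"
        then show ?thesis using T gd[of 4 w' 3] gd[OF 3(1), of 3] t by simp
      qed
    qed
  next
    case False
    then have d3: "deg V w = 3" "deg V w' = 3" using dw by auto
    have "card (nb V w - {a,b}) = 1" using d3 abw d(7) d(1) by (simp add: card_Diff_subset)
    then obtain y where y: "nb V w - {a,b} = {y}" by (auto simp: card_1_singleton_iff)
    have "card (nb V w' - {a,b}) = 1" using d3 abw d(7) d(1) by (simp add: card_Diff_subset)
    then obtain y' where y': "nb V w' - {a,b} = {y'}" by (auto simp: card_1_singleton_iff)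
    have uw: "u \<notin> nb V w" using nb_triangle[OF wn(1) d(10) d(4)] nbD[of u V w] wV by auto
    have yu: "nb V w - {u,a,b} = {y}" using y uw by auto
    have yw: "y \<in> nb V w" "y \<noteq> a" "y \<noteq> b" using y by auto
    have yV: "y \<in> V" "w \<in> nb V y" using nbD[OF yw(1) wV(1)] by auto
    have yab: "a \<notin> nb V y" "b \<notin> nb V y" "u \<notin> nb V y"
      using nb_triangle[OF abw(1) yw(1) wV(1)] nb_triangle[OF abw(2) yw(1) wV(1)] nbD[of u V y] yV d(6) yw by auto
    have degy: "nb V y - {u,a,b} = nb V y" using yab by auto
    note T = cfg3[OF c na nb _ x1[unfolded n_def], folded n_def]
    show "real (num_mds V) < g n"
    proof (cases "3 \<le> deg V y")
      case True
      have "count_le V (\<lambda>F. isolated V F u) (22/27 * g (n - 3))"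
        using deg_2_3_3_leaf3[OF c n wV(1) wab yu] degy True by (simp add: n_def)
      then show ?thesis using T d3 t by fastforce
    next
      case False
      then have dy: "deg V y = 2" using d(17)[OF yV(1)] by simp
      show ?thesis
      proof (cases "y = y'")
        case False
        have "2 \<le> card (nb V z - {u,a,b})" if z: "z \<in> nb V y - {u,a,b,w}" for z
        proof -
          have zV: "z \<in> V" "y \<in> nb V z" using nbD[of z V y] z yV by auto
          have "z \<noteq> w'" using zV y' False yw by auto
          then have "z \<notin> nb V a" "z \<notin> nb V b" "z \<notin> nb V u" using z na nb d(6) by auto
          then have "nb V z - {u,a,b} = nb V z" using nb_sym[of _ V z] zV by blast
          then show ?thesis using d(17)[OF zV(1)] by simp
        qed
        then have "count_le V (\<lambda>F. isolated V F u) (17/18 * g (n - 3))"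
          using deg_2_3_3_leaf2[OF c n wV(1) wab yu] degy dy by (simp add: n_def)
        then show ?thesis using T d3 t by fastforce
      next
        case True
        \<comment> \<open>The component is now K_{3,3} without the edge from \<open>u\<close> to
          \<open>y\<close>. If \<open>a\<close> and \<open>b\<close> are isolated in
          \<open>F\<close>, then \<open>y\<close> is in \<open>F\<close> as well, so six vertices
          are deleted instead of five.\<close>
        have "w' \<in> nb V y" using True y' nbD[of y V w'] wV by auto
        then have nby: "nb V y = {w,w'}" using dy yV wu card_subset_eq[of "nb V y" "{w,w'}"] d(1) by auto
        have "count_le V (\<lambda>F. isolated V F a \<and> isolated V F b) (g (int (card V) - int 6))"
        proof (rule cell[OF d(1,2), where I = "{a,b,y}" and J = "{}" and O' = "{}" and K = "{a,b,u,w,w',y}"])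
          have "y \<noteq> w" "y \<noteq> w'" "y \<noteq> u" using nby wu yV \<open>w' \<in> nb V y\<close> irrefl yw uw by (auto simp: nb_def)
          moreover have "w' \<noteq> a" "w' \<noteq> b" using wn d(20,21) by auto
          ultimately show "6 \<le> card {a,b,u,w,w',y}" using wab wu yw d(7,15,16) by auto
          fix F assume F: "mds V F" "isolated V F a \<and> isolated V F b"
          then have "w \<notin> F" "w' \<notin> F" using na by auto
          then have "y \<in> F" using mds_blocked'[OF F(1) yV(1)] nby by auto
          then show "{a,b,y} \<subseteq> F \<and> {} \<subseteq> F \<and> {} \<inter> F = {} \<and> (\<forall>v\<in>{a,b,y}. nb V v \<inter> F = {})"
            using F(2) nby \<open>w \<notin> F\<close> \<open>w' \<notin> F\<close> by auto
        qed (use d(3-5) wV yV na in auto)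
        then have x6: "count_le V (\<lambda>F. isolated V F a \<and> isolated V F b) (g (int (card V) - 6))" by simp
        show ?thesis using cfg3[OF c na nb x0[unfolded n_def] x6, folded n_def] d3 t by simp
      qed
    qed
  qed
qed

lemma deg2_other:
  assumes "finite V" "deg V w = 2" "a \<in> nb V w"
  shows "\<exists>z. nb V w = {a,z} \<and> a \<noteq> z"
proof -
  have "card (nb V w - {a}) = 1" using assms by simp
  then obtain z where "nb V w - {a} = {z}" by (auto simp: card_1_singleton_iff)
  then show ?thesis using assms(3) by (intro exI[of _ z]) auto
qed

text \<open>With \<open>w\<close>, \<open>w1\<close>, \<open>w2\<close> of degree 2 the sum of
  \<open>cfg2\<close> is exactly \<open>g n\<close>. Whenever \<open>w1\<close> has degree 2, its
  other neighbour \<open>z\<close> has degree at least 3, and \<open>w1\<close> becomes a leaf at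
  \<open>z\<close> once \<open>a\<close> is deleted; this improves the count of the sets with
  \<open>u\<close> isolated.\<close>

lemma B_residue2_one_common:
  assumes c: "deg_2_3_3 V u a b" and n: "int (card V) = 4 * q + 2"
    and na: "nb V a = {u,w,w1}" and nb: "nb V b = {u,w,w2}" and ne: "w1 \<noteq> w2"
    and dd: "deg V w2 = 2 \<Longrightarrow> deg V w1 = 2"
  shows "real (num_mds V) < g (int (card V))"
proof -
  define n where "n = int (card V)"
  note t = g_table2[OF n, folded n_def] g_pos[of n]
  have gd: "g (n - k - int (deg V w)) \<le> g (n - k - int j)" if "j \<le> deg V w" for k w j
    using that by (intro g_mono) auto
  note d = cfgD[OF c]
  have dw: "2 \<le> deg V w" "2 \<le> deg V w1" "2 \<le> deg V w2" and V: "w \<in> V" "w1 \<in> V" "w2 \<in> V"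
    using deg_2_3_3_nbr_deg[OF c] na nb by auto
  have wu: "u \<noteq> w" "u \<noteq> w1" "w \<noteq> w1" using d(8) na by (auto simp: card_insert_if split: if_splits)
  have wu2: "u \<noteq> w2" "w \<noteq> w2" using d(9) nb by (auto simp: card_insert_if split: if_splits)
  have in1: "w1 \<in> nb V a" "w \<in> nb V a" "w2 \<in> nb V b" "w \<in> nb V b" using na nb by auto
  have aw1: "a \<in> nb V w1" "b \<in> nb V w2" using nbD[OF in1(1) d(4)] nbD[OF in1(3) d(5)] by auto
  have w1n: "w1 \<notin> {u,a,b}" using in1 wu d(14,20) nb ne by auto
  have bw1: "b \<notin> nb V w1" using nbD[of b V w1] V nb ne wu by auto
  have z1: "z \<notin> {u,a,b} \<and> nb V w1 - {u,a,b} = {z} \<and> z \<in> V \<and> 3 \<le> deg V z \<and> a \<notin> nb V z \<and> u \<notin> nb V z \<and> (z = w2 \<or> b \<notin> nb V z)"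
    if nw: "nb V w1 = {a,z}" "a \<noteq> z" for z
  proof -
    have d2: "deg V w1 = 2" using nw by simp
    have z: "z \<in> nb V w1" using nw by simp
    note zD = nbD[OF z V(2)]
    have "z \<noteq> u" using zD d(6) w1n by auto
    moreover have "z \<noteq> b" using z bw1 by auto
    moreover have "3 \<le> deg V z" using d(17)[of z] d(18)[of w1 z] zD V z d2 by fastforce
    moreover have "a \<notin> nb V z" using nb_triangle[OF aw1(1) z V(2)] by simp
    moreover have "u \<notin> nb V z" using nbD[of u V z] zD d(6) \<open>z \<noteq> b\<close> nw(2) by auto
    moreover have "z \<noteq> w" using nb_triangle[OF in1(1,2) d(4)] zD by auto
    moreover have "z = w2 \<or> b \<notin> nb V z" using nbD[of b V z] zD nb \<open>z \<noteq> u\<close> \<open>z \<noteq> w\<close> by auto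
    ultimately show ?thesis using zD nw wu w1n by auto
  qed
  show ?thesis unfolding n_def[symmetric]
  proof (cases "deg V w = 2")
    case w2: True
    note tw = cfg2_twin[OF c na nb w2]
    show "real (num_mds V) < g n"
    proof (cases "deg V w2 = 2")
      case True
      then have d1: "deg V w1 = 2" using dd by simp
      obtain z where nw: "nb V w1 = {a,z}" "a \<noteq> z" using deg2_other[OF d(1) d1 aw1(1)] by (elim exE conjE)
      have z: "z \<notin> {u,a,b}" "nb V w1 - {u,a,b} = {z}" "z \<in> V" "3 \<le> deg V z" "a \<notin> nb V z" "u \<notin> nb V z"
        "z = w2 \<or> b \<notin> nb V z"
        using z1[OF nw] by blast+
      have bz: "b \<notin> nb V z" using z(4,7) True by auto
      have wz: "w \<notin> nb V z" using nbD[of w V z] z(1,3) tw(1) d(6) by auto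
      \<comment> \<open>The twin \<open>w\<close> of \<open>u\<close> is deleted as well, so this
        graph has residue 2 again and the factor 21/22 of \<open>leaf3\<close> applies.\<close>
      let ?H = "V - insert u (insert w (nb V u))"
      have HS: "insert u (insert w (nb V u)) = {u,w,a,b}" using d(6) by auto
      have wab: "w \<noteq> a" "w \<noteq> b" using in1 d(20,21) by auto
      have finH: "finite ?H" "subsets_bounded ?H" using d(1) subsets_bounded_subset[OF d(2)] by auto
      have "card {u,w,a,b} = 4" "{u,w,a,b} \<subseteq> V" using wu d(3-5,7,15,16) wab V by auto
      then have "card ?H + 4 = card V"
        using card_Diff_subset[of "{u,w,a,b}" V] card_mono[of V "{u,w,a,b}"] d(1) unfolding HS by simp
      then have cH: "int (card ?H) = n - 4" by (simp add: n_def)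
      have nbH: "nb ?H x = nb V x - {u,w,a,b}" for x using HS by (simp add: nb_Diff)
      have "z \<noteq> w" using z(4) w2 by auto
      then have zH: "z \<in> ?H" using z(1,3) \<open>z \<noteq> w\<close> HS by auto
      have "w1 \<in> nb V z" using nbD[of z V w1] nw V by auto
      then have 1: "w1 \<in> nb ?H z" using nbH w1n wu by auto
      have 2: "deg ?H w1 = 1" using nbH[of w1] nw(1) z(1) \<open>z \<noteq> w\<close> by (simp add: insert_Diff_if)
      have "nb ?H z = nb V z" using nbH[of z] z(5,6) bz wz by auto
      then have 3: "3 \<le> deg ?H z" using z(4) by simp
      have "real (num_mds ?H) \<le> 21/22 * g (int (card ?H))"
        by (rule leaf3(3)[OF finH zH 1 2 3, where q = "q - 1"]) (use cH n n_def in simp)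
      then have "count_le V (\<lambda>F. isolated V F u) (21/22 * g (n - 4))"
        using count_le_num_mds_mono[OF count_le_iso_twin_restrict[OF d(1) tw(2,1)]] cH by simp
      note T = cfg2[OF c na nb ne this dd, folded n_def]
      show ?thesis using T w2 True d1 t by simp
    next
      case False
      then have w23: "3 \<le> deg V w2" using dw by simp
      note T = cfg2[OF c na nb ne tw(3) dd, folded n_def]
      show ?thesis using T w2 gd[OF w23, of 4] gd[OF dw(2), of 3] t by simp
    qed
  next
    case False
    then have w3: "3 \<le> deg V w" using dw by simp
    show "real (num_mds V) < g n"
    proof (cases "deg V w1 = 2")
      case d1: True
      obtain z where nw: "nb V w1 = {a,z}" "a \<noteq> z" using deg2_other[OF d(1) d1 aw1(1)] by (elim exE conjE)
      have z: "z \<notin> {u,a,b}" "nb V w1 - {u,a,b} = {z}" "z \<in> V" "3 \<le> deg V z" "a \<notin> nb V z" "u \<notin> nb V z"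
        "z = w2 \<or> b \<notin> nb V z"
        using z1[OF nw] by blast+
      show ?thesis
      proof (cases "b \<in> nb V z")
        case False
        then have "nb V z - {u,a,b} = nb V z" using z(5,6) by auto
        then have "count_le V (\<lambda>F. isolated V F u) (22/27 * g (n - 3))"
          using deg_2_3_3_leaf3[OF c n V(2) w1n z(2)] z(4) by (simp add: n_def)
        note T = cfg2[OF c na nb ne this dd, folded n_def]
        show ?thesis using T d1 gd[OF w3, of 3] gd[OF dw(3), of 4] t by simp
      next
        case True
        \<comment> \<open>Here \<open>z\<close> loses \<open>b\<close> in \<open>H\<close> and may
          keep only two neighbours, so just 17/18 is available; in return \<open>w2\<close>, being
          \<open>z\<close>, has degree at least 3.\<close>
        then have zw2: "z = w2" using z(7) by auto
        have "nb V z - {u,a,b} = nb V z - {b}" using z(5,6) by auto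
        then have c2: "2 \<le> card (nb V z - {u,a,b})" using z(4) True d(1) by simp
        have "2 \<le> card (nb V y - {u,a,b})" if y: "y \<in> nb V z - {u,a,b,w1}" for y
        proof -
          have yD: "y \<in> V" "z \<in> nb V y" using nbD[of y V z] y z(3) by auto
          have "y \<noteq> w" using nb_triangle[OF in1(4,3) d(5)] y zw2 by auto
          then have "a \<notin> nb V y" using nbD[of a V y] yD y na by auto
          moreover have "b \<notin> nb V y" using nb_triangle[OF True, of y] y z(3) by auto
          moreover have "u \<notin> nb V y" using nbD[of u V y] yD y d(6) by auto
          ultimately have "nb V y - {u,a,b} = nb V y" by auto
          then show ?thesis using d(17)[OF yD(1)] by simp
        qed
        then have "count_le V (\<lambda>F. isolated V F u) (17/18 * g (n - 3))"
          using deg_2_3_3_leaf2[OF c n V(2) w1n z(2) c2] by (simp add: n_def)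
        note T = cfg2[OF c na nb ne this dd, folded n_def]
        have "3 \<le> deg V w2" using z(4) zw2 by simp
        then show ?thesis using T d1 gd[OF w3, of 3] gd[of 3 w2 4] t by simp
      qed
    next
      case False
      then have w: "3 \<le> deg V w1" "3 \<le> deg V w2" using dw dd by fastforce+
      note T = cfg2[OF c na nb ne deg_2_3_3_x0[OF c] dd, folded n_def]
      show ?thesis using T gd[OF w3, of 3] gd[OF w(1), of 3] gd[OF w(2), of 4] t by simp
    qed
  qed
qed

text \<open>\<open>single\<close> may be assumed because a configuration with more common neighbours
  is preferred if one exists. When \<open>w1\<close> and \<open>w2\<close> have degree 2 it supplies
  new neighbours of \<open>w3\<close> and \<open>w4\<close>, hence \<open>g (n - 8)\<close> in the
  last summands.\<close>

lemma B_residue2_no_common: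
  assumes c: "deg_2_3_3 V u a b" and n: "int (card V) = 4 * q + 2"
    and na: "nb V a = {u,w1,w2}" and nb: "nb V b = {u,w3,w4}" and ne: "{w1,w2} \<inter> {w3,w4} = {}"
    and dd: "deg V w2 = 2 \<Longrightarrow> deg V w1 = 2" "deg V w4 = 2 \<Longrightarrow> deg V w3 = 2"
      "deg V w3 = 2 \<Longrightarrow> deg V w1 = 2" "deg V w4 = 2 \<Longrightarrow> deg V w2 = 2"
    and single: "\<And>u' a' b'. deg_2_3_3 V u' a' b' \<Longrightarrow> nb V a' \<inter> nb V b' = {u'}"
  shows "real (num_mds V) < g (int (card V))"
proof -
  define n where "n = int (card V)"
  note t = g_table2[OF n, folded n_def] g_pos[of n]
  have gd: "g (n - k - int (deg V w)) \<le> g (n - k - int j)" if "j \<le> deg V w" for k w j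
    using that by (intro g_mono) auto
  note d = cfgD[OF c]
  have dw: "2 \<le> deg V w1" "2 \<le> deg V w2" "2 \<le> deg V w3" "2 \<le> deg V w4"
    and V: "w1 \<in> V" "w2 \<in> V" "w3 \<in> V" "w4 \<in> V"
    using deg_2_3_3_nbr_deg[OF c] na nb by auto
  have wu: "u \<noteq> w1" "u \<noteq> w2" "w1 \<noteq> w2" using d(8) na by (auto simp: card_insert_if split: if_splits)
  have wu2: "u \<noteq> w3" "u \<noteq> w4" "w3 \<noteq> w4" using d(9) nb by (auto simp: card_insert_if split: if_splits)
  have in1: "w1 \<in> nb V a" "w2 \<in> nb V a" "w3 \<in> nb V b" "w4 \<in> nb V b" using na nb by auto
  have aw: "a \<in> nb V w1" "a \<in> nb V w2" "b \<in> nb V w3" "b \<in> nb V w4"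
    using nbD[OF in1(1) d(4)] nbD[OF in1(2) d(4)] nbD[OF in1(3) d(5)] nbD[OF in1(4) d(5)] by auto
  have w1n: "w1 \<notin> {u,a,b}" using in1 wu d(14,20) by auto
  have bw: "b \<notin> nb V w1" "b \<notin> nb V w2"
    using nbD[of b V w1] nbD[of b V w2] V nb ne wu by auto
  have z1: "z \<notin> {u,a,b} \<and> nb V w1 - {u,a,b} = {z} \<and> z \<in> V \<and> 3 \<le> deg V z \<and> a \<notin> nb V z \<and> u \<notin> nb V z \<and> (z = w3 \<or> z = w4 \<or> b \<notin> nb V z)"
    if nw: "nb V w1 = {a,z}" "a \<noteq> z" for z
  proof -
    have d2: "deg V w1 = 2" using nw by simp
    have z: "z \<in> nb V w1" using nw by simp
    note zD = nbD[OF z V(1)]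
    have "z \<noteq> u" using zD d(6) w1n by auto
    moreover have "z \<noteq> b" using z bw by auto
    moreover have "3 \<le> deg V z" using d(17)[of z] d(18)[of w1 z] zD V z d2 by fastforce
    moreover have "a \<notin> nb V z" using nb_triangle[OF aw(1) z V(1)] by simp
    moreover have "u \<notin> nb V z" using nbD[of u V z] zD d(6) \<open>z \<noteq> b\<close> nw(2) by auto
    moreover have "z = w3 \<or> z = w4 \<or> b \<notin> nb V z" using nbD[of b V z] zD nb \<open>z \<noteq> u\<close> by auto
    ultimately show ?thesis using zD nw wu w1n by auto
  qed
  have leaf3: "count_le V (\<lambda>F. isolated V F u) (22/27 * g (n - 3))" if nw: "nb V w1 = {a,z}" "a \<noteq> z" and b: "b \<notin> nb V z" for z
  proof -
    have z: "z \<notin> {u,a,b}" "nb V w1 - {u,a,b} = {z}" "z \<in> V" "3 \<le> deg V z" "a \<notin> nb V z" "u \<notin> nb V z"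
        "z = w3 \<or> z = w4 \<or> b \<notin> nb V z"
        using z1[OF nw] by blast+
    have "nb V z - {u,a,b} = nb V z" using b z(5,6) by auto
    then show ?thesis using deg_2_3_3_leaf3[OF c n V(1) w1n z(2)] z(4) by (simp add: n_def)
  qed
  have tail: "g (n - 7 - int (card (nb V w3 - {b,w1,w2}))) \<le> g (n - 7)"
    "g (n - 7 - int (card (nb V w4 - {b,w1,w2}))) \<le> g (n - 7)" by (auto intro!: g_mono)
  have tail8: "g (n - 7 - int (card (nb V w - {b,w1,w2}))) \<le> g (n - 8)" if "1 \<le> card (nb V w - {b,w1,w2})" for w
    using that by (auto intro!: g_mono)
  show ?thesis unfolding n_def[symmetric]
  proof (cases "deg V w2 = 2")
    case d2: True
    then have d1: "deg V w1 = 2" using dd by simp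
    have core_C4_union: "1 \<le> card (nb V w - {b,w1,w2})" if w: "w \<in> nb V b" "w \<in> V" "w \<noteq> u" for w
    proof (cases "deg V w = 2")
      case True
      then have "w1 \<notin> nb V w" "w2 \<notin> nb V w" using d(18)[OF w(2)] d1 d2 by blast+
      then show ?thesis using True by (intro core_C4_union_ge1[OF d(1)]) simp
    next
      case False
      then have w3: "3 \<le> deg V w" using d(17)[OF w(2)] by simp
      show ?thesis
      proof (rule ccontr)
        assume "\<not> ?thesis"
        then have e: "nb V w - {b,w1,w2} = {}" using d(1) by (simp add: not_le)
        then have sub: "nb V w \<subseteq> {b,w1,w2}" by auto
        have "card {b,w1,w2} \<le> 3" by (simp add: card_insert_if)
        then have nw: "nb V w = {b,w1,w2}" using card_seteq[OF _ sub] w3 by simp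
        then have w3': "deg V w = 3" using w3 \<open>card {b,w1,w2} \<le> 3\<close> by simp
        have wa: "w \<noteq> a" using w d(13) by auto
        \<comment> \<open>If \<open>b\<close>, \<open>w1\<close>, \<open>w2\<close> were all
          neighbours of \<open>w\<close>, then \<open>w1\<close> would be a vertex of degree 2 whose
          neighbours \<open>a\<close> and \<open>w\<close> share both \<open>w1\<close> and
          \<open>w2\<close>, against \<open>single\<close>.\<close>
        have "w1 \<in> nb V w" using nw by simp
        then have nw1: "nb V w1 = {a,w}"
          using twin_nb[OF d(1) in1(1) _ d(4) w(2) wa[symmetric] d1] by simp
        have "deg_2_3_3 V w1 a w"
          unfolding deg_2_3_3_def by (intro conjI d(1,2) V(1) nw1 wa[symmetric] d(8) w3') (use c in \<open>simp_all add: deg_2_3_3_def\<close>)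
        then have "nb V a \<inter> nb V w = {w1}" by (rule single)
        then show False using na nw wu by auto
      qed
    qed
    have e3: "1 \<le> card (nb V w3 - {b,w1,w2})" "1 \<le> card (nb V w4 - {b,w1,w2})"
      using core_C4_union in1 V wu2 by auto
    show "real (num_mds V) < g n"
    proof (cases "deg V w4 = 2")
      case True
      then have d3: "deg V w3 = 2" using dd by simp
      obtain z where nw: "nb V w1 = {a,z}" "a \<noteq> z" using deg2_other[OF d(1) d1 aw(1)] by (elim exE conjE)
      have "3 \<le> deg V z" "z = w3 \<or> z = w4 \<or> b \<notin> nb V z" using z1[OF nw] by blast+
      then have "b \<notin> nb V z" using True d3 by auto
      note T = cfg1[OF c na nb ne leaf3[OF nw this], folded n_def]
      show ?thesis using T tail8[OF e3(1)] tail8[OF e3(2)] d1 d2 d3 True t by simp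
    next
      case False
      then have w43: "3 \<le> deg V w4" using dw by simp
      note T = cfg1[OF c na nb ne deg_2_3_3_x0[OF c], folded n_def]
      show ?thesis using T tail8[OF e3(1)] tail8[OF e3(2)] d1 d2 gd[OF w43, of 4] gd[OF dw(3), of 4] t by simp
    qed
  next
    case False
    then have w2: "3 \<le> deg V w2" "3 \<le> deg V w4" using dw dd by fastforce+
    show "real (num_mds V) < g n"
    proof (cases "deg V w1 = 2")
      case d1: True
      obtain z where nw: "nb V w1 = {a,z}" "a \<noteq> z" using deg2_other[OF d(1) d1 aw(1)] by (elim exE conjE)
      have z: "z \<notin> {u,a,b}" "nb V w1 - {u,a,b} = {z}" "z \<in> V" "3 \<le> deg V z" "a \<notin> nb V z" "u \<notin> nb V z"
        "z = w3 \<or> z = w4 \<or> b \<notin> nb V z"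
        using z1[OF nw] by blast+
      have "count_le V (\<lambda>F. isolated V F u) (17/18 * g (n - 3))"
      proof (cases "b \<in> nb V z")
        case False
        show ?thesis using count_le_mono[OF leaf3[OF nw False] _ _ d(1)] g_pos[of "n - 3"] by simp
      next
        case True
        have zb: "z \<in> nb V b" using nbD[OF True z(3)] by blast
        have "nb V z - {u,a,b} = nb V z - {b}" using z(5,6) by auto
        then have c2: "2 \<le> card (nb V z - {u,a,b})" using z(4) True d(1) by simp
        have "2 \<le> card (nb V y - {u,a,b})" if y: "y \<in> nb V z - {u,a,b,w1}" for y
        proof -
          have yD: "y \<in> V" "z \<in> nb V y" using nbD[of y V z] y z(3) by auto
          have by1: "b \<notin> nb V y" using nb_triangle[OF True, of y] y z(3) by auto
          have uy: "u \<notin> nb V y" using nbD[of u V y] yD y d(6) by auto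
          show ?thesis
          proof (cases "y = w2")
            case True
            have "nb V y - {u,a,b} = nb V y - {a}" using by1 uy by auto
            then show ?thesis using w2(1) aw(2) True d(1) by simp
          next
            case False
            then have "a \<notin> nb V y" using nbD[of a V y] yD y na by auto
            then have "nb V y - {u,a,b} = nb V y" using by1 uy by auto
            then show ?thesis using d(17)[OF yD(1)] by simp
          qed
        qed
        then show ?thesis
          using deg_2_3_3_leaf2[OF c n V(1) w1n z(2) c2] by (simp add: n_def)
      qed
      note T = cfg1[OF c na nb ne this, folded n_def]
      show ?thesis using T tail d1 gd[OF w2(1), of 3] gd[OF w2(2), of 4] gd[OF dw(3), of 4] t by simp
    next
      case False
      then have w: "3 \<le> deg V w1" "3 \<le> deg V w3" using dw dd by fastforce+
      note T = cfg1[OF c na nb ne deg_2_3_3_x0[OF c], folded n_def]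
      show ?thesis using T tail gd[OF w(1), of 3] gd[OF w2(1), of 3] gd[OF w2(2), of 4] gd[OF w(2), of 4] t by simp
    qed
  qed
qed

text \<open>The configuration used may differ from the given one: if some vertex of degree 2 has one
  with more than one common neighbour, that one is taken; otherwise \<open>single\<close> holds
  throughout.\<close>

lemma B_residue2:
  assumes c: "deg_2_3_3 V u a b" and n: "int (card V) = 4 * q + 2"
    and no: "\<And>a b. a \<in> V \<Longrightarrow> b \<in> V \<Longrightarrow> a \<noteq> b \<Longrightarrow> nb V a = nb V b \<Longrightarrow> card (nb V a) = 3 \<Longrightarrow> \<not> (\<forall>x\<in>nb V a. deg V x = 2)"
  shows "real (num_mds V) < g (int (card V))"
proof (cases "\<exists>u' a' b'. deg_2_3_3 V u' a' b' \<and> nb V a' \<inter> nb V b' \<noteq> {u'}")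
  case True
  then obtain u' a' b' where c': "deg_2_3_3 V u' a' b'" and ne: "nb V a' \<inter> nb V b' \<noteq> {u'}" by blast
  note d = cfgD[OF c']
  show ?thesis
  proof (cases rule: deg_2_3_3_cases[OF c'])
    case (1 w w')
    show ?thesis
      by (rule B_residue2_twins[OF c' n _ 1]) (use no[OF d(4,5,7)] 1 d(8) in simp)
  next
    case (2 a'' b'' w w1 w2)
    show ?thesis by (rule B_residue2_one_common[OF 2(1) n 2(2-5)])
  next
    case (3 a'' b'' w1 w2 w3 w4)
    have u: "u' \<notin> {w1,w2,w3,w4}"
      using cfgD(8,9)[OF 3(1)] 3(2,3) by (auto simp: card_insert_if split: if_splits)
    have "nb V a' \<inter> nb V b' = nb V a'' \<inter> nb V b''" using 3(9) by (auto simp: doubleton_eq_iff)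
    also have "\<dots> = {u'}" using 3(2-4) u by auto
    finally show ?thesis using ne by simp
  qed
next
  case False
  have sg: "nb V a' \<inter> nb V b' = {u'}" if c': "deg_2_3_3 V u' a' b'" for u' a' b'
  proof (rule ccontr)
    assume "nb V a' \<inter> nb V b' \<noteq> {u'}"
    with c' have "\<exists>u' a' b'. deg_2_3_3 V u' a' b' \<and> nb V a' \<inter> nb V b' \<noteq> {u'}" by (intro exI conjI)
    with False show False by (rule notE)
  qed
  note d = cfgD[OF c]
  show ?thesis
  proof (cases rule: deg_2_3_3_cases[OF c])
    case (1 w w')
    show ?thesis
      by (rule B_residue2_twins[OF c n _ 1]) (use no[OF d(4,5,7)] 1 d(8) in simp)
  next
    case (2 a'' b'' w w1 w2)
    show ?thesis by (rule B_residue2_one_common[OF 2(1) n 2(2-5)])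
  next
    case (3 a'' b'' w1 w2 w3 w4)
    show ?thesis by (rule B_residue2_no_common[OF 3(1) n 3(2-8) sg])
  qed
qed

end

section \<open>Disjoint unions and complete bipartite graphs\<close>

context sym_graph
begin

definition separated :: "'a set \<Rightarrow> 'a set \<Rightarrow> bool" where
  "separated A B \<longleftrightarrow> A \<inter> B = {} \<and> (\<forall>x\<in>A. \<forall>y\<in>B. \<not> adj x y)"

definition complete_bip :: "'a set \<Rightarrow> 'a set \<Rightarrow> bool" where
  "complete_bip X Y \<longleftrightarrow> X \<inter> Y = {} \<and> (\<forall>x\<in>X. \<forall>y\<in>Y. adj x y) \<and>
    (\<forall>x\<in>X. \<forall>x'\<in>X. \<not> adj x x') \<and> (\<forall>y\<in>Y. \<forall>y'\<in>Y. \<not> adj y y')"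

lemma dissoc_separated:
  assumes "separated A B" "F \<subseteq> A \<union> B"
  shows "dissoc F \<longleftrightarrow> dissoc (F \<inter> A) \<and> dissoc (F \<inter> B)"
proof
  assume "dissoc F"
  then show "dissoc (F \<inter> A) \<and> dissoc (F \<inter> B)" using dissoc_mono[of F] by auto
next
  assume d: "dissoc (F \<inter> A) \<and> dissoc (F \<inter> B)"
  have nadj: "\<not> adj x y \<and> \<not> adj y x" if "x \<in> A" "y \<in> B" for x y
    using assms(1) that sym unfolding separated_def by blast
  show "dissoc F"
    unfolding dissoc_def
  proof (intro ballI impI, elim conjE)
    fix v x y assume *: "v \<in> F" "x \<in> F" "y \<in> F" "adj v x" "adj v y"
    show "x = y"
    proof (cases "v \<in> A")
      case True
      then have "x \<in> A" "y \<in> A" using * assms(2) nadj by blast+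
      then show ?thesis using d * True unfolding dissoc_def by blast
    next
      case False
      then have "v \<in> B" "x \<in> B" "y \<in> B" using * assms(2) nadj by blast+
      then show ?thesis using d * unfolding dissoc_def by blast
    qed
  qed
qed

lemma mds_separated:
  assumes s: "separated A B" and F: "F \<subseteq> A \<union> B"
  shows "mds (A \<union> B) F \<longleftrightarrow> mds A (F \<inter> A) \<and> mds B (F \<inter> B)"
proof -
  have AB: "A \<inter> B = {}" using s by (simp add: separated_def)
  have A: "dissoc (insert x F) \<longleftrightarrow> dissoc (insert x (F \<inter> A)) \<and> dissoc (F \<inter> B)" if "x \<in> A" for x
  proof -
    have "insert x F \<inter> A = insert x (F \<inter> A)" "insert x F \<inter> B = F \<inter> B" using that AB by auto
    moreover have "insert x F \<subseteq> A \<union> B" using that F by auto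
    ultimately show ?thesis using dissoc_separated[OF s, of "insert x F"] by simp
  qed
  have B: "dissoc (insert x F) \<longleftrightarrow> dissoc (F \<inter> A) \<and> dissoc (insert x (F \<inter> B))" if "x \<in> B" for x
  proof -
    have "insert x F \<inter> B = insert x (F \<inter> B)" "insert x F \<inter> A = F \<inter> A" using that AB by auto
    moreover have "insert x F \<subseteq> A \<union> B" using that F by auto
    ultimately show ?thesis using dissoc_separated[OF s, of "insert x F"] by simp
  qed
  have "(\<forall>x\<in>A \<union> B - F. \<not> dissoc (insert x F)) \<longleftrightarrow>
      (\<forall>x\<in>A - F \<inter> A. \<not> dissoc (insert x (F \<inter> A))) \<and> (\<forall>x\<in>B - F \<inter> B. \<not> dissoc (insert x (F \<inter> B)))"
    if "dissoc (F \<inter> A)" "dissoc (F \<inter> B)"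
  proof -
    have "(\<forall>x\<in>A \<union> B - F. \<not> dissoc (insert x F)) \<longleftrightarrow>
      (\<forall>x\<in>A - F \<inter> A. \<not> dissoc (insert x F)) \<and> (\<forall>x\<in>B - F \<inter> B. \<not> dissoc (insert x F))" by blast
    then show ?thesis using A B that by auto
  qed
  then show ?thesis unfolding mds_def using dissoc_separated[OF s F] F by auto
qed

lemma num_mds_separated:
  assumes s: "separated A B" and fin: "finite A" "finite B"
  shows "num_mds (A \<union> B) = num_mds A * num_mds B"
proof -
  have AB: "A \<inter> B = {}" using s by (simp add: separated_def)
  have "bij_betw (\<lambda>(F, G). F \<union> G) ({F. mds A F} \<times> {F. mds B F}) {F. mds (A \<union> B) F}"
  proof (rule bij_betw_byWitness[where f' = "\<lambda>F. (F \<inter> A, F \<inter> B)"])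
    show "\<forall>a\<in>{F. mds A F} \<times> {F. mds B F}. (\<lambda>F. (F \<inter> A, F \<inter> B)) ((\<lambda>(F, G). F \<union> G) a) = a"
      using AB by (auto dest: mds_subset)
    show "\<forall>a'\<in>{F. mds (A \<union> B) F}. (\<lambda>(F, G). F \<union> G) ((\<lambda>F. (F \<inter> A, F \<inter> B)) a') = a'"
      by (auto dest: mds_subset)
    show "(\<lambda>(F, G). F \<union> G) ` ({F. mds A F} \<times> {F. mds B F}) \<subseteq> {F. mds (A \<union> B) F}"
    proof clarsimp
      fix F G assume *: "mds A F" "mds B G"
      then have sub: "F \<subseteq> A" "G \<subseteq> B" by (auto dest: mds_subset)
      then have "(F \<union> G) \<inter> A = F" "(F \<union> G) \<inter> B = G" using AB by auto
      then show "mds (A \<union> B) (F \<union> G)" using mds_separated[OF s, of "F \<union> G"] * sub by auto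
    qed
    show "(\<lambda>F. (F \<inter> A, F \<inter> B)) ` {F. mds (A \<union> B) F} \<subseteq> {F. mds A F} \<times> {F. mds B F}"
      using mds_separated[OF s] mds_subset[of "A \<union> B"] by auto
  qed
  then have "card ({F. mds A F} \<times> {F. mds B F}) = num_mds (A \<union> B)"
    unfolding num_mds_def by (rule bij_betw_same_card)
  then show ?thesis by (simp add: num_mds_def card_cartesian_product)
qed

section \<open>Maximal dissociation sets of complete bipartite graphs\<close>

lemma complete_bip_swap: "complete_bip X Y \<Longrightarrow> complete_bip Y X"
  using sym unfolding complete_bip_def by blast

lemma complete_bip_dissoc_side: "complete_bip X Y \<Longrightarrow> F \<subseteq> X \<Longrightarrow> dissoc F"
  unfolding complete_bip_def dissoc_def by blast

lemma complete_bip_dissoc_pair: "complete_bip X Y \<Longrightarrow> x \<in> X \<Longrightarrow> y \<in> Y \<Longrightarrow> dissoc {x,y}"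
  unfolding complete_bip_def dissoc_def by blast

text \<open>A set meeting both sides has one vertex on each, because every vertex is adjacent to the
  whole other side.\<close>

lemma complete_bip_mds_cases:
  assumes k: "complete_bip X Y" and F: "mds (X \<union> Y) F"
  shows "F = X \<or> F = Y \<or> (\<exists>x\<in>X. \<exists>y\<in>Y. F = {x,y})"
proof -
  have FV: "F \<subseteq> X \<union> Y" and d: "dissoc F" and mx: "\<And>z. z \<in> X \<union> Y - F \<Longrightarrow> \<not> dissoc (insert z F)"
    using F by (auto simp: mds_def)
  have side: "F = X" if "F \<inter> Y = {}" "complete_bip X Y" "F \<subseteq> X \<union> Y" "\<And>z. z \<in> X \<union> Y - F \<Longrightarrow> \<not> dissoc (insert z F)" for X Y
  proof -
    have "F \<subseteq> X" using that by auto
    moreover have "X \<subseteq> F"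
    proof
      fix x assume x: "x \<in> X"
      show "x \<in> F"
      proof (rule ccontr)
        assume "x \<notin> F"
        moreover have "dissoc (insert x F)" by (rule complete_bip_dissoc_side[OF that(2)]) (use x \<open>F \<subseteq> X\<close> in auto)
        ultimately show False using that(4)[of x] x by auto
      qed
    qed
    ultimately show ?thesis by auto
  qed
  show ?thesis
  proof (cases "F \<inter> X = {} \<or> F \<inter> Y = {}")
    case True
    have c: "Y \<union> X = X \<union> Y" by (rule Un_commute)
    from True show ?thesis
    proof
      assume "F \<inter> X = {}"
      then have "F = Y" by (rule side[OF _ complete_bip_swap[OF k], unfolded c, OF _ FV mx])
      then show ?thesis by (rule disjI2[OF disjI1])
    next
      assume "F \<inter> Y = {}"
      then have "F = X" by (rule side[OF _ k FV mx])
      then show ?thesis by (rule disjI1)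
    qed
  next
    case False
    then obtain x y where xy: "x \<in> F" "x \<in> X" "y \<in> F" "y \<in> Y" by auto
    have 1: "z = x" if "z \<in> F" "z \<in> X" for z
    proof -
      have "adj y z" "adj y x" using k that xy sym by (auto simp: complete_bip_def)
      then show ?thesis using d that xy unfolding dissoc_def by blast
    qed
    have 2: "z = y" if "z \<in> F" "z \<in> Y" for z
    proof -
      have "adj x z" "adj x y" using k that xy by (auto simp: complete_bip_def)
      then show ?thesis using d that xy unfolding dissoc_def by blast
    qed
    have "F = {x,y}"
    proof (rule equalityI[OF subsetI subsetI])
      fix z assume "z \<in> F"
      then show "z \<in> {x,y}" using FV 1[of z] 2[of z] by blast
    next
      fix z assume "z \<in> {x,y}"
      then show "z \<in> F" using xy by blast
    qed
    then show ?thesis using xy(2,4) by (intro disjI2 bexI)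
  qed
qed

lemma complete_bip_mds_side:
  assumes k: "complete_bip X Y" and X: "2 \<le> card X"
  shows "mds (X \<union> Y) X"
proof -
  have "\<not> dissoc (insert y X)" if y: "y \<in> X \<union> Y - X" for y
  proof -
    obtain x x' where x: "x \<in> X" "x' \<in> X" "x \<noteq> x'" using X by (metis card_le_Suc0_iff_eq card.infinite not_less_eq_eq numeral_2_eq_2 zero_le)
    then have "adj y x" "adj y x'" using k y sym by (auto simp: complete_bip_def)
    then show ?thesis using x unfolding dissoc_def by blast
  qed
  then show ?thesis using complete_bip_dissoc_side[OF k] by (auto simp: mds_def)
qed

lemma complete_bip_mds_pair:
  assumes k: "complete_bip X Y" and xy: "x \<in> X" "y \<in> Y"
  shows "mds (X \<union> Y) {x,y}"
proof -
  have nxy: "x \<noteq> y" using k xy by (auto simp: complete_bip_def)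
  have "\<not> dissoc (insert z {x,y})" if z: "z \<in> X \<union> Y - {x,y}" for z
  proof (cases "z \<in> X")
    case True
    then have "adj y z" "adj y x" using k xy sym by (auto simp: complete_bip_def)
    then show ?thesis using z unfolding dissoc_def by blast
  next
    case False
    then have "adj x z" "adj x y" using k xy z by (auto simp: complete_bip_def)
    then show ?thesis using z unfolding dissoc_def by blast
  qed
  then show ?thesis using complete_bip_dissoc_pair[OF k xy] xy by (auto simp: mds_def)
qed

lemma card_complete_bip_pairs:
  assumes k: "complete_bip X Y" and fin: "finite X" "finite Y"
  shows "card ((\<lambda>(x,y). {x,y}) ` (X \<times> Y)) = card X * card Y"
proof -
  have "inj_on (\<lambda>(x,y). {x,y}) (X \<times> Y)"
    using k by (auto simp: inj_on_def complete_bip_def doubleton_eq_iff)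
  then show ?thesis by (simp add: card_image card_cartesian_product)
qed

text \<open>The sets are the two sides and the single edges; sides of size at least 2 are maximal
  and are not edges. This gives 6, 8 and 11 for K_{2,2}, K_{2,3} and K_{3,3}.\<close>

lemma num_mds_complete_bip:
  assumes k: "complete_bip X Y" and X: "2 \<le> card X" and Y: "2 \<le> card Y"
  shows "num_mds (X \<union> Y) = card X * card Y + 2"
proof -
  have fin: "finite X" "finite Y" using X Y by (auto intro: card_ge_0_finite)
  let ?P = "(\<lambda>(x,y). {x,y}) ` (X \<times> Y)"
  have 1: "mds (X \<union> Y) Y" using complete_bip_mds_side[OF complete_bip_swap[OF k] Y] by (simp add: Un_commute)
  have "{F. mds (X \<union> Y) F} = {X, Y} \<union> ?P"
  proof (rule equalityI[OF subsetI subsetI])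
    fix F assume "F \<in> {F. mds (X \<union> Y) F}"
    then have "F = X \<or> F = Y \<or> (\<exists>x\<in>X. \<exists>y\<in>Y. F = {x,y})" by (intro complete_bip_mds_cases[OF k]) simp
    then show "F \<in> {X, Y} \<union> ?P" by (elim disjE bexE) auto
  next
    fix F assume "F \<in> {X, Y} \<union> ?P"
    then consider "F = X" | "F = Y" | x y where "x \<in> X" "y \<in> Y" "F = {x,y}" by auto
    then show "F \<in> {F. mds (X \<union> Y) F}"
      by cases (use 1 complete_bip_mds_side[OF k X] complete_bip_mds_pair[OF k] in simp_all)
  qed
  moreover have "X \<inter> Y = {}" using k by (simp add: complete_bip_def)
  then have "X \<noteq> Y" "X \<notin> ?P" "Y \<notin> ?P" using X Y by auto
  then have "card ({X, Y} \<union> ?P) = 2 + card ?P" using fin by simp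
  ultimately show ?thesis using card_complete_bip_pairs[OF k fin] by (simp add: num_mds_def)
qed

text \<open>The side \<open>{x}\<close> can be extended by a vertex of \<open>Y\<close>, so
  \<open>Y\<close> and the edges remain; for P_3 this makes 3.\<close>

lemma num_mds_complete_bip_star:
  assumes k: "complete_bip {x} Y" and Y: "2 \<le> card Y"
  shows "num_mds ({x} \<union> Y) = card Y + 1"
proof -
  have fin: "finite Y" using Y by (auto intro: card_ge_0_finite)
  let ?P = "(\<lambda>(x,y). {x,y}) ` ({x} \<times> Y)"
  have 1: "mds ({x} \<union> Y) Y" using complete_bip_mds_side[OF complete_bip_swap[OF k] Y] by (simp add: Un_commute)
  have "Y \<noteq> {}" using Y by auto
  then obtain y where y: "y \<in> Y" by auto
  have "\<not> mds ({x} \<union> Y) {x}"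
  proof
    assume m: "mds ({x} \<union> Y) {x}"
    have "dissoc (insert y {x})" using complete_bip_dissoc_pair[OF k _ y, of x] by (simp add: insert_commute)
    moreover have "y \<in> {x} \<union> Y - {x}" using y k by (auto simp: complete_bip_def)
    ultimately show False using m by (auto simp: mds_def)
  qed
  then have 2: "F \<noteq> {x}" if "mds ({x} \<union> Y) F" for F using that by blast
  have "{F. mds ({x} \<union> Y) F} = insert Y ?P"
  proof (rule equalityI[OF subsetI subsetI])
    fix F assume "F \<in> {F. mds ({x} \<union> Y) F}"
    then have F: "mds ({x} \<union> Y) F" by simp
    show "F \<in> insert Y ?P" using complete_bip_mds_cases[OF k F] 2[OF F] by (elim disjE bexE) auto
  next
    fix F assume "F \<in> insert Y ?P"
    then consider "F = Y" | y where "y \<in> Y" "F = {x,y}" by auto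
    then show "F \<in> {F. mds ({x} \<union> Y) F}"
      by cases (use 1 complete_bip_mds_pair[OF k] in simp_all)
  qed
  moreover have "x \<notin> Y" using k by (simp add: complete_bip_def)
  then have "Y \<notin> ?P" by auto
  ultimately show ?thesis using card_complete_bip_pairs[OF k _ fin] fin by (simp add: num_mds_def)
qed

end

context tf_graph
begin

text \<open>A complete bipartite connected component with sides \<open>X\<close> and
  \<open>Y\<close>, described by neighbourhoods in \<open>V\<close>, which is how the branching
  arguments detect it.\<close>

definition bip_component :: "'a set \<Rightarrow> 'a set \<Rightarrow> 'a set \<Rightarrow> bool" where
  "bip_component V X Y \<longleftrightarrow> X \<subseteq> V \<and> Y \<subseteq> V \<and> X \<noteq> {} \<and> Y \<noteq> {} \<and> (\<forall>x\<in>X. nb V x = Y) \<and> (\<forall>y\<in>Y. nb V y = X)"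

lemma bip_component_complete_bip:
  assumes "bip_component V X Y"
  shows "complete_bip X Y" "separated (X \<union> Y) (V - (X \<union> Y))" "V = (X \<union> Y) \<union> (V - (X \<union> Y))" "X \<inter> Y = {}"
proof -
  have nb: "\<And>x. x \<in> X \<Longrightarrow> nb V x = Y" "\<And>y. y \<in> Y \<Longrightarrow> nb V y = X" and sub: "X \<subseteq> V" "Y \<subseteq> V" and ne: "X \<noteq> {}" "Y \<noteq> {}"
    using assms by (auto simp: bip_component_def)
  show "V = (X \<union> Y) \<union> (V - (X \<union> Y))" using sub by auto
  show disj: "X \<inter> Y = {}"
  proof (rule ccontr)
    assume "X \<inter> Y \<noteq> {}"
    then obtain z where "z \<in> X" "z \<in> Y" by auto
    then have "z \<in> nb V z" using nb by auto
    then show False using irrefl by (simp add: nb_def)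
  qed
  have adj_iff: "adj x y \<longleftrightarrow> y \<in> nb V x" if "y \<in> V" for x y using that by (simp add: nb_def)
  have X: "adj x y \<longleftrightarrow> y \<in> Y" if "x \<in> X" "y \<in> V" for x y
    using adj_iff[OF that(2)] nb(1)[OF that(1)] by simp
  have Y: "adj x y \<longleftrightarrow> y \<in> X" if "x \<in> Y" "y \<in> V" for x y
    using adj_iff[OF that(2)] nb(2)[OF that(1)] by simp
  show "complete_bip X Y"
    unfolding complete_bip_def
  proof (intro conjI ballI disj)
    show "adj x y" if "x \<in> X" "y \<in> Y" for x y using X[of x y] that sub by auto
    show "\<not> adj x y" if "x \<in> X" "y \<in> X" for x y using X[of x y] that sub disj by auto
    show "\<not> adj x y" if "x \<in> Y" "y \<in> Y" for x y using Y[of x y] that sub disj by auto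
  qed
  show "separated (X \<union> Y) (V - (X \<union> Y))"
    unfolding separated_def
  proof (intro conjI ballI)
    show "\<not> adj x y" if "x \<in> X \<union> Y" "y \<in> V - (X \<union> Y)" for x y
      using X[of x y] Y[of x y] that by auto
  qed auto
qed

lemma num_mds_bip_component:
  assumes "finite V" "bip_component V X Y"
  shows "num_mds V = num_mds (X \<union> Y) * num_mds (V - (X \<union> Y))"
  using num_mds_separated[OF bip_component_complete_bip(2)[OF assms(2)]] bip_component_complete_bip(3)[OF assms(2)] assms(1)
  by (metis finite_Un)

lemma card_bip_component:
  assumes "finite V" "bip_component V X Y"
  shows "int (card (V - (X \<union> Y))) = int (card V) - int (card X) - int (card Y)" "V - (X \<union> Y) \<subset> V"
proof -
  have sub: "X \<subseteq> V" "Y \<subseteq> V" "X \<noteq> {}" using assms(2) by (auto simp: bip_component_def)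
  then have fin: "finite X" "finite Y" using assms(1) finite_subset by auto
  have "card (X \<union> Y) = card X + card Y" using card_Un_disjoint[OF fin bip_component_complete_bip(4)[OF assms(2)]] .
  moreover have "card (V - (X \<union> Y)) + card (X \<union> Y) = card V"
    using card_Diff_subset[of "X \<union> Y" V] card_mono[of V "X \<union> Y"] sub fin assms(1) by simp
  ultimately show "int (card (V - (X \<union> Y))) = int (card V) - int (card X) - int (card Y)" by linarith
  show "V - (X \<union> Y) \<subset> V" using sub by auto
qed

section \<open>Graphs without extremal components\<close>

text \<open>Minimum degree 2 excludes the components K_1, K_2 and P_3; the sizes (3,2) are covered
  by exchanging the sides.\<close>

definition no_extremal_component :: "'a set \<Rightarrow> bool" where
  "no_extremal_component V \<longleftrightarrow> finite V \<and> subsets_bounded V \<and> (\<forall>x\<in>V. 2 \<le> deg V x) \<and>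
    (\<forall>X Y. bip_component V X Y \<longrightarrow> (card X, card Y) \<notin> {(2,2),(2,3),(3,3)})"

lemma plainD:
  assumes "no_extremal_component V"
  shows "finite V" "subsets_bounded V" "\<And>x. x \<in> V \<Longrightarrow> 2 \<le> deg V x"
    "\<And>X Y. bip_component V X Y \<Longrightarrow> (card X, card Y) \<notin> {(2,2),(2,3),(3,3)}"
  using assms unfolding no_extremal_component_def by blast+

text \<open>The edge between two vertices of degree 2 extends to the path of
  \<open>path_less\<close>, whose exception would be a component C_4.\<close>

lemma path_no_extremal_component:
  assumes p: "no_extremal_component V" and a: "a \<in> V" "deg V a = 2" and v: "v \<in> nb V a" "deg V v = 2"
    and d4: "\<And>x y. x \<in> V \<Longrightarrow> deg V x = 2 \<Longrightarrow> y \<in> nb V x \<Longrightarrow> deg V y \<le> 4"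
  shows "real (num_mds V) < g (int (card V))"
proof -
  note P = plainD[OF p]
  have vV: "v \<in> V" "a \<in> nb V v" using nbD[OF v(1) a(1)] by auto
  obtain c where c: "nb V a = {v,c}" "v \<noteq> c" using deg2_other[OF P(1) a(2) v(1)] by (elim exE conjE)
  obtain b where b: "nb V v = {a,b}" "a \<noteq> b" using deg2_other[OF P(1) v(2) vV(2)] by (elim exE conjE)
  have cn: "c \<in> nb V a" and bn: "b \<in> nb V v" using b c by auto
  have cV: "c \<in> V" "a \<in> nb V c" using nbD[OF cn a(1)] by auto
  have bV: "b \<in> V" "v \<in> nb V b" using nbD[OF bn vV(1)] by auto
  have bc: "b \<noteq> c" using nb_triangle[OF cn v(1) a(1)] bn by auto
  have na: "nb V a = {c,v}" using c by auto
  show ?thesis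
  proof (rule path_less[OF P(1,2) a(1) vV(1) na b(1,2) c(2)[symmetric] bc P(3)])
    show "deg V b \<le> 4" "deg V c \<le> 4" using d4[OF vV(1) v(2) bn] d4[OF a cn] by auto
    show "\<not> (deg V b = 2 \<and> deg V c = 2 \<and> c \<in> nb V b)"
    proof
      assume d: "deg V b = 2 \<and> deg V c = 2 \<and> c \<in> nb V b"
      then have cb: "b \<in> nb V c" using nbD[of c V b] bV by auto
      have nb: "nb V b = {c,v}" by (rule twin_nb[OF P(1)]) (use d cb bn cV vV c in auto)
      have nc: "nb V c = {a,b}" by (rule twin_nb[OF P(1)]) (use d cn a bV b in auto)
      have "bip_component V {a,b} {c,v}"
        unfolding bip_component_def using a(1) bV cV vV na nb nc b by auto
      then show False using P(4)[of "{a,b}" "{c,v}"] b c bc by auto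
    qed
  qed
qed

text \<open>By triangle-freeness the other neighbour \<open>b\<close> of \<open>u\<close> is not
  adjacent to \<open>v\<close>, so its degree survives the deletion, while \<open>u\<close> becomes
  a leaf at \<open>b\<close>.\<close>

lemma del_leaf:
  assumes fin: "finite V" and v: "v \<in> V" and u: "u \<in> nb V v" "deg V u = 2"
  obtains b where "nb V u = {v,b}" "b \<noteq> v" "b \<in> V - {v}" "u \<in> V - {v}" "u \<in> nb (V - {v}) b" "deg (V - {v}) u = 1"
    "deg (V - {v}) b = deg V b" "b \<notin> nb V v"
proof -
  have uV: "u \<in> V" "v \<in> nb V u" using nbD[OF u(1) v] by auto
  obtain b where b: "nb V u = {v,b}" "v \<noteq> b" using deg2_other[OF fin u(2) uV(2)] by (elim exE conjE)
  have bn: "b \<in> nb V u" using b by simp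
  have bV: "b \<in> V" "u \<in> nb V b" using nbD[OF bn uV(1)] by auto
  have bv: "b \<notin> nb V v" "v \<notin> nb V b" using nb_triangle[OF uV(2) bn uV(1)] nbD[of b V v] v by auto
  have "u \<noteq> v" using uV(2) irrefl by (auto simp: nb_def)
  show ?thesis
    by (rule that[of b]) (use b bV bv uV \<open>u \<noteq> v\<close> in \<open>auto simp: nb_Diff insert_Diff_if\<close>)
qed

lemma no_extremal_component_residue0:
  assumes p: "no_extremal_component V" and n: "int (card V) = 4 * q" and ne: "V \<noteq> {}"
  shows "real (num_mds V) < g (int (card V))"
proof (cases "\<exists>v\<in>V. 3 \<le> deg V v")
  case True
  then obtain v where v: "v \<in> V" "3 \<le> deg V v" by blast
  note P = plainD[OF p]
  have "real (num_mds V) \<le> 11/12 * g (int (card V))"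
    using S_residue0[OF P(1,2) n v] P(3) nb_subset by blast
  then show ?thesis using g_pos[of "int (card V)"] by linarith
next
  case False
  note P = plainD[OF p]
  then have d2: "deg V x = 2" if "x \<in> V" for x using P(3)[OF that] False that by force
  obtain a where a: "a \<in> V" using ne by auto
  have "nb V a \<noteq> {}" using d2[OF a] by auto
  then obtain v where v: "v \<in> nb V a" by auto
  show ?thesis
  proof (rule path_no_extremal_component[OF p a d2[OF a] v d2])
    show "v \<in> V" using v nb_subset by blast
    fix x y assume "x \<in> V" "y \<in> nb V x"
    then have "y \<in> V" using nb_subset by blast
    then show "deg V y \<le> 4" using d2[of y] by simp
  qed
qed

lemma del_props:
  assumes "finite V" "subsets_bounded V" "v \<in> V"
  shows "finite (V - {v})" "subsets_bounded (V - {v})" "int (card (V - {v})) = int (card V) - 1"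
  using assms subsets_bounded_subset[of V "V - {v}"] int_card_minus1[of V v] by auto

lemma ex_deg2_neighbour_config:
  assumes p: "no_extremal_component V" and x: "x \<in> V" "deg V x = 2"
    and d3: "\<And>y. y \<in> nb V x \<Longrightarrow> deg V y \<le> 3"
    and nadj: "\<And>x y. x \<in> V \<Longrightarrow> y \<in> nb V x \<Longrightarrow> \<not> (deg V x = 2 \<and> deg V y = 2)"
  obtains a b where "deg_2_3_3 V x a b"
proof -
  note P = plainD[OF p]
  obtain a b where ab: "nb V x = {a,b}" "a \<noteq> b" using x(2) by (auto simp: card_2_iff)
  have d: "deg V y = 3" if "y \<in> nb V x" for y
  proof -
    have "y \<in> V" using that nb_subset by blast
    then show ?thesis using d3[OF that] P(3)[of y] nadj[OF x(1) that] x(2) by auto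
  qed
  have "deg_2_3_3 V x a b"
    unfolding deg_2_3_3_def using P(1,2,3) x ab d nadj by auto
  then show ?thesis by (rule that)
qed

lemma deg_2_3_3_no_K23:
  assumes p: "no_extremal_component V" and ab: "a \<in> V" "b \<in> V" "a \<noteq> b" "nb V a = nb V b" "card (nb V a) = 3"
  shows "\<not> (\<forall>x\<in>nb V a. deg V x = 2)"
proof
  assume all: "\<forall>x\<in>nb V a. deg V x = 2"
  note P = plainD[OF p]
  have "nb V x = {a,b}" if x: "x \<in> nb V a" for x
    by (rule twin_nb[OF P(1) x _ ab(1,2,3)]) (use x ab all in auto)
  moreover have "nb V a \<noteq> {}" using ab(5) by auto
  ultimately have "bip_component V {a,b} (nb V a)"
    unfolding bip_component_def using ab nb_subset by auto
  then show False using P(4)[of "{a,b}" "nb V a"] ab by auto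
qed

text \<open>At a vertex \<open>v\<close> of degree at least 4 the count of \<open>V - {v}\<close>, a
  graph of residue 0, is improved: by \<open>low0\<close> if \<open>v\<close> has a neighbour of
  degree 2, by \<open>S_residue0\<close> if all degrees are at least 3.\<close>

lemma no_extremal_component_residue1:
  assumes p: "no_extremal_component V" and n: "int (card V) = 4 * q + 1"
  shows "real (num_mds V) < g (int (card V))"
proof -
  define n where "n = int (card V)"
  note t = g_table1[OF n, folded n_def] g_pos[of n]
  note P = plainD[OF p]
  have S: "real (num_mds V) \<le> real (num_mds (V - {v})) + g (n - 5) + 4 * g (n - int m - 4)"
    if v: "v \<in> V" "4 \<le> deg V v" and m: "\<And>u. u \<in> nb V v \<Longrightarrow> m \<le> deg V u" for v m
  proof -
    have "real (num_mds V) \<le> real (num_mds (V - {v})) + g (n - 1 - int (deg V v)) + real (deg V v) * g (n - int m - int (deg V v))"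
      unfolding n_def by (rule S_num_const[OF P(1,2) v(1) m])
    moreover have "g (n - 1 - int (deg V v)) \<le> g (n - 5)" using v by (intro g_mono) auto
    moreover have "real (deg V v) * g (n - int m - int (deg V v)) \<le> real 4 * g (n - int m - int 4)"
      using v by (intro g_mult_decr) auto
    ultimately show ?thesis by simp
  qed
  have nbV: "y \<in> V" if "y \<in> nb V x" for x y using that nb_subset by blast
  show ?thesis
  proof (cases "\<exists>v\<in>V. 4 \<le> deg V v \<and> (\<exists>u\<in>nb V v. deg V u = 2)")
    case True
    then obtain v u where v: "v \<in> V" "4 \<le> deg V v" and u: "u \<in> nb V v" "deg V u = 2" by blast
    obtain b where b: "u \<in> V - {v}" "deg (V - {v}) u = 1" using del_leaf[OF P(1) v(1) u] by metis
    note H = del_props[OF P(1,2) v(1)]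
    have "real (num_mds (V - {v})) \<le> 25/36 * g (int (card (V - {v})))"
      by (rule low0[OF H(1,2) b(1), where q = q]) (use b(2) H(3) n in auto)
    then have "real (num_mds (V - {v})) \<le> 25/36 * g (n - 1)" using H(3) by (simp add: n_def)
    then show ?thesis using S[OF v, of 2] P(3)[OF nbV] t unfolding n_def[symmetric] by simp
  next
    case no42: False
    have d3: "deg V y \<le> 3" if "x \<in> V" "deg V x = 2" "y \<in> nb V x" for x y
    proof (rule ccontr)
      assume "\<not> deg V y \<le> 3"
      then have "4 \<le> deg V y" by simp
      then show False using no42 that nbD[OF that(3,1)] by blast
    qed
    show ?thesis
    proof (cases "\<exists>x\<in>V. \<exists>y\<in>nb V x. deg V x = 2 \<and> deg V y = 2")
      case True
      then obtain x y where "x \<in> V" "y \<in> nb V x" "deg V x = 2" "deg V y = 2" by blast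
      then show ?thesis using path_no_extremal_component[OF p, of x y] d3 by force
    next
      case nadj: False
      show ?thesis
      proof (cases "\<exists>x\<in>V. deg V x = 2")
        case True
        then obtain x where x: "x \<in> V" "deg V x = 2" by blast
        obtain a b where c: "deg_2_3_3 V x a b"
          by (rule ex_deg2_neighbour_config[OF p x]) (use d3[OF x] nadj in blast)+
        note d = cfgD[OF c]
        have "\<not> (nb V a = nb V b \<and> (\<forall>x\<in>nb V a. deg V x = 2))"
          using deg_2_3_3_no_K23[OF p d(4,5,7)] d(8) by blast
        from B_residue1[OF c n this] show ?thesis using g_pos[of "int (card V)"] by linarith
      next
        case False
        then have d3: "3 \<le> deg V x" if "x \<in> V" for x using P(3)[OF that] that by force
        have "\<exists>v\<in>V. 4 \<le> deg V v"
        proof (rule ccontr)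
          assume "\<not> ?thesis"
          then have "deg V v = 3" if "v \<in> V" for v using d3[OF that] that by force
          then have "even (card V)" by (rule even_card_regular3[OF P(1)])
          then show False using n by presburger
        qed
        then obtain v where v: "v \<in> V" "4 \<le> deg V v" by blast
        note H = del_props[OF P(1,2) v(1)]
        have "nb V v \<noteq> {}" using v by auto
        then obtain u where u: "u \<in> nb V v" by auto
        note uD = nbD[OF u v(1)]
        have "\<not> nb V u \<subseteq> {v}" using d3[of u] uD card_mono[of "{v}" "nb V u"] by auto
        \<comment> \<open>\<open>x\<close> has distance two from \<open>v\<close>, so it keeps its
          degree of at least 3 in \<open>V - {v}\<close>, and its neighbours keep degree at least
          2.\<close>
        then obtain x where x: "x \<in> nb V u" "x \<noteq> v" by auto
        have xv: "x \<notin> nb V v" using nb_triangle[OF _ x(1), of v] uD nbD[of x V v] v by auto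
        have xV: "x \<in> V - {v}" using x nbV by auto
        have "v \<notin> nb V x" using xv nbD[of v V x] xV by auto
        then have "nb (V - {v}) x = nb V x" by (simp add: nb_Diff)
        then have dx: "3 \<le> deg (V - {v}) x" using d3 xV by auto
        have dH: "2 \<le> deg (V - {v}) y" if "y \<in> nb (V - {v}) x" for y
        proof -
          have "y \<in> V" using that nb_subset by blast
          then have "3 \<le> deg V y" by (rule d3)
          then show ?thesis using card_Diff1_le[of "nb V y" v] P(1) by (cases "v \<in> nb V y") (auto simp: nb_Diff)
        qed
        have "real (num_mds (V - {v})) \<le> 11/12 * g (int (card (V - {v})))"
          by (rule S_residue0[OF H(1,2) _ xV dx dH, where q = q]) (use H(3) n in auto)
        then have "real (num_mds (V - {v})) \<le> 11/12 * g (n - 1)" using H(3) by (simp add: n_def)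
        then show ?thesis using S[OF v, of 3] d3[OF nbV] t unfolding n_def[symmetric] by simp
      qed
    qed
  qed
qed

text \<open>Degree at least 5 is settled by 11/18 + 2/27 + 5/18 = 26/27. Degree 4 with a neighbour
  of degree 2 would give 109/108, so the leaf created by the deletion is used. Below that, odd order
  forces a vertex of degree 2.\<close>

lemma no_extremal_component_residue3:
  assumes p: "no_extremal_component V" and n: "int (card V) = 4 * q + 3"
  shows "real (num_mds V) < g (int (card V))"
proof -
  define n where "n = int (card V)"
  note t = g_table3[OF n, folded n_def] g_pos[of n]
  note P = plainD[OF p]
  have nbV: "y \<in> V" if "y \<in> nb V x" for x y using that nb_subset by blast
  show ?thesis
  proof (cases "\<exists>v\<in>V. 5 \<le> deg V v")
    case True
    then obtain v where v: "v \<in> V" "5 \<le> deg V v" by blast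
    have "real (num_mds V) \<le> real (num_mds (V - {v})) + g (n - 1 - int (deg V v)) + real (deg V v) * g (n - int 2 - int (deg V v))"
      unfolding n_def by (rule S_num_const[OF P(1,2) v(1)]) (use P(3)[OF nbV] in auto)
    moreover have "g (n - 1 - int (deg V v)) \<le> g (n - 6)" using v by (intro g_mono) auto
    moreover have "real (deg V v) * g (n - int 2 - int (deg V v)) \<le> real 5 * g (n - int 2 - int 5)"
      using v by (intro g_mult_decr) auto
    moreover have "real (num_mds (V - {v})) \<le> g (n - 1)" unfolding n_def by (rule num_mds_minus1[OF P(1,2) v(1)])
    ultimately show ?thesis using t unfolding n_def[symmetric] by simp
  next
    case False
    then have d4: "deg V v \<le> 4" if "v \<in> V" for v using that by force
    show ?thesis
    proof (cases "\<exists>x\<in>V. \<exists>y\<in>nb V x. deg V x = 2 \<and> deg V y = 2")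
      case True
      then obtain x y where "x \<in> V" "y \<in> nb V x" "deg V x = 2" "deg V y = 2" by blast
      then show ?thesis using path_no_extremal_component[OF p, of x y] d4[OF nbV] by blast
    next
      case nadj: False
      show ?thesis
      proof (cases "\<exists>v\<in>V. deg V v = 4")
        case True
        then obtain v where v: "v \<in> V" "deg V v = 4" by blast
        show ?thesis
        proof (cases "\<exists>u\<in>nb V v. deg V u = 2")
          case True
          then obtain u where u: "u \<in> nb V v" "deg V u = 2" by blast
          obtain b where b: "nb V u = {v,b}" "b \<noteq> v" "b \<in> V - {v}" "u \<in> V - {v}" "u \<in> nb (V - {v}) b" "deg (V - {v}) u = 1"
            "deg (V - {v}) b = deg V b" "b \<notin> nb V v" using del_leaf[OF P(1) v(1) u] by metis
          note H = del_props[OF P(1,2) v(1)]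
          have "b \<in> nb V u" using b(1) by simp
          then have "deg V b \<noteq> 2" using nadj u nbV by blast
          then have db: "3 \<le> deg (V - {v}) b" using P(3)[of b] b(3,7) by auto
          have "real (num_mds (V - {v})) \<le> 21/22 * g (int (card (V - {v})))"
            by (rule leaf3(3)[OF H(1,2) b(3,5,6) db, where q = q]) (use H(3) n in auto)
          then have "real (num_mds (V - {v})) \<le> 21/22 * g (n - 1)" using H(3) by (simp add: n_def)
          moreover have "real (num_mds V) \<le> real (num_mds (V - {v})) + g (n - 1 - int (deg V v)) + real (deg V v) * g (n - int 2 - int (deg V v))"
            unfolding n_def by (rule S_num_const[OF P(1,2) v(1)]) (use P(3)[OF nbV] in auto)
          ultimately show ?thesis using v t unfolding n_def[symmetric] by simp
        next
          case False
          then have "3 \<le> deg V u" if "u \<in> nb V v" for u using P(3)[OF nbV[OF that]] that by force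
          then have "real (num_mds V) \<le> real (num_mds (V - {v})) + g (n - 1 - int (deg V v)) + real (deg V v) * g (n - int 3 - int (deg V v))"
            unfolding n_def by (intro S_num_const[OF P(1,2) v(1)])
          moreover have "real (num_mds (V - {v})) \<le> g (n - 1)" unfolding n_def by (rule num_mds_minus1[OF P(1,2) v(1)])
          ultimately show ?thesis using v t unfolding n_def[symmetric] by simp
        qed
      next
        case False
        then have d3: "deg V v \<le> 3" if "v \<in> V" for v using d4[OF that] that by force
        have "\<exists>x\<in>V. deg V x = 2"
        proof (rule ccontr)
          assume "\<not> ?thesis"
          then have "deg V v = 3" if "v \<in> V" for v using d3[OF that] P(3)[OF that] that by force
          then have "even (card V)" by (rule even_card_regular3[OF P(1)])
          then show False using n by presburger
        qed
        then obtain x where x: "x \<in> V" "deg V x = 2" by blast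
        obtain a b where c: "deg_2_3_3 V x a b"
          by (rule ex_deg2_neighbour_config[OF p x]) (use d3[OF nbV] nadj in blast)+
        show ?thesis by (rule B_residue3[OF c n])
      qed
    qed
  qed
qed

text \<open>\<open>alt\<close> excludes a single leaf at a vertex of degree 3, the worst case of
  \<open>leaf3\<close> in residue 1. One leaf at degree 4 and two leaves at degree 3 both give
  11/16.\<close>

lemma leaf_residue1_strong:
  assumes fin: "finite V" and h: "subsets_bounded V" and n: "int (card V) = 4 * q + 1" and b: "b \<in> V"
    and u: "u \<in> nb V b" "deg V u = 1" and d: "3 \<le> deg V b" "deg V b \<le> 4"
    and alt: "deg V b = 4 \<or> (\<exists>u'\<in>nb V b. u' \<noteq> u \<and> deg V u' = 1)"
  shows "real (num_mds V) \<le> 11/16 * g (int (card V))"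
proof (rule leaf_le3[OF fin h b u], goal_cases)
  case 1
  then have "deg V b = 4" using alt by blast
  then show ?case using 1(1) g_table1[OF n] g_pos[of "int (card V)"] by simp
next
  case (2 l)
  then have "l \<in> {2,3,4}" "deg V b \<in> {3,4}" using d by auto
  then have "(l, deg V b) \<in> {(2,3),(3,3),(2,4),(3,4),(4,4)}" using 2(2) by auto
  then show ?case using 2(3) g_table1[OF n] g_pos[of "int (card V)"] by auto
qed

text \<open>Branching at \<open>v\<close> with \<open>low1\<close> tolerates two neighbours of
  degree 2, while three give 67/66. For three or four, either the deletion of \<open>v\<close>
  leaves a situation at \<open>b\<close> covered by the factor 11/16, or \<open>B_rule\<close> at
  \<open>u\<close> succeeds.\<close>

lemma residue2_deg4_deg2:
  assumes p: "no_extremal_component V" and n: "int (card V) = 4 * q + 2" and d4: "\<And>x. x \<in> V \<Longrightarrow> deg V x \<le> 4"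
    and nadj: "\<And>x y. x \<in> V \<Longrightarrow> y \<in> nb V x \<Longrightarrow> \<not> (deg V x = 2 \<and> deg V y = 2)"
    and v: "v \<in> V" "deg V v = 4" and u: "u \<in> nb V v" "deg V u = 2"
  shows "real (num_mds V) < g (int (card V))"
proof -
  define n where "n = int (card V)"
  note t = g_table2[OF n, folded n_def] g_pos[of n]
  note P = plainD[OF p]
  have nbV: "y \<in> V" if "y \<in> nb V x" for x y using that nb_subset by blast
  have vn: "v \<notin> nb V v" using irrefl by (auto simp: nb_def)
  define M where "M = {x \<in> nb V v. deg V x = 2}"
  have M: "finite M" "M \<subseteq> nb V v" "u \<in> M" using P(1) u by (auto simp: M_def)
  have Mle: "card M \<le> 4" using card_mono[OF _ M(2)] P(1) v by simp
  have S: "real (num_mds V) \<le> real (num_mds (V - {v})) + g (n - 5) + (real (card M) * g (n - 6) + real (4 - card M) * g (n - 7))"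
  proof -
    have "real (num_mds V) \<le> real (num_mds (V - {v})) + g (n - 1 - int (deg V v))
        + (\<Sum>w\<in>nb V v. g (n - int (if w \<in> M then 2 else 3) - int (deg V v)))"
      unfolding n_def
    proof (rule S_num[OF P(1,2) v(1)])
      fix w assume w: "w \<in> nb V v"
      show "(if w \<in> M then 2 else 3) \<le> deg V w" using P(3)[OF nbV[OF w]] w by (auto simp: M_def)
    qed
    also have "(\<Sum>w\<in>nb V v. g (n - int (if w \<in> M then 2 else 3) - int (deg V v)))
        = (\<Sum>w\<in>nb V v - M. g (n - int (if w \<in> M then 2 else 3) - int (deg V v))) + (\<Sum>w\<in>M. g (n - int (if w \<in> M then 2 else 3) - int (deg V v)))"
      using P(1) M by (intro sum.subset_diff) auto
    also have "(\<Sum>w\<in>M. g (n - int (if w \<in> M then 2 else 3) - int (deg V v))) = real (card M) * g (n - 6)" using v by simp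
    also have "(\<Sum>w\<in>nb V v - M. g (n - int (if w \<in> M then 2 else 3) - int (deg V v))) = (\<Sum>w\<in>nb V v - M. g (n - 7))"
      using v by (intro sum.cong) auto
    also have "\<dots> = real (4 - card M) * g (n - 7)" using v M P(1) by (simp add: card_Diff_subset)
    finally show ?thesis using v by simp
  qed
  obtain b where b: "nb V u = {v,b}" "b \<noteq> v" "b \<in> V - {v}" "u \<in> V - {v}" "u \<in> nb (V - {v}) b" "deg (V - {v}) u = 1"
    "deg (V - {v}) b = deg V b" "b \<notin> nb V v" using del_leaf[OF P(1) v(1) u] by metis
  note H = del_props[OF P(1,2) v(1)]
  have nH: "int (card (V - {v})) = 4 * q + 1" using H(3) n by simp
  have bu: "b \<in> nb V u" using b(1) by simp
  have db: "3 \<le> deg V b" using nadj[OF nbV[OF u(1)] bu] u(2) P(3)[of b] b(3) by auto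
  have low: "real (num_mds (V - {v})) \<le> 19/24 * g (n - 1)"
    using low1[OF H(1,2) b(4) _ nH] b(6) H(3) by (simp add: n_def)
  show ?thesis
  proof (cases "card M \<le> 2")
    case True
    have "card M = 0 \<or> card M = 1 \<or> card M = 2" using True by linarith
    then show ?thesis using S low t unfolding n_def[symmetric] by auto
  next
    case False
    show ?thesis
    proof (cases "deg V b = 4 \<or> (\<exists>u'\<in>M. u' \<noteq> u \<and> b \<in> nb V u')")
      case True
      have "deg (V - {v}) b = 4 \<or> (\<exists>u'\<in>nb (V - {v}) b. u' \<noteq> u \<and> deg (V - {v}) u' = 1)"
        using True
      proof (elim disjE bexE conjE)
        fix u' assume u': "u' \<in> M" "u' \<noteq> u" "b \<in> nb V u'"
        then have u'V: "u' \<in> nb V v" "deg V u' = 2" by (auto simp: M_def)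
        have "v \<in> nb V u'" using nbD[OF u'V(1) v(1)] by auto
        then have "deg (V - {v}) u' = 1" using u'V P(1) by (simp add: nb_Diff)
        moreover have "u' \<in> nb (V - {v}) b" using nbD[OF u'(3) nbV[OF u'V(1)]] u'V vn by (auto simp: nb_Diff)
        ultimately show ?thesis using u' by blast
      qed (use b(7) in simp)
      then have "real (num_mds (V - {v})) \<le> 11/16 * g (int (card (V - {v})))"
        using leaf_residue1_strong[OF H(1,2) nH b(3,5,6)] db b(3,7) d4[of b] by auto
      then have "real (num_mds (V - {v})) \<le> 11/16 * g (n - 1)" using H(3) by (simp add: n_def)
      moreover have "card M = 3 \<or> card M = 4" using False Mle by linarith
      ultimately show ?thesis using S t unfolding n_def[symmetric] by auto
    next
      case far: False
      have b3: "deg V b = 3" using db d4[of b] far b(3) by auto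
      have Mb: "x \<notin> nb V b" if "x \<in> M" "x \<noteq> u" for x
        using far that nbD[of x V b] b(3) by auto
      \<comment> \<open>Two further degree-2 neighbours \<open>x\<close>, \<open>y\<close> of
        \<open>v\<close> are fixed; neither is adjacent to \<open>b\<close>. The overlap of the
        neighbourhoods of \<open>b\<close> and \<open>v\<close> then depends only on the fourth
        neighbour \<open>z\<close>.\<close>
      have "2 \<le> card (M - {u})" using False M by simp
      then obtain T where T: "T \<subseteq> M - {u}" "card T = 2" "finite T" using obtain_subset_with_card_n[of 2 "M - {u}"] by metis
      then obtain x y where xy: "T = {x,y}" "x \<noteq> y" by (auto simp: card_2_iff)
      have xyM: "x \<in> M" "y \<in> M" "x \<noteq> u" "y \<noteq> u" using T xy by auto
      have xyv: "x \<in> nb V v" "y \<in> nb V v" using xyM M by auto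
      have "card (nb V v - {u,x,y}) = 1"
        using v u xyv xyM xy P(1) by (simp add: card_Diff_subset)
      then obtain z where z: "nb V v - {u,x,y} = {z}" by (auto simp: card_1_singleton_iff)
      have nv: "nb V v - {u} = {x,y,z}" and zn: "z \<noteq> x" "z \<noteq> y" "z \<noteq> u" "z \<in> nb V v" using z u xyv xyM by auto
      have nvv: "nb V v = {u,x,y,z}" using nv u(1) by blast
      have uV: "u \<in> V" using nbV u by blast
      have uv: "v \<notin> nb V b" using b(8) nbD[of v V b] b(3) by auto
      have ub: "u \<in> nb V b" using nbD[OF bu uV] by auto
      have xb: "x \<notin> nb V b" "y \<notin> nb V b" using Mb xyM by auto
      have dd: "2 \<le> deg V w" if "w \<in> nb V w'" for w w' using P(3)[OF nbV[OF that]] .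
      have nu: "nb V u = {b,v}" using b(1) by auto
      have x0: "count_le V (\<lambda>F. isolated V F u) (g (n - 3))" using count_le_iso[OF P(1,2) uV] u(2) by (simp add: n_def)
      have x1: "count_le V (\<lambda>F. isolated V F b \<and> isolated V F v) (g (n - int (2 + card (nb V b \<union> nb V v))))"
        unfolding n_def using b(3,8) v(1) b(2) by (intro B_iso_pair[OF P(1,2)]) auto
      have cU: "card (nb V b \<union> nb V v) = 7 - card (nb V b \<inter> nb V v)"
        using card_Un_Int[of "nb V b" "nb V v"] P(1) v b3 by simp
      note R = B_rule[OF P(1,2) uV nu b(2) x0 x1, folded n_def]
      have s2: "(\<Sum>w\<in>nb V v - {u}. g (n - int (deg V v + deg V w + (if w \<in> nb V b then 0 else 1)))) \<le> real 3 * g (n - 7)"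
      proof (rule sum_g_le)
        show "card (nb V v - {u}) = 3" using v u P(1) by simp
        fix w assume w: "w \<in> nb V v - {u}"
        \<comment> \<open>For a neighbour of \<open>b\<close> the extra deleted vertex is missing,
          but its degree is at least 3 and makes up for it.\<close>
        have "3 \<le> deg V w" if "w \<in> nb V b"
        proof -
          have "deg V w \<noteq> 2" using Mb[of w] that w by (auto simp: M_def)
          then show ?thesis using dd[of w v] w by force
        qed
        then show "n - int (deg V v + deg V w + (if w \<in> nb V b then 0 else 1)) \<le> n - 7"
          using v(2) dd[of w v] w by auto
      qed (use P(1) in auto)
      show ?thesis
      proof (cases "z \<in> nb V b")
        case False
        then have C: "nb V b \<inter> nb V v = {u}" unfolding nvv using xb ub False by auto
        have s1: "(\<Sum>w\<in>nb V b - {u}. g (n - int (deg V b + deg V w))) \<le> real 2 * g (n - 5)"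
          by (rule sum_g_le) (use b3 ub P(1) dd in force)+
        have s3: "(\<Sum>w\<in>nb V v - nb V b. g (n - int (deg V b + deg V v + 2 - card (nb V b \<inter> nb V v) + card (nb V w - nb V b - {v})))) \<le> real 3 * g (n - 8)"
        proof (rule sum_g_le)
          have "nb V v - nb V b = {x,y,z}" unfolding nvv using xb ub False by auto
          then show "card (nb V v - nb V b) = 3" using xy zn by simp
        qed (use P(1) C b3 v(2) in auto)
        show ?thesis using R s1 s2 s3 cU C b3 v(2) u(2) t unfolding n_def[symmetric] by simp
      next
        case True
        then have C: "nb V b \<inter> nb V v = {u,z}" unfolding nvv using xb ub True by auto
        have "deg V z \<noteq> 2" using Mb[of z] True zn by (auto simp: M_def)
        then have dz: "3 \<le> deg V z" using dd[of z v] zn by force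
        have "card (nb V b - {u,z}) = 1" using b3 ub True zn P(1) by (simp add: card_Diff_subset)
        then obtain y' where y': "nb V b - {u,z} = {y'}" by (auto simp: card_1_singleton_iff)
        then have nbb: "nb V b - {u} = {z,y'}" "z \<noteq> y'" "y' \<in> nb V b" using True zn by auto
        have "g (n - int (deg V b + deg V z)) \<le> g (n - 6)" "g (n - int (deg V b + deg V y')) \<le> g (n - 5)"
          using dz dd[OF nbb(3)] b3 by (auto intro!: g_mono)
        then have s1: "(\<Sum>w\<in>nb V b - {u}. g (n - int (deg V b + deg V w))) \<le> g (n - 6) + g (n - 5)"
          using nbb by simp
        have s3: "(\<Sum>w\<in>nb V v - nb V b. g (n - int (deg V b + deg V v + 2 - card (nb V b \<inter> nb V v) + card (nb V w - nb V b - {v})))) \<le> real 2 * g (n - 7)"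
        proof (rule sum_g_le)
          have "nb V v - nb V b = {x,y}" unfolding nvv using xb ub True by auto
          then show "card (nb V v - nb V b) = 2" using xy by simp
        qed (use P(1) C b3 v(2) zn in auto)
        show ?thesis using R s1 s2 s3 cU C b3 v(2) u(2) zn t unfolding n_def[symmetric] by simp
      qed
    qed
  qed
qed

text \<open>The aim is the factor 275/288 for \<open>V - {v}\<close>, a graph of residue 1 in which
  a degree-3 neighbour \<open>u\<close> of \<open>v\<close> has degree 2. Either a neighbour of
  \<open>u\<close> still has degree 4 and is branched on in turn, or \<open>B_residue1\<close>
  applies, unless a component K_{2,3} appears.\<close>

lemma residue2_deg4_min3:
  assumes p: "no_extremal_component V" and n: "int (card V) = 4 * q + 2" and d34: "\<And>x. x \<in> V \<Longrightarrow> deg V x = 3 \<or> deg V x = 4"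
    and v: "v \<in> V" "deg V v = 4"
  shows "real (num_mds V) < g (int (card V))"
proof -
  define n where "n = int (card V)"
  note t = g_table2[OF n, folded n_def] g_pos[of n]
  note P = plainD[OF p]
  have nbV: "y \<in> V" if "y \<in> nb V x" for x y using that nb_subset by blast
  note H = del_props[OF P(1,2) v(1)]
  let ?H = "V - {v}"
  have nH: "int (card ?H) = 4 * q + 1" using H(3) n by simp
  have S: "real (num_mds V) \<le> real (num_mds (V - {w})) + g (n - 1 - int (deg V w)) + real (deg V w) * g (n - int m - int (deg V w))"
    if "w \<in> V" "\<And>x. x \<in> nb V w \<Longrightarrow> m \<le> deg V x" for w m
    unfolding n_def by (rule S_num_const[OF P(1,2) that])
  have m3: "3 \<le> deg V x" if "x \<in> nb V w" for x w using d34[OF nbV[OF that]] by auto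
  show ?thesis
  proof (cases "\<forall>u\<in>nb V v. deg V u = 4")
    case True
    then have "real (num_mds V) \<le> real (num_mds ?H) + g (n - 1 - int (deg V v)) + real (deg V v) * g (n - int 4 - int (deg V v))"
      by (intro S[OF v(1)]) auto
    moreover have "real (num_mds ?H) \<le> g (n - 1)" unfolding n_def by (rule num_mds_minus1[OF P(1,2) v(1)])
    ultimately show ?thesis using v(2) t unfolding n_def[symmetric] by simp
  next
    case False
    then obtain u where u: "u \<in> nb V v" "deg V u = 3" using d34[OF nbV] by blast
    note uD = nbD[OF u(1) v(1)]
    have degH: "nb ?H x = nb V x - {v}" for x by (simp add: nb_Diff)
    have vn: "v \<notin> nb V v" using irrefl by (auto simp: nb_def)
    have uH: "u \<in> ?H" using uD irrefl by auto
    have vu: "v \<in> nb V u" using uD by auto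
    have "deg ?H u = 2" using degH vu u(2) P(1) by simp
    then obtain a b where ab: "nb ?H u = {a,b}" "a \<noteq> b" by (auto simp: card_2_iff)
    have degH_eq: "nb ?H x = nb V x" if "x \<in> V" "x \<notin> nb V v" for x
      using degH nbD[of v V x] that by auto
    have nu: "a \<in> nb V u" "b \<in> nb V u" "a \<noteq> v" "b \<noteq> v" using ab degH[of u] by auto
    have nva: "a \<notin> nb V v" "b \<notin> nb V v"
      using nb_triangle[OF vu nu(1)] nb_triangle[OF vu nu(2)] nbD[of a V v] nbD[of b V v] v uD by auto
    have dH2: "2 \<le> deg ?H x" if "x \<in> ?H" for x
    proof -
      have "3 \<le> deg V x" using d34[of x] that by auto
      then show ?thesis using degH[of x] card_Diff1_le[of "nb V x" v] P(1) by (cases "v \<in> nb V x") auto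
    qed
    \<comment> \<open>The total is 25/36 + 4/33 + 2/11 = 395/396, so the factor 275/288 is only just
      good enough.\<close>
    have final: ?thesis if "real (num_mds ?H) \<le> 275/288 * g (n - 1)"
    proof -
      have "real (num_mds V) \<le> real (num_mds ?H) + g (n - 1 - int (deg V v)) + real (deg V v) * g (n - int 3 - int (deg V v))"
        by (rule S[OF v(1) m3])
      then show ?thesis using that v(2) t unfolding n_def[symmetric] by simp
    qed
    have four: ?thesis if w: "w \<in> nb ?H u" "deg ?H w = 4" for w
    proof -
      have wH: "w \<in> ?H" using w nb_subset by blast
      note K = del_props[OF H(1,2) wH]
      have "w \<in> nb ?H u" by fact
      then have "deg (?H - {w}) u = 1" using \<open>deg ?H u = 2\<close> H(1) by (simp add: nb_Diff[of ?H])
      moreover have "u \<in> ?H - {w}" using uH w irrefl by (auto simp: nb_def)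
      ultimately have "real (num_mds (?H - {w})) \<le> 25/36 * g (int (card (?H - {w})))"
        using K(3) nH by (intro low0[OF K(1,2), where q = q and x = u]) auto
      then have 1: "real (num_mds (?H - {w})) \<le> 25/36 * g (n - 2)" using K(3) H(3) by (simp add: n_def)
      have "real (num_mds ?H) \<le> real (num_mds (?H - {w})) + g (int (card ?H) - 1 - int (deg ?H w)) + real (deg ?H w) * g (int (card ?H) - int 2 - int (deg ?H w))"
        by (rule S_num_const[OF H(1,2) wH]) (use dH2 nb_subset in blast)
      then have "real (num_mds ?H) \<le> real (num_mds (?H - {w})) + g (n - 6) + 4 * g (n - 7)" using w(2) H(3) by (simp add: n_def)
      then show ?thesis using final 1 t by simp
    qed
    show ?thesis
    proof (cases "deg ?H a = 4 \<or> deg ?H b = 4")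
      case True
      then show ?thesis using four[of a] four[of b] ab by blast
    next
      case False
      have aV: "a \<in> V" "b \<in> V" using nu nbV by blast+
      have ha: "nb ?H a = nb V a" "nb ?H b = nb V b" using degH_eq aV nva by auto
      have d3: "deg ?H a = 3" "deg ?H b = 3" using False d34[OF aV(1)] d34[OF aV(2)] ha by auto
      have two: "x \<in> nb V v" if "x \<in> ?H" "deg ?H x = 2" for x
      proof (rule ccontr)
        assume "x \<notin> nb V v"
        then have "deg V x = 2" using degH_eq[of x] that by simp
        then show False using d34[of x] that by auto
      qed
      have c: "deg_2_3_3 ?H u a b"
        unfolding deg_2_3_3_def
      proof (intro conjI ballI H uH ab d3 dH2)
        fix x y assume x: "x \<in> ?H" and y: "y \<in> nb ?H x"
        show "\<not> (deg ?H x = 2 \<and> deg ?H y = 2)"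
        proof
          assume *: "deg ?H x = 2 \<and> deg ?H y = 2"
          have "y \<in> ?H" using y nb_subset by blast
          then have "x \<in> nb V v" "y \<in> nb V v" using two x * by auto
          then show False using nb_triangle[of y V v x] v(1) y degH[of x] by auto
        qed
      qed
      show ?thesis
      proof (cases "nb ?H a = nb ?H b \<and> (\<forall>x\<in>nb ?H a. deg ?H x = 2)")
        case False
        have "real (num_mds ?H) \<le> 275/288 * g (int (card ?H))" by (rule B_residue1[OF c nH False])
        then show ?thesis using final H(3) by (simp add: n_def)
      next
        case True
        \<comment> \<open>The vertices of \<open>Y\<close> have degree 2 only after the deletion, so
          all are adjacent to \<open>v\<close>. Thus \<open>v\<close>, \<open>a\<close>,
          \<open>b\<close> and \<open>Y\<close> form a K_{3,3} that is joined to the rest only by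
          the edge from \<open>v\<close> to its fourth neighbour \<open>x\<close>; deleting
          \<open>x\<close> makes it a component.\<close>
        define Y where "Y = nb V a"
        have Y: "nb V a = Y" "nb V b = Y" "card Y = 3" using True ha d3 by (auto simp: Y_def)
        have Yv: "Y \<subseteq> nb V v"
        proof
          fix x assume x: "x \<in> Y"
          then have "x \<in> nb ?H a" using ha Y_def by simp
          then show "x \<in> nb V v" using two True nb_subset by blast
        qed
        have "finite Y" using P(1) by (simp add: Y_def)
        then have "card (nb V v - Y) = 1" using v(2) Y(3) Yv by (simp add: card_Diff_subset)
        then obtain x where x: "nb V v - Y = {x}" by (auto simp: card_1_singleton_iff)
        then have xv: "x \<in> nb V v" "x \<notin> Y" by auto
        have xV: "x \<in> V" "v \<in> nb V x" using nbD[OF xv(1) v(1)] by auto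
        let ?G = "V - {x}"
        note G = del_props[OF P(1,2) xV(1)]
        have Yx: "nb V y = {v,a,b}" if y: "y \<in> Y" for y
        proof -
          have yH: "y \<in> nb ?H a" using y ha Y_def by simp
          then have yV: "y \<in> ?H" using nb_subset by blast
          have "y \<in> nb ?H b" using yH True by simp
          have "deg ?H y = 2" using True yH by blast
          then have "nb ?H y = {a,b}"
            using twin_nb[OF H(1) yH \<open>y \<in> nb ?H b\<close> _ _ ab(2)] aV nu by auto
          moreover have "v \<in> nb V y" using Yv y nbD[of y V v] v(1) by auto
          ultimately show ?thesis using degH[of y] by auto
        qed
        have kc: "bip_component ?G {v,a,b} Y"
          unfolding bip_component_def
        proof (intro conjI ballI)
          show "{v,a,b} \<subseteq> ?G" using v aV xV(2) xv Y Yv x irrefl nva by (auto simp: nb_def)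
          show "Y \<subseteq> ?G" using Yv xv nbV by auto
          show "Y \<noteq> {}" using Y(3) by auto
          fix w assume "w \<in> {v,a,b}"
          then show "nb ?G w = Y" using Y x xv Yv by (auto simp: nb_Diff)
        next
          fix y assume y: "y \<in> Y"
          have "x \<notin> {v,a,b}" using xv nva irrefl by (auto simp: nb_def)
          then show "nb ?G y = {v,a,b}" using Yx[OF y] by (auto simp: nb_Diff)
        qed simp
        have c3: "card {v,a,b} = 3" using nu ab(2) by auto
        have "num_mds ?G = num_mds ({v,a,b} \<union> Y) * num_mds (?G - ({v,a,b} \<union> Y))" by (rule num_mds_bip_component[OF G(1) kc])
        also have "num_mds ({v,a,b} \<union> Y) = 11"
          using num_mds_complete_bip[OF bip_component_complete_bip(1)[OF kc]] c3 Y(3) by simp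
        finally have e: "num_mds ?G = 11 * num_mds (?G - ({v,a,b} \<union> Y))" .
        have "real (num_mds (?G - ({v,a,b} \<union> Y))) \<le> g (int (card (?G - ({v,a,b} \<union> Y))))"
          using G(2) card_bip_component(2)[OF G(1) kc] unfolding subsets_bounded_def by blast
        moreover have "int (card (?G - ({v,a,b} \<union> Y))) = n - 7"
          using card_bip_component(1)[OF G(1) kc] c3 Y(3) G(3) by (simp add: n_def)
        ultimately have 1: "real (num_mds ?G) \<le> 11 * g (n - 7)" using e by simp
        have "real (num_mds V) \<le> real (num_mds ?G) + g (n - 1 - int (deg V x)) + real (deg V x) * g (n - int 3 - int (deg V x))"
          by (rule S[OF xV(1) m3])
        then show ?thesis using 1 d34[OF xV(1)] t unfolding n_def[symmetric] by auto
      qed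
    qed
  qed
qed

lemma no_extremal_component_residue2_not_cubic:
  assumes p: "no_extremal_component V" and n: "int (card V) = 4 * q + 2" and nc: "\<not> (\<forall>x\<in>V. deg V x = 3)"
  shows "real (num_mds V) < g (int (card V))"
proof -
  define n where "n = int (card V)"
  note t = g_table2[OF n, folded n_def] g_pos[of n]
  note P = plainD[OF p]
  have nbV: "y \<in> V" if "y \<in> nb V x" for x y using that nb_subset by blast
  show ?thesis
  proof (cases "\<exists>v\<in>V. 5 \<le> deg V v")
    case True
    then obtain v where v: "v \<in> V" "5 \<le> deg V v" by blast
    note H = del_props[OF P(1,2) v(1)]
    have S: "real (num_mds V) \<le> real (num_mds (V - {v})) + g (n - 6) + 5 * g (n - int m - 5)"
      if m: "\<And>u. u \<in> nb V v \<Longrightarrow> m \<le> deg V u" for m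
    proof -
      have "real (num_mds V) \<le> real (num_mds (V - {v})) + g (n - 1 - int (deg V v)) + real (deg V v) * g (n - int m - int (deg V v))"
        unfolding n_def by (rule S_num_const[OF P(1,2) v(1) m])
      moreover have "g (n - 1 - int (deg V v)) \<le> g (n - 6)" using v by (intro g_mono) auto
      moreover have "real (deg V v) * g (n - int m - int (deg V v)) \<le> real 5 * g (n - int m - int 5)"
        using v by (intro g_mult_decr) auto
      ultimately show ?thesis by simp
    qed
    show ?thesis
    proof (cases "\<exists>u\<in>nb V v. deg V u = 2")
      case True
      then obtain u where u: "u \<in> nb V v" "deg V u = 2" by blast
      obtain b where b: "u \<in> V - {v}" "deg (V - {v}) u = 1" using del_leaf[OF P(1) v(1) u] by metis
      have "real (num_mds (V - {v})) \<le> 19/24 * g (int (card (V - {v})))"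
        by (rule low1[OF H(1,2) b(1), where q = q]) (use b(2) H(3) n in auto)
      then have "real (num_mds (V - {v})) \<le> 19/24 * g (n - 1)" using H(3) by (simp add: n_def)
      then show ?thesis using S[of 2] P(3)[OF nbV] t unfolding n_def[symmetric] by simp
    next
      case False
      then have "3 \<le> deg V u" if "u \<in> nb V v" for u using P(3)[OF nbV[OF that]] that by force
      then have "real (num_mds V) \<le> real (num_mds (V - {v})) + g (n - 6) + 5 * g (n - int 3 - 5)" by (rule S)
      moreover have "real (num_mds (V - {v})) \<le> g (n - 1)" unfolding n_def by (rule num_mds_minus1[OF P(1,2) v(1)])
      ultimately show ?thesis using t unfolding n_def[symmetric] by simp
    qed
  next
    case False
    then have d4: "deg V v \<le> 4" if "v \<in> V" for v using that by force
    show ?thesis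
    proof (cases "\<exists>x\<in>V. \<exists>y\<in>nb V x. deg V x = 2 \<and> deg V y = 2")
      case True
      then obtain x y where "x \<in> V" "y \<in> nb V x" "deg V x = 2" "deg V y = 2" by blast
      then show ?thesis using path_no_extremal_component[OF p, of x y] d4[OF nbV] by blast
    next
      case nadj': False
      then have nadj: "\<not> (deg V x = 2 \<and> deg V y = 2)" if "x \<in> V" "y \<in> nb V x" for x y using that by blast
      show ?thesis
      proof (cases "\<exists>x\<in>V. deg V x = 2")
        case True
        then obtain x where x: "x \<in> V" "deg V x = 2" by blast
        show ?thesis
        proof (cases "\<exists>v\<in>nb V x. deg V v = 4")
          case True
          then obtain v where v: "v \<in> nb V x" "deg V v = 4" by blast
          have "x \<in> nb V v" "v \<in> V" using nbD[OF v(1) x(1)] by auto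
          then show ?thesis using residue2_deg4_deg2[OF p n d4 nadj] v x by blast
        next
          case no4: False
          have d3: "deg V y \<le> 3" if "y \<in> nb V x" for y using d4[OF nbV[OF that]] no4 that by force
          obtain a b where c: "deg_2_3_3 V x a b"
            by (rule ex_deg2_neighbour_config[OF p x d3 nadj])
          show ?thesis by (rule B_residue2[OF c n deg_2_3_3_no_K23[OF p]])
        qed
      next
        case False
        then have d34: "deg V x = 3 \<or> deg V x = 4" if "x \<in> V" for x using P(3)[OF that] d4[OF that] that by force
        then obtain v where "v \<in> V" "deg V v = 4" using nc by blast
        then show ?thesis using residue2_deg4_min3[OF p n d34] by blast
      qed
    qed
  qed
qed

section \<open>Cubic graphs\<close>

lemma deg3_third:
  assumes "finite V" "deg V u = 3" "v \<in> nb V u" "w \<in> nb V u" "v \<noteq> w"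
  shows "\<exists>z. nb V u = {v,w,z} \<and> z \<noteq> v \<and> z \<noteq> w"
proof -
  have "card (nb V u - {v,w}) = 1" using assms by (simp add: card_Diff_subset)
  then obtain z where "nb V u - {v,w} = {z}" by (auto simp: card_1_singleton_iff)
  then show ?thesis using assms(3,4) by (intro exI[of _ z]) auto
qed

text \<open>If \<open>v\<close> is outside \<open>F\<close> and \<open>w\<close> inside, the
  neighbour blocking \<open>v\<close> is a partner of \<open>w\<close>. The sets avoiding both are
  split at \<open>u1\<close>; as \<open>w1\<close> differs from \<open>w2\<close> and
  \<open>w3\<close>, a partner of \<open>w1\<close> other than \<open>u1\<close> is adjacent to
  neither twin, and eight vertices are deleted.\<close>

lemma cubic_twins_core:
  assumes fin: "finite V" and h: "subsets_bounded V" and n: "int (card V) = 4 * q + 2"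
    and d3: "\<And>x. x \<in> V \<Longrightarrow> deg V x = 3"
    and V: "v \<in> V" "w \<in> V" "v \<noteq> w" and nv: "nb V v = {u1,u2,u3}" and nw: "nb V w = {u1,u2,u3}"
    and nu: "nb V u1 = {v,w,w1}" "nb V u2 = {v,w,w2}" "nb V u3 = {v,w,w3}"
    and w1: "w1 \<noteq> v" "w1 \<noteq> w" "w1 \<noteq> w2" "w1 \<noteq> w3"
  shows "real (num_mds V) < g (int (card V))"
proof -
  define n where "n = int (card V)"
  note t = g_table2[OF n, folded n_def] g_pos[of n]
  have u1v: "u1 \<in> nb V v" "u1 \<in> nb V w" using nv nw by auto
  have u1V: "u1 \<in> V" using u1v nb_subset by blast
  have w1u: "w1 \<in> nb V u1" using nu by simp
  have w1V: "w1 \<in> V" "u1 \<in> nb V w1" "adj u1 w1" using nbD[OF w1u u1V] by auto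
  have 1: "count_le V (\<lambda>F. isolated V F v) (g (n - 5))"
    using count_le_iso_twin[OF fin h V(1,2) _ V(3)] nv nw d3[OF V(1)] by (simp add: n_def)
  have pr: "count_le V (\<lambda>F. x \<in> F \<and> y \<in> F) (g (n - 6))" if "x \<in> V" "y \<in> nb V x" for x y
    using cell_pair[OF fin h that(1), of y] that d3[of x] d3[of y] by (simp add: n_def nb_iff)
  have 5: "count_le V (\<lambda>F. isolated V F u1) (g (n - 4))"
    using count_le_iso[OF fin h u1V] d3[OF u1V] by (simp add: n_def)
  have vw1: "v \<notin> nb V w1" "w \<notin> nb V w1"
    using nb_triangle[OF w1u _ u1V, of v] nb_triangle[OF w1u _ u1V, of w] nu nbD[of v V w1] nbD[of w V w1] w1V by auto
  have 6: "count_le V (\<lambda>F. v \<notin> F \<and> w \<notin> F \<and> u1 \<notin> F \<and> w1 \<in> F \<and> y \<in> F) (g (n - int 8))" if y: "y \<in> nb V w1 - {u1}" for y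
    unfolding n_def
  proof (rule cell[OF fin h, where I = "{}" and J = "{w1,y}" and O' = "{v,w,u1}" and K = "insert v (insert w (nb V w1 \<union> nb V y))"])
    have yV: "y \<in> V" "w1 \<in> nb V y" "adj w1 y" "adj y w1" using nbD[of y V w1] y w1V by auto
    have "y \<noteq> u2" "y \<noteq> u3" using yV(2) nu w1 by auto
    then have "y \<notin> nb V v" "y \<notin> nb V w" using nv nw y by auto
    then have "v \<notin> nb V y" "w \<notin> nb V y" using nbD[of v V y] nbD[of w V y] yV by auto
    then show "8 \<le> card (insert v (insert w (nb V w1 \<union> nb V y)))"
      using fin vw1 V(3) card_nb_Un[OF fin yV(3)] d3[OF w1V(1)] d3[OF yV(1)] by simp
    show "\<exists>z\<in>{w1,y}. adj x z" if "x \<in> {w1,y}" for x using that yV by auto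
  qed (use V nb_subset in auto)
  have c2: "card (nb V w1 - {u1}) = 2" using w1V d3[OF w1V(1)] fin by simp
  let ?P = "\<lambda>F. ((((isolated V F v \<or> (\<exists>u\<in>nb V v. v \<in> F \<and> u \<in> F)) \<or> (\<exists>u\<in>nb V w. w \<in> F \<and> u \<in> F)) \<or> (u1 \<in> F \<and> w1 \<in> F))
    \<or> isolated V F u1) \<or> (\<exists>y\<in>nb V w1 - {u1}. v \<notin> F \<and> w \<notin> F \<and> u1 \<notin> F \<and> w1 \<in> F \<and> y \<in> F)"
  have "real (num_mds V) \<le> g (n - 5) + (\<Sum>u\<in>nb V v. g (n - 6)) + (\<Sum>u\<in>nb V w. g (n - 6)) + g (n - 6) + g (n - 4)
      + (\<Sum>y\<in>nb V w1 - {u1}. g (n - int 8))"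
  proof (rule count_le_num_mds)
    show "count_le V ?P (g (n - 5) + (\<Sum>u\<in>nb V v. g (n - 6)) + (\<Sum>u\<in>nb V w. g (n - 6)) + g (n - 6) + g (n - 4)
        + (\<Sum>y\<in>nb V w1 - {u1}. g (n - int 8)))"
      by (intro count_le_or count_le_ex 1 pr 5 6 fin finite_nb finite_Diff V u1V w1u)
    fix F assume F: "mds V F"
    show "?P F"
    proof (cases "v \<in> F")
      case True
      then show ?thesis by blast
    next
      case vF: False
      show ?thesis
      proof (cases "w \<in> F")
        case True
        have "nb V v \<inter> F \<noteq> {}" using mds_blocked'[OF F V(1) vF] by blast
        then show ?thesis using True nv nw by blast
      next
        case wF: False
        show ?thesis
        proof (cases "u1 \<in> F")
          case True
          then show ?thesis using nu(1) vF wF by auto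
        next
          case u1F: False
          have "w1 \<in> F \<and> (\<exists>y\<in>nb V w1 \<inter> F. y \<noteq> u1)"
            using mds_blocked'[OF F u1V u1F] nu(1) vF wF by auto
          then show ?thesis using vF wF u1F by blast
        qed
      qed
    qed
  qed fact
  also have "\<dots> = g (n - 5) + 3 * g (n - 6) + 3 * g (n - 6) + g (n - 6) + g (n - 4) + 2 * g (n - 8)"
    using d3[OF V(1)] d3[OF V(2)] c2 by simp
  finally show ?thesis using t unfolding n_def[symmetric] by simp
qed

text \<open>Either one of \<open>w1\<close>, \<open>w2\<close>, \<open>w3\<close> differs from the
  other two, or all coincide and the component is K_{3,3}.\<close>

lemma cubic_twins:
  assumes p: "no_extremal_component V" and n: "int (card V) = 4 * q + 2" and d3: "\<And>x. x \<in> V \<Longrightarrow> deg V x = 3"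
    and V: "v \<in> V" "w \<in> V" "v \<noteq> w" "nb V v = nb V w"
  shows "real (num_mds V) < g (int (card V))"
proof -
  note P = plainD[OF p]
  obtain u1 u2 u3 where u: "nb V v = {u1,u2,u3}" "u1 \<noteq> u2" "u1 \<noteq> u3" "u2 \<noteq> u3"
    using d3[OF V(1)] by (auto simp: card_3_iff)
  have third: "\<exists>z. nb V x = {v,w,z} \<and> z \<noteq> v \<and> z \<noteq> w" if x: "x \<in> nb V v" for x
  proof -
    have "x \<in> V" "v \<in> nb V x" "w \<in> nb V x" using nbD[OF x V(1)] nbD[of x V w] x V by auto
    then show ?thesis using deg3_third[OF P(1) d3] V(3) by blast
  qed
  obtain w1 where w1: "nb V u1 = {v,w,w1}" "w1 \<noteq> v" "w1 \<noteq> w" using third[of u1] u by auto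
  obtain w2 where w2: "nb V u2 = {v,w,w2}" "w2 \<noteq> v" "w2 \<noteq> w" using third[of u2] u by auto
  obtain w3 where w3: "nb V u3 = {v,w,w3}" "w3 \<noteq> v" "w3 \<noteq> w" using third[of u3] u by auto
  note core = cubic_twins_core[OF P(1,2) n d3 V(1-3)]
  have nw: "nb V w = {u1,u2,u3}" using u V by simp
  have perm: "nb V v = {u2,u1,u3}" "nb V w = {u2,u1,u3}" "nb V v = {u3,u1,u2}" "nb V w = {u3,u1,u2}" using u nw by auto
  consider "w1 \<noteq> w2 \<and> w1 \<noteq> w3" | "w2 \<noteq> w1 \<and> w2 \<noteq> w3" | "w3 \<noteq> w1 \<and> w3 \<noteq> w2" | "w1 = w2 \<and> w2 = w3" by blast
  then show ?thesis
  proof cases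
    case 1
    then show ?thesis using core[OF _ u(1) nw w1(1) w2(1) w3(1) w1(2,3)] by blast
  next
    case 2
    then show ?thesis using core[OF _ perm(1,2) w2(1) w1(1) w3(1) w2(2,3)] by blast
  next
    case 3
    then show ?thesis using core[OF _ perm(3,4) w3(1) w1(1) w2(1) w3(2,3)] by blast
  next
    case 4
    have uV: "u1 \<in> V" "u2 \<in> V" "u3 \<in> V" using u nb_subset[of V v] by auto
    have "w1 \<in> nb V u1" "w1 \<in> nb V u2" "w1 \<in> nb V u3" using w1 w2 w3 4 by auto
    then have "w1 \<in> V" "{u1,u2,u3} \<subseteq> nb V w1" using nbD uV by blast+
    moreover have "card {u1,u2,u3} = 3" using u by simp
    ultimately have nw1: "nb V w1 = {u1,u2,u3}" using d3[of w1] P(1) by (metis card_subset_eq finite_nb)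
    have "bip_component V {v,w,w1} {u1,u2,u3}"
      unfolding bip_component_def using V uV \<open>w1 \<in> V\<close> u nw nw1 w1 w2 w3 4 by auto
    moreover have "card {v,w,w1} = 3" using V(3) w1 by auto
    ultimately show ?thesis using P(4)[of "{v,w,w1}" "{u1,u2,u3}"] u by auto
  qed
qed

text \<open>Without 4-cycles two vertices have at most one common neighbour, so the neighbourhoods
  deleted around \<open>v\<close> overlap little. \<open>k\<close> bounds the common neighbours of
  \<open>u2\<close> with vertices behind \<open>u3\<close>, each of which closes a 5-cycle through
  \<open>v\<close>. \<open>x1\<close> stays open for an improvement.\<close>

lemma girth5_rule:
  assumes fin: "finite V" and h: "subsets_bounded V" and d3': "\<forall>x\<in>V. deg V x = 3"
    and noC4': "\<forall>x\<in>V. \<forall>y\<in>V. x \<noteq> y \<longrightarrow> (\<forall>p\<in>nb V x \<inter> nb V y. \<forall>q\<in>nb V x \<inter> nb V y. p = q)"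
    and v: "v \<in> V" and nv: "nb V v = {u1,u2,u3}" "u1 \<noteq> u2" "u1 \<noteq> u3" "u2 \<noteq> u3"
    and x1: "count_le V (\<lambda>F. \<exists>w\<in>nb V u1 - {v}. u1 \<in> F \<and> w \<in> F) x1"
    and x2: "\<forall>w\<in>nb V u3 - {v}. int (card (nb V w \<inter> nb V u2)) \<le> k"
  shows "real (num_mds V) \<le> 2 * g (int (card V) - 4) + 3 * g (int (card V) - 6) + x1 + 2 * g (int (card V) - 7)
    + 3 * g (int (card V) - 8) + 2 * g (int (card V) - 10 + k)"
proof -
  have d3: "deg V x = 3" if "x \<in> V" for x using d3' that by blast
  have noC4: "p = q" if "x \<in> V" "y \<in> V" "x \<noteq> y" "p \<in> nb V x \<inter> nb V y" "q \<in> nb V x \<inter> nb V y" for x y p q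
    using noC4' that by blast
  define n where "n = int (card V)"
  have u: "u1 \<in> nb V v" "u2 \<in> nb V v" "u3 \<in> nb V v" using nv by auto
  have uV: "u1 \<in> V" "u2 \<in> V" "u3 \<in> V" and vu: "v \<in> nb V u1" "v \<in> nb V u2" "v \<in> nb V u3"
    using nbD[OF u(1) v] nbD[OF u(2) v] nbD[OF u(3) v] by auto
  have nu: "u1 \<notin> nb V u2" "u1 \<notin> nb V u3" "u2 \<notin> nb V u1" "u2 \<notin> nb V u3" "u3 \<notin> nb V u1" "u3 \<notin> nb V u2"
    using nb_triangle[OF u(1,2) v] nb_triangle[OF u(1,3) v] nb_triangle[OF u(2,1) v] nb_triangle[OF u(2,3) v]
      nb_triangle[OF u(3,1) v] nb_triangle[OF u(3,2) v] by auto
  have nn: "x \<notin> nb V x" for x using irrefl by (auto simp: nb_def)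
  \<comment> \<open>Otherwise \<open>x\<close> and \<open>y\<close> would have both \<open>v\<close>
    and \<open>w\<close> as common neighbours.\<close>
  have far: "x \<notin> nb V w" if "w \<in> nb V y - {v}" "v \<in> nb V x" "v \<in> nb V y" "x \<in> V" "y \<in> V" "x \<noteq> y" for x y w
    using noC4[OF that(4-6), of v w] that nbD[of x V w] nbD[of w V y] by auto
  have I: "count_le V (\<lambda>F. isolated V F x) (g (n - 4))" if "x \<in> V" for x
    using count_le_iso[OF fin h that] d3[OF that] by (simp add: n_def)
  have pr: "count_le V (\<lambda>F. x \<in> F \<and> y \<in> F) (g (n - 6))" if "y \<in> nb V x" "x \<in> V" for x y
    using cell_pair[OF fin h that(2), of y] that d3[of x] d3[of y] by (simp add: n_def nb_iff)
  have wD: "w \<in> V \<and> adj x w \<and> adj w x \<and> deg V w = 3 \<and> card (nb V x \<union> nb V w) = 6" if "w \<in> nb V x - {v}" "x \<in> V" for w x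
    using nbD[of w V x] that card_nb_Un[OF fin, of x w] d3[of x] d3[of w] by auto
  have 3: "count_le V (\<lambda>F. u1 \<notin> F \<and> u2 \<in> F \<and> w \<in> F) (g (n - int 7))" if w: "w \<in> nb V u2 - {v}" for w
    unfolding n_def
  proof (rule cell[OF fin h, where I = "{}" and J = "{u2,w}" and O' = "{u1}" and K = "insert u1 (nb V u2 \<union> nb V w)"])
    note d = wD[OF w uV(2)]
    have "u1 \<notin> nb V w" by (rule far[OF w vu(1,2) uV(1,2) nv(2)])
    then show "7 \<le> card (insert u1 (nb V u2 \<union> nb V w))" using nu d fin by simp
    show "\<exists>y\<in>{u2,w}. adj x y" if "x \<in> {u2,w}" for x using that d by auto
  qed (use uV nb_subset in auto)
  have c23: "nb V u2 \<inter> nb V u3 = {v}" using noC4[OF uV(2,3) nv(4)] vu by blast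
  then have card23: "card (nb V u2 \<union> nb V u3) = 5"
    using card_Un_Int[of "nb V u2" "nb V u3"] fin d3[OF uV(2)] d3[OF uV(3)] by simp
  have 4: "count_le V (\<lambda>F. u1 \<notin> F \<and> isolated V F u2 \<and> isolated V F u3) (g (n - int 8))"
    unfolding n_def
  proof (rule cell[OF fin h, where I = "{u2,u3}" and J = "{}" and O' = "{u1}" and K = "{u1,u2,u3} \<union> (nb V u2 \<union> nb V u3)"])
    show "8 \<le> card ({u1,u2,u3} \<union> (nb V u2 \<union> nb V u3))" using card23 nu nn nv fin by simp
  qed (use uV nb_subset in auto)
  have 5: "count_le V (\<lambda>F. u1 \<notin> F \<and> isolated V F u2 \<and> u3 \<in> F \<and> w \<in> F) (g (n - 10 + k))" if w: "w \<in> nb V u3 - {v}" for w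
  proof -
    note d = wD[OF w uV(3)]
    have dissoc: "nb V u3 \<inter> nb V w = {}" using nb_disjoint d by blast
    have f: "u1 \<notin> nb V w" "u2 \<notin> nb V w"
      using far[OF w vu(1,3) uV(1,3) nv(3)] far[OF w vu(2,3) uV(2,3) nv(4)] by auto
    have "card ((nb V u2 \<union> nb V u3) \<union> nb V w) = 5 + 3 - card (nb V w \<inter> nb V u2)"
    proof -
      have "(nb V u2 \<union> nb V u3) \<inter> nb V w = nb V w \<inter> nb V u2" using dissoc by auto
      then show ?thesis using card_Un_Int[of "nb V u2 \<union> nb V u3" "nb V w"] fin card23 d by simp
    qed
    moreover have "card (nb V w \<inter> nb V u2) \<le> 3" using d card_mono[of "nb V w" "nb V w \<inter> nb V u2"] fin by simp
    ultimately have c: "10 - card (nb V w \<inter> nb V u2) \<le> card ({u1,u2} \<union> ((nb V u2 \<union> nb V u3) \<union> nb V w))"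
      using f nu nn nv fin by simp
    have "count_le V (\<lambda>F. u1 \<notin> F \<and> isolated V F u2 \<and> u3 \<in> F \<and> w \<in> F) (g (int (card V) - int (10 - card (nb V w \<inter> nb V u2))))"
    proof (rule cell[OF fin h, where I = "{u2}" and J = "{u3,w}" and O' = "{u1}" and K = "{u1,u2} \<union> ((nb V u2 \<union> nb V u3) \<union> nb V w)"])
      show "10 - card (nb V w \<inter> nb V u2) \<le> card ({u1,u2} \<union> ((nb V u2 \<union> nb V u3) \<union> nb V w))" by (rule c)
      show "0 < 10 - card (nb V w \<inter> nb V u2)" using \<open>card (nb V w \<inter> nb V u2) \<le> 3\<close> by simp
      show "\<exists>y\<in>{u3,w}. adj x y" if "x \<in> {u3,w}" for x using that d by auto
    qed (use uV nb_subset in auto)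
    moreover have "int (card V) - int (10 - card (nb V w \<inter> nb V u2)) \<le> n - 10 + k"
      using bspec[OF x2 w] \<open>card (nb V w \<inter> nb V u2) \<le> 3\<close> by (simp add: n_def)
    ultimately show ?thesis using g_mono order_trans unfolding count_le_def by blast
  qed
  have 6: "count_le V (\<lambda>F. u1 \<notin> F \<and> u2 \<notin> F \<and> u3 \<in> F \<and> w \<in> F) (g (n - int 8))" if w: "w \<in> nb V u3 - {v}" for w
    unfolding n_def
  proof (rule cell[OF fin h, where I = "{}" and J = "{u3,w}" and O' = "{u1,u2}" and K = "insert u1 (insert u2 (nb V u3 \<union> nb V w))"])
    note d = wD[OF w uV(3)]
    have "u1 \<notin> nb V w" "u2 \<notin> nb V w"
      using far[OF w vu(1,3) uV(1,3) nv(3)] far[OF w vu(2,3) uV(2,3) nv(4)] by auto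
    then show "8 \<le> card (insert u1 (insert u2 (nb V u3 \<union> nb V w)))" using nu nv d fin by simp
    show "\<exists>y\<in>{u3,w}. adj x y" if "x \<in> {u3,w}" for x using that d by auto
  qed (use uV nb_subset in auto)
  have c2: "card (nb V u2 - {v}) = 2" "card (nb V u3 - {v}) = 2" using vu d3 uV fin by simp_all
  let ?P = "\<lambda>F. ((((((isolated V F v \<or> (\<exists>u\<in>nb V v. v \<in> F \<and> u \<in> F)) \<or> (\<exists>w\<in>nb V u1 - {v}. u1 \<in> F \<and> w \<in> F)) \<or> isolated V F u1)
    \<or> (\<exists>w\<in>nb V u2 - {v}. u1 \<notin> F \<and> u2 \<in> F \<and> w \<in> F)) \<or> (u1 \<notin> F \<and> isolated V F u2 \<and> isolated V F u3))
    \<or> (\<exists>w\<in>nb V u3 - {v}. u1 \<notin> F \<and> isolated V F u2 \<and> u3 \<in> F \<and> w \<in> F))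
    \<or> (\<exists>w\<in>nb V u3 - {v}. u1 \<notin> F \<and> u2 \<notin> F \<and> u3 \<in> F \<and> w \<in> F)"
  have "real (num_mds V) \<le> g (n - 4) + (\<Sum>u\<in>nb V v. g (n - 6)) + x1 + g (n - 4) + (\<Sum>w\<in>nb V u2 - {v}. g (n - int 7)) + g (n - int 8)
      + (\<Sum>w\<in>nb V u3 - {v}. g (n - 10 + k)) + (\<Sum>w\<in>nb V u3 - {v}. g (n - int 8))"
  proof (rule count_le_num_mds)
    show "count_le V ?P (g (n - 4) + (\<Sum>u\<in>nb V v. g (n - 6)) + x1 + g (n - 4) + (\<Sum>w\<in>nb V u2 - {v}. g (n - int 7)) + g (n - int 8)
      + (\<Sum>w\<in>nb V u3 - {v}. g (n - 10 + k)) + (\<Sum>w\<in>nb V u3 - {v}. g (n - int 8)))"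
      by (intro count_le_or count_le_ex I pr 3 4 5 6 x1 fin finite_nb finite_Diff uV v)
    fix F assume F: "mds V F"
    show "?P F"
    proof (cases "v \<in> F")
      case True
      then show ?thesis by blast
    next
      case vF: False
      note blk = mds_blocked'[OF F v vF]
      show ?thesis
      proof (cases "u1 \<in> F")
        case True
        then show ?thesis using vF by blast
      next
        case u1F: False
        show ?thesis
        proof (cases "u2 \<in> F")
          case u2F: True
          show ?thesis
          proof (cases "nb V u2 \<inter> F = {}")
            case True
            have "u3 \<in> F" using blk nv u1F True by auto
            then show ?thesis using u1F u2F True vF by blast
          next
            case False
            then show ?thesis using u1F u2F vF by blast
          qed
        next
          case u2F: False
          have "u3 \<in> F \<and> (\<exists>w\<in>nb V u3 \<inter> F. w \<noteq> v)" using blk nv u1F u2F by auto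
          then show ?thesis using u1F u2F by blast
        qed
      qed
    qed
  qed fact
  also have "\<dots> = 2 * g (n - 4) + 3 * g (n - 6) + x1 + 2 * g (n - 7) + 3 * g (n - 8) + 2 * g (n - 10 + k)"
    using d3[OF v] c2 by simp
  finally show ?thesis by (simp add: n_def)
qed

text \<open>Without 5-cycles \<open>k = 0\<close> and the sum is 131/132. With \<open>k = 1\<close>
  it would be 397/396. But if \<open>x\<close>, \<open>w\<close> are matched on a 5-cycle, deleting
  their neighbourhoods leaves \<open>y\<close> with degree at most 1 in a graph of residue 0, and
  \<open>low0\<close> saves enough.\<close>

lemma cubic_girth5:
  assumes fin: "finite V" and h: "subsets_bounded V" and n: "int (card V) = 4 * q + 2" and d3': "\<forall>x\<in>V. deg V x = 3"
    and noC4': "\<forall>x\<in>V. \<forall>y\<in>V. x \<noteq> y \<longrightarrow> (\<forall>p\<in>nb V x \<inter> nb V y. \<forall>q\<in>nb V x \<inter> nb V y. p = q)"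
    and ne: "V \<noteq> {}"
  shows "real (num_mds V) < g (int (card V))"
proof -
  have d3: "deg V x = 3" if "x \<in> V" for x using d3' that by blast
  have noC4: "p = q" if "x \<in> V" "y \<in> V" "x \<noteq> y" "p \<in> nb V x \<inter> nb V y" "q \<in> nb V x \<inter> nb V y" for x y p q
    using noC4' that by blast
  define n where "n = int (card V)"
  note t = g_table2[OF n, folded n_def] g_pos[of n]
  have pr: "count_le V (\<lambda>F. x \<in> F \<and> y \<in> F) (g (n - 6))" if "y \<in> nb V x" "x \<in> V" for x y
    using cell_pair[OF fin h that(2), of y] that d3[of x] d3[of y] by (simp add: n_def nb_iff)
  show ?thesis
  proof (cases "\<exists>v\<in>V. \<exists>x\<in>nb V v. \<exists>y\<in>nb V v. \<exists>w\<in>nb V x - {v}. x \<noteq> y \<and> nb V w \<inter> nb V y \<noteq> {}")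
    case True
    then obtain v x y w where v: "v \<in> V" and xy: "x \<in> nb V v" "y \<in> nb V v" "x \<noteq> y" and w: "w \<in> nb V x - {v}"
      and cyc: "nb V w \<inter> nb V y \<noteq> {}" by blast
    obtain z where z: "nb V v = {x,y,z}" "z \<noteq> x" "z \<noteq> y"
      using deg3_third[OF fin d3[OF v] xy] by blast
    have xV: "x \<in> V" "y \<in> V" "v \<in> nb V x" "v \<in> nb V y" using nbD[OF xy(1) v] nbD[OF xy(2) v] by auto
    have wV: "w \<in> V" "x \<in> nb V w" "adj x w" using nbD[of w V x] w xV by auto
    obtain w' where w': "nb V x = {v,w,w'}" "w' \<noteq> v" "w' \<noteq> w"
      using deg3_third[OF fin d3[OF xV(1)] xV(3), of w] w by blast
    have one: "count_le V (\<lambda>F. x \<in> F \<and> w \<in> F) (25/36 * g (n - 6))"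
    proof (rule count_le_num_mds_mono)
      let ?A = "nb V x \<union> nb V w"
      show "count_le V (\<lambda>F. x \<in> F \<and> w \<in> F) (num_mds (V - ?A))"
      proof (rule count_le_restrict[OF fin, where S = "{x,w}"])
        fix F assume F: "mds V F" "x \<in> F \<and> w \<in> F"
        have "nb V x \<inter> F = {w}" "nb V w \<inter> F = {x}"
          using mds_pair[OF F(1), of x w] mds_pair[OF F(1), of w x] F(2) wV(3) sym by auto
        then show "F \<inter> ?A = {x,w}" by auto
      qed auto
      have "?A \<subseteq> V" using nb_subset by auto
      then have "card (V - ?A) + 6 = card V"
        using card_nb_Un[OF fin wV(3)] d3[OF xV(1)] d3[OF wV(1)] card_Diff_subset[of ?A V] card_mono[of V ?A] fin by simp
      then have cA: "int (card (V - ?A)) = n - 6" by (simp add: n_def)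
      have yx: "y \<notin> nb V x" using nb_triangle[OF xy(2,1) v] .
      have yw: "y \<notin> nb V w" using noC4[OF xV(1,2) xy(3), of v w] xV w nbD[of y V w] wV by auto
      obtain z' where z': "z' \<in> nb V w" "z' \<in> nb V y" using cyc by auto
      have "z' \<noteq> v" using z'(1) nbD[of v V w] w wV nb_triangle[OF _ xV(3) xV(1), of w] by auto
      have "nb (V - ?A) y \<subseteq> nb V y - {v,z'}" using z' xV by (auto simp: nb_Diff)
      then have "deg (V - ?A) y \<le> card (nb V y - {v,z'})" by (rule card_mono[rotated]) (use fin in auto)
      also have "\<dots> = 1" using d3[OF xV(2)] xV(4) z' \<open>z' \<noteq> v\<close> fin by (simp add: card_Diff_subset)
      finally have dy: "deg (V - ?A) y \<le> 1" .
      have "real (num_mds (V - ?A)) \<le> 25/36 * g (int (card (V - ?A)))"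
        by (rule low0[OF _ _ _ dy, where q = "q - 1"]) (use fin subsets_bounded_subset[OF h] xV yx yw cA n n_def in auto)
      then show "real (num_mds (V - ?A)) \<le> 25/36 * g (n - 6)" using cA by simp
    qed
    have "count_le V (\<lambda>F. x \<in> F \<and> w \<in> F \<or> x \<in> F \<and> w' \<in> F) (25/36 * g (n - 6) + g (n - 6))"
      by (rule count_le_or[OF one pr fin]) (use w' xV in auto)
    then have x1: "count_le V (\<lambda>F. \<exists>w\<in>nb V x - {v}. x \<in> F \<and> w \<in> F) (25/36 * g (n - 6) + g (n - 6))"
      by (rule count_le_mono) (use w' fin in auto)
    have x2: "\<forall>w\<in>nb V z - {v}. int (card (nb V w \<inter> nb V y)) \<le> 1"
    proof
      fix w assume that: "w \<in> nb V z - {v}"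
      have zV: "z \<in> nb V v" using z by simp
      then have "z \<in> V" "v \<in> nb V z" using nbD v by blast+
      then have wV: "w \<in> V" "z \<in> nb V w" using nbD[of w V z] that by auto
      have "w \<noteq> y" using nb_triangle[OF xy(2) zV v] that by auto
      then have "\<forall>p\<in>nb V w \<inter> nb V y. \<forall>q\<in>nb V w \<inter> nb V y. p = q" using noC4[OF wV(1) xV(2)] by blast
      then have "card (nb V w \<inter> nb V y) \<le> Suc 0" using card_le_Suc0_iff_eq[of "nb V w \<inter> nb V y"] fin by simp
      then show "int (card (nb V w \<inter> nb V y)) \<le> 1" by simp
    qed
    show ?thesis
      using girth5_rule[OF fin h d3' noC4' v z(1) xy(3) z(2)[symmetric] z(3)[symmetric] x1 x2, folded n_def] t
      unfolding n_def[symmetric] by simp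
  next
    case False
    obtain v where v: "v \<in> V" using ne by auto
    obtain u1 u2 u3 where u: "nb V v = {u1,u2,u3}" "u1 \<noteq> u2" "u1 \<noteq> u3" "u2 \<noteq> u3"
      using d3[OF v] by (auto simp: card_3_iff)
    have uV: "u1 \<in> V" using u nb_subset[of V v] by auto
    have vu: "v \<in> nb V u1" using nbD[of u1 V v] u v by auto
    have "count_le V (\<lambda>F. \<exists>w\<in>nb V u1 - {v}. u1 \<in> F \<and> w \<in> F) (\<Sum>w\<in>nb V u1 - {v}. g (n - 6))"
      by (intro count_le_ex pr fin finite_Diff finite_nb uV) auto
    moreover have "card (nb V u1 - {v}) = 2" using d3[OF uV] vu fin by simp
    ultimately have x1: "count_le V (\<lambda>F. \<exists>w\<in>nb V u1 - {v}. u1 \<in> F \<and> w \<in> F) (2 * g (n - 6))" by simp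
    have x2: "\<forall>w\<in>nb V u3 - {v}. int (card (nb V w \<inter> nb V u2)) \<le> 0"
    proof
      fix w assume that: "w \<in> nb V u3 - {v}"
      have uv: "u3 \<in> nb V v" "u2 \<in> nb V v" using u by auto
      have "nb V w \<inter> nb V u2 = {}"
      proof (rule ccontr)
        assume "nb V w \<inter> nb V u2 \<noteq> {}"
        then have "u3 \<noteq> u2 \<and> nb V w \<inter> nb V u2 \<noteq> {}" using u(4) by simp
        then have "\<exists>v\<in>V. \<exists>x\<in>nb V v. \<exists>y\<in>nb V v. \<exists>w\<in>nb V x - {v}. x \<noteq> y \<and> nb V w \<inter> nb V y \<noteq> {}"
          using v uv that by (intro bexI)
        with False show False by (rule notE)
      qed
      then show "int (card (nb V w \<inter> nb V u2)) \<le> 0" by simp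
    qed
    show ?thesis
      using girth5_rule[OF fin h d3' noC4' v u x1 x2, folded n_def] t
      unfolding n_def[symmetric] by simp
  qed
qed

section \<open>Cubic graphs with a 4-cycle whose opposite vertices are not twins\<close>

definition cubic_C4 :: "'a set \<Rightarrow> 'a \<Rightarrow> 'a \<Rightarrow> 'a \<Rightarrow> 'a \<Rightarrow> 'a \<Rightarrow> 'a \<Rightarrow> 'a \<Rightarrow> 'a \<Rightarrow> bool" where
  "cubic_C4 V a b c d a' b' c' d' \<longleftrightarrow> finite V \<and> subsets_bounded V \<and> (\<forall>x\<in>V. deg V x = 3) \<and>
    a \<in> V \<and> b \<in> V \<and> c \<in> V \<and> d \<in> V \<and>
    nb V a = {b,d,a'} \<and> nb V b = {a,c,b'} \<and> nb V c = {b,d,c'} \<and> nb V d = {a,c,d'} \<and> a' \<noteq> c' \<and> b' \<noteq> d'"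

lemma cubic_C4_swap:
  assumes "cubic_C4 V a b c d a' b' c' d'"
  shows "cubic_C4 V c b a d c' b' a' d'" "cubic_C4 V a d c b a' d' c' b'" "cubic_C4 V b c d a b' c' d' a'"
  using assms by (auto simp: cubic_C4_def)

lemma quadD:
  assumes q: "cubic_C4 V a b c d a' b' c' d'"
  shows "finite V" "subsets_bounded V" "a \<in> V" "b \<in> V" "c \<in> V" "d \<in> V" "a' \<in> V" "c' \<in> V" "b' \<in> V" "d' \<in> V"
    "nb V a = {b,d,a'}" "nb V b = {a,c,b'}" "nb V c = {b,d,c'}" "nb V d = {a,c,d'}"
    "a' \<noteq> c'" "b' \<noteq> d'" "a \<noteq> b" "a \<noteq> c" "a \<noteq> d" "b \<noteq> c" "b \<noteq> d" "c \<noteq> d"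
    "a' \<noteq> b" "a' \<noteq> d" "a' \<noteq> a" "a' \<noteq> c" "a' \<noteq> b'" "a' \<noteq> d'"
    "c' \<noteq> b" "c' \<noteq> d" "c' \<noteq> a" "c' \<noteq> c" "c' \<noteq> b'" "c' \<noteq> d'"
    "b' \<noteq> a" "b' \<noteq> b" "b' \<noteq> c" "b' \<noteq> d" "d' \<noteq> a" "d' \<noteq> b" "d' \<noteq> c" "d' \<noteq> d"
    "a \<in> nb V a'" "b \<notin> nb V a'" "c \<notin> nb V a'" "d \<notin> nb V a'" "c \<in> nb V c'" "a \<notin> nb V c'" "b \<notin> nb V c'" "d \<notin> nb V c'"
    "b \<in> nb V b'" "d \<in> nb V d'"
proof -
  show *: "finite V" "subsets_bounded V" "a \<in> V" "b \<in> V" "c \<in> V" "d \<in> V"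
    "nb V a = {b,d,a'}" "nb V b = {a,c,b'}" "nb V c = {b,d,c'}" "nb V d = {a,c,d'}" "a' \<noteq> c'" "b' \<noteq> d'"
    using q by (auto simp: cubic_C4_def)
  have d3: "deg V a = 3" "deg V b = 3" "deg V c = 3" "deg V d = 3" using q by (auto simp: cubic_C4_def)
  show ne: "b \<noteq> d" "a' \<noteq> b" "a' \<noteq> d" "a \<noteq> c" "b' \<noteq> a" "b' \<noteq> c" "c' \<noteq> b" "c' \<noteq> d" "d' \<noteq> a" "d' \<noteq> c"
    using d3 unfolding *(7-10) by (auto simp: card_insert_if split: if_splits)
  have mem: "b \<in> nb V a" "d \<in> nb V a" "a' \<in> nb V a" "a \<in> nb V b" "c \<in> nb V b" "b' \<in> nb V b"
    "b \<in> nb V c" "d \<in> nb V c" "c' \<in> nb V c" "a \<in> nb V d" "c \<in> nb V d" "d' \<in> nb V d"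
    unfolding *(7-10) by auto
  have nn: "x \<notin> nb V x" for x using irrefl by (auto simp: nb_def)
  show "a \<noteq> b" "a \<noteq> d" "b \<noteq> c" "c \<noteq> d" "a' \<noteq> a" "b' \<noteq> b" "c' \<noteq> c" "d' \<noteq> d" using mem nn by metis+
  show "a' \<in> V" "a \<in> nb V a'" using nbD[OF mem(3) *(3)] by auto
  show "b' \<in> V" "b \<in> nb V b'" using nbD[OF mem(6) *(4)] by auto
  show "c' \<in> V" "c \<in> nb V c'" using nbD[OF mem(9) *(5)] by auto
  show "d' \<in> V" "d \<in> nb V d'" using nbD[OF mem(12) *(6)] by auto
  show "b \<notin> nb V a'" "d \<notin> nb V a'" using nb_triangle[OF mem(1,3) *(3)] nb_triangle[OF mem(2,3) *(3)] by auto
  show "b \<notin> nb V c'" "d \<notin> nb V c'" using nb_triangle[OF mem(7,9) *(5)] nb_triangle[OF mem(8,9) *(5)] by auto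
  show "a' \<noteq> c" using nb_triangle[OF mem(3,1) *(3)] mem by auto
  show "c' \<noteq> a" using nb_triangle[OF mem(9,7) *(5)] mem by auto
  show "b' \<noteq> d" using nb_triangle[OF mem(6,4) *(4)] mem by auto
  show "d' \<noteq> b" using nb_triangle[OF mem(12,10) *(6)] mem by auto
  show "c \<notin> nb V a'"
  proof
    assume "c \<in> nb V a'"
    then have "a' \<in> nb V c" using nbD \<open>a' \<in> V\<close> by blast
    then show False unfolding *(9) using ne *(11) by auto
  qed
  show "a \<notin> nb V c'"
  proof
    assume "a \<in> nb V c'"
    then have "c' \<in> nb V a" using nbD \<open>c' \<in> V\<close> by blast
    then show False unfolding *(7) using ne *(11) by auto
  qed
  show "a' \<noteq> b'" using nb_triangle[OF mem(3,1) *(3)] mem nbD[OF mem(6) *(4)] \<open>b \<notin> nb V a'\<close> by auto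
  show "a' \<noteq> d'" using \<open>d \<notin> nb V a'\<close> \<open>d \<in> nb V d'\<close> by auto
  show "c' \<noteq> b'" using \<open>b \<notin> nb V c'\<close> \<open>b \<in> nb V b'\<close> by auto
  show "c' \<noteq> d'" using \<open>d \<notin> nb V c'\<close> \<open>d \<in> nb V d'\<close> by auto
qed

lemma nb_sym_iff: "x \<in> V \<Longrightarrow> y \<in> V \<Longrightarrow> x \<in> nb V y \<longleftrightarrow> y \<in> nb V x"
  by (auto simp: nb_def sym)

lemma cubic_C4_deg: "cubic_C4 V a b c d a' b' c' d' \<Longrightarrow> x \<in> V \<Longrightarrow> deg V x = 3"
  by (simp add: cubic_C4_def)

lemma cubic_C4_pair:
  assumes q: "cubic_C4 V a b c d a' b' c' d'" and x: "x \<in> V" "y \<in> nb V x"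
  shows "count_le V (\<lambda>F. x \<in> F \<and> y \<in> F) (g (int (card V) - 6))"
proof -
  have "y \<in> V" "adj x y" using nbD[OF x(2,1)] by auto
  then show ?thesis
    using cell_pair[OF quadD(1,2)[OF q] x(1), of y] cubic_C4_deg[OF q] x(1) by simp
qed

text \<open>The sets avoiding \<open>b\<close>, \<open>d\<close> and \<open>a\<close>: then \<open>a'\<close> must be matched, since it blocks \<open>a\<close>.\<close>

lemma cubic_C4_match:
  assumes q: "cubic_C4 V a b c d a' b' c' d'" and x: "x \<in> nb V a' - {a}"
  shows "x \<noteq> b' \<Longrightarrow> x \<noteq> d' \<Longrightarrow> count_le V (\<lambda>F. a \<notin> F \<and> b \<notin> F \<and> d \<notin> F \<and> a' \<in> F \<and> x \<in> F) (g (int (card V) - 8))"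
    and "count_le V (\<lambda>F. a \<notin> F \<and> b \<notin> F \<and> d \<notin> F \<and> a' \<in> F \<and> x \<in> F) (g (int (card V) - 7))"
    and "c' \<in> nb V a' \<Longrightarrow> count_le V (\<lambda>F. a \<notin> F \<and> b \<notin> F \<and> d \<notin> F \<and> a' \<in> F \<and> x \<in> F) (g (int (card V) - 8))"
proof -
  note D = quadD[OF q]
  have xV: "x \<in> V" "a' \<in> nb V x" "adj a' x" "adj x a'" using nbD[of x V a'] x D(7) by auto
  have x': "x \<noteq> b" "x \<noteq> d" "x \<noteq> c" using x D(44-46) by auto
  have c6: "card (nb V a' \<union> nb V x) = 6"
    using card_nb_Un[OF D(1) xV(3)] cubic_C4_deg[OF q D(7)] cubic_C4_deg[OF q xV(1)] by simp
  have bx: "b \<in> nb V x \<longleftrightarrow> x = b'" unfolding nb_sym_iff[OF D(4) xV(1)] D(12) using x x'(3) by simp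
  have dx: "d \<in> nb V x \<longleftrightarrow> x = d'" unfolding nb_sym_iff[OF D(6) xV(1)] D(14) using x x'(3) by simp
  have cx: "c \<in> nb V x \<longleftrightarrow> x = c'" unfolding nb_sym_iff[OF D(5) xV(1)] D(13) using x'(1,2) by simp
  have J: "\<exists>z\<in>{a',x}. adj y z" if "y \<in> {a',x}" for y using that xV by auto
  have eight: "count_le V (\<lambda>F. a \<notin> F \<and> b \<notin> F \<and> d \<notin> F \<and> a' \<in> F \<and> x \<in> F) (g (int (card V) - int 8))"
    if "x \<noteq> b'" "x \<noteq> d'"
  proof (rule cell[OF D(1,2), where I = "{}" and J = "{a',x}" and O' = "{b,d}" and K = "{b,d} \<union> (nb V a' \<union> nb V x)"])
    show "8 \<le> card ({b,d} \<union> (nb V a' \<union> nb V x))" using c6 bx dx that D(1,21,44,46) by simp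
  qed (use J D(4,6) nb_subset in auto)
  then show "x \<noteq> b' \<Longrightarrow> x \<noteq> d' \<Longrightarrow> count_le V (\<lambda>F. a \<notin> F \<and> b \<notin> F \<and> d \<notin> F \<and> a' \<in> F \<and> x \<in> F) (g (int (card V) - 8))" by simp
  have "count_le V (\<lambda>F. a \<notin> F \<and> b \<notin> F \<and> d \<notin> F \<and> a' \<in> F \<and> x \<in> F) (g (int (card V) - int 7))"
  proof (rule cell[OF D(1,2), where I = "{}" and J = "{a',x}" and O' = "{b,d}" and K = "{b,d} \<union> (nb V a' \<union> nb V x)"])
    show "7 \<le> card ({b,d} \<union> (nb V a' \<union> nb V x))"
      using c6 bx dx D(1,16,21,44,46) by (cases "x = b'"; cases "x = d'") (auto simp: card_insert_if)
  qed (use J D(4,6) nb_subset in auto)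
  then show "count_le V (\<lambda>F. a \<notin> F \<and> b \<notin> F \<and> d \<notin> F \<and> a' \<in> F \<and> x \<in> F) (g (int (card V) - 7))" by simp
  show "count_le V (\<lambda>F. a \<notin> F \<and> b \<notin> F \<and> d \<notin> F \<and> a' \<in> F \<and> x \<in> F) (g (int (card V) - 8))" if ca: "c' \<in> nb V a'"
  proof (cases "x = c'")
    case True
    then show ?thesis using eight D(33,34) by simp
  next
    case False
    have adjc: "adj a' c'" using ca by (simp add: nb_def)
    have c': "c' \<notin> F" if F: "mds V F" "a' \<in> F" "x \<in> F" for F
      using mds_unique[OF F(1,2), of x c'] xV(3) F(3) adjc False by blast
    \<comment> \<open>The partner of \<open>a'\<close> is \<open>x\<close>, so its neighbour
      \<open>c'\<close> is outside \<open>F\<close>. Then all neighbours of \<open>c\<close> are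
      outside \<open>F\<close>, which makes \<open>c\<close> an isolated member and provides a
      further deleted vertex.\<close>
    have "count_le V (\<lambda>F. a \<notin> F \<and> b \<notin> F \<and> d \<notin> F \<and> a' \<in> F \<and> x \<in> F) (g (int (card V) - int 8))"
    proof (rule cell[OF D(1,2), where I = "{c}" and J = "{a',x}" and O' = "{b,d}" and K = "{b,d,c} \<union> (nb V a' \<union> nb V x)"])
      fix F assume F: "mds V F" "a \<notin> F \<and> b \<notin> F \<and> d \<notin> F \<and> a' \<in> F \<and> x \<in> F"
      have cF: "c' \<notin> F" using c'[OF F(1)] F(2) by blast
      have "c \<in> F" using mds_blocked'[OF F(1) D(5)] D(13) F(2) cF by auto
      then show "{c} \<subseteq> F \<and> {a',x} \<subseteq> F \<and> {b,d} \<inter> F = {} \<and> (\<forall>v\<in>{c}. nb V v \<inter> F = {})"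
        using F(2) cF D(13) by auto
    next
      show "8 \<le> card ({b,d,c} \<union> (nb V a' \<union> nb V x))"
        using c6 bx dx cx False D(1,16,20,21,22,44,45,46) by (cases "x = b'"; cases "x = d'") (auto simp: card_insert_if)
    qed (use J D(4,5,6) nb_subset in auto)
    then show ?thesis by simp
  qed
qed

text \<open>Once \<open>b\<close> and \<open>d\<close> are outside \<open>F\<close>, the vertex
  \<open>a\<close> is isolated in \<open>F\<close>, matched to \<open>a'\<close>, or blocked by
  \<open>a'\<close> with another partner.\<close>

lemma cubic_C4_side_rule:
  assumes q: "cubic_C4 V a b c d a' b' c' d'"
    and xa: "count_le V (\<lambda>F. isolated V F a) xa" and na: "nb V a' = {a,p,r}" "p \<noteq> r" "p \<noteq> a" "r \<noteq> a"
    and xp: "count_le V (\<lambda>F. a \<notin> F \<and> b \<notin> F \<and> d \<notin> F \<and> a' \<in> F \<and> p \<in> F) xp"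
    and xr: "count_le V (\<lambda>F. a \<notin> F \<and> b \<notin> F \<and> d \<notin> F \<and> a' \<in> F \<and> r \<in> F) xr"
  shows "count_le V (\<lambda>F. b \<notin> F \<and> d \<notin> F) (xa + g (int (card V) - 6) + xp + xr)"
proof -
  note D = quadD[OF q]
  have a': "a' \<in> nb V a" using D(11) by simp
  have "count_le V (\<lambda>F. ((isolated V F a \<or> a \<in> F \<and> a' \<in> F) \<or> a \<notin> F \<and> b \<notin> F \<and> d \<notin> F \<and> a' \<in> F \<and> p \<in> F)
      \<or> a \<notin> F \<and> b \<notin> F \<and> d \<notin> F \<and> a' \<in> F \<and> r \<in> F) (xa + g (int (card V) - 6) + xp + xr)"
    by (intro count_le_or xa xp xr D(1) cubic_C4_pair[OF q D(3) a'])
  then show ?thesis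
  proof (rule count_le_mono)
    fix F assume F: "mds V F" "b \<notin> F \<and> d \<notin> F"
    show "((isolated V F a \<or> a \<in> F \<and> a' \<in> F) \<or> a \<notin> F \<and> b \<notin> F \<and> d \<notin> F \<and> a' \<in> F \<and> p \<in> F)
      \<or> a \<notin> F \<and> b \<notin> F \<and> d \<notin> F \<and> a' \<in> F \<and> r \<in> F"
    proof (cases "a \<in> F")
      case True
      then show ?thesis using D(11) F(2) by auto
    next
      case False
      have "a' \<in> F" "\<exists>w\<in>nb V a' \<inter> F. w \<noteq> a" using mds_blocked'[OF F(1) D(3) False] D(11) F(2) by auto
      then show ?thesis using na(1) False F(2) by auto
    qed
  qed (use D(1) in auto)
qed

text \<open>1/6 + 1/11 + 2/36 = 31/99, a value that \<open>cubic_C4_less\<close> can afford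
  twice.\<close>

lemma cubic_C4_side_far:
  assumes q: "cubic_C4 V a b c d a' b' c' d'" and n: "int (card V) = 4 * k + 2"
    and far: "c' \<in> nb V a' \<or> b' \<notin> nb V a' \<and> d' \<notin> nb V a'"
  shows "count_le V (\<lambda>F. b \<notin> F \<and> d \<notin> F) (31/99 * g (int (card V)))"
proof -
  note D = quadD[OF q]
  have "card (nb V a' - {a}) = 2" using cubic_C4_deg[OF q D(7)] D(1,43) by simp
  then obtain p r where pr: "nb V a' - {a} = {p,r}" "p \<noteq> r" by (auto simp: card_2_iff)
  then have na: "nb V a' = {a,p,r}" "p \<noteq> a" "r \<noteq> a" "p \<in> nb V a' - {a}" "r \<in> nb V a' - {a}" using D(43) by auto
  have x: "count_le V (\<lambda>F. a \<notin> F \<and> b \<notin> F \<and> d \<notin> F \<and> a' \<in> F \<and> x \<in> F) (g (int (card V) - 8))" if x: "x \<in> nb V a' - {a}" for x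
  proof (cases "c' \<in> nb V a'")
    case True
    then show ?thesis by (rule cubic_C4_match(3)[OF q x])
  next
    case False
    then show ?thesis using far x by (intro cubic_C4_match(1)[OF q x]) auto
  qed
  have xa: "count_le V (\<lambda>F. isolated V F a) (g (int (card V) - 4))"
    using count_le_iso[OF D(1-3)] cubic_C4_deg[OF q D(3)] by simp
  have "count_le V (\<lambda>F. b \<notin> F \<and> d \<notin> F) (g (int (card V) - 4) + g (int (card V) - 6) + g (int (card V) - 8) + g (int (card V) - 8))"
    by (rule cubic_C4_side_rule[OF q xa na(1) pr(2) na(2,3) x[OF na(4)] x[OF na(5)]])
  then show ?thesis using g_table2[OF n] by (simp add: count_le_def)
qed

text \<open>If \<open>a\<close> is isolated and \<open>b, c, d\<close> are avoided, then \<open>b', d'\<close> are chosen and \<open>c'\<close> is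
  matched, so \<open>c'\<close> has at most one neighbour among \<open>b', d'\<close>.\<close>

lemma cubic_C4_iso:
  assumes q: "cubic_C4 V a b c d a' b' c' d'" and bc: "b' \<in> nb V c'" and ac: "c' \<notin> nb V a'"
  shows "count_le V (\<lambda>F. isolated V F a) (g (int (card V) - 6) + g (int (card V) - 8) + (if d' \<in> nb V c' then 0 else g (int (card V) - 8)))"
proof -
  note D = quadD[OF q]
  have ca: "a' \<notin> nb V c'" using ac nbD[of a' V c'] D(8) by auto
  have 1: "count_le V (\<lambda>F. isolated V F a \<and> isolated V F c) (g (int (card V) - int 6))"
  proof (rule cell[OF D(1,2), where I = "{a,c}" and J = "{}" and O' = "{}" and K = "{a,b,d,a',c,c'}"])
    show "6 \<le> card {a,b,d,a',c,c'}" using D(15-34) by auto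
  qed (use D(3-8,11,13) in auto)
  have c6: "card (nb V c \<union> nb V c') = 6"
  proof -
    have "c' \<in> nb V c" using D(13) by simp
    then have "adj c c'" by (simp add: nb_iff)
    then show ?thesis
      using card_nb_Un[OF D(1)] cubic_C4_deg[OF q D(5)] cubic_C4_deg[OF q D(8)] by simp
  qed
  have 2: "count_le V (\<lambda>F. isolated V F a \<and> c \<in> F \<and> c' \<in> F) (g (int (card V) - int 8))"
  proof (rule cell[OF D(1,2), where I = "{a}" and J = "{c,c'}" and O' = "{}" and K = "{a,a'} \<union> (nb V c \<union> nb V c')"])
    have "a \<notin> nb V c" "a' \<notin> nb V c" using D(13,15,17,19,23,24,31) by auto
    then show "8 \<le> card ({a,a'} \<union> (nb V c \<union> nb V c'))" using c6 ca D(1,25,48) by simp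
    have "c' \<in> nb V c" using D(13) by simp
    then have "adj c c'" "adj c' c" using sym by (simp_all add: nb_iff)
    then show "\<exists>z\<in>{c,c'}. adj y z" if "y \<in> {c,c'}" for y using that by auto
  qed (use D(3,5,7,8,11) nb_subset in auto)
  have bD: "adj c' b'" "adj b' c'" using nbD[OF bc D(8)] by auto
  have F: "b' \<in> F \<and> d' \<in> F \<and> c' \<in> F" if F: "mds V F" "isolated V F a" "c \<notin> F" for F
  proof -
    have n: "b \<notin> F" "d \<notin> F" "a' \<notin> F" using F(2) D(11) by auto
    have "b' \<in> F" using mds_blocked'[OF F(1) D(4) n(1)] D(12) F(2,3) by auto
    moreover have "d' \<in> F" using mds_blocked'[OF F(1) D(6) n(2)] D(14) F(2,3) by auto
    moreover have "c' \<in> F" using mds_blocked'[OF F(1) D(5) F(3)] D(13) n by auto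
    ultimately show ?thesis by blast
  qed
  have 3: "count_le V (\<lambda>F. isolated V F a \<and> c \<notin> F) (if d' \<in> nb V c' then 0 else g (int (card V) - 8))"
  proof (cases "d' \<in> nb V c'")
    case True
    have "count_le V (\<lambda>F. isolated V F a \<and> c \<notin> F) 0"
    proof (rule count_le_zero)
      fix F assume F': "mds V F" "isolated V F a \<and> c \<notin> F"
      then have "b' \<in> F" "d' \<in> F" "c' \<in> F" using F[OF F'(1)] by blast+
      moreover have "adj c' d'" using True by (simp add: nb_def)
      ultimately show False using mds_unique[OF F'(1), of c' b' d'] bD D(16) by blast
    qed simp
    then show ?thesis using True by simp
  next
    case False
    \<comment> \<open>The third neighbour of \<open>c'\<close> serves as the eighth deleted vertex;
      it differs from \<open>a'\<close> by \<open>ca\<close>.\<close>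
    obtain z where z: "nb V c' = {c,b',z}" "z \<noteq> c" "z \<noteq> b'"
      using deg3_third[OF D(1) cubic_C4_deg[OF q D(8)] D(47) bc] D(37) by metis
    have zn: "z \<in> nb V c'" using z by simp
    have zV: "z \<in> V" "c' \<in> nb V z" using nbD[OF zn D(8)] by auto
    have z': "z \<noteq> a" "z \<noteq> b" "z \<noteq> d" "z \<noteq> a'" using zn D(48-50) ca by auto
    have "z \<noteq> c'" using zn irrefl by (auto simp: nb_def)
    have "count_le V (\<lambda>F. isolated V F a \<and> c \<notin> F) (g (int (card V) - int 8))"
    proof (rule cell[OF D(1,2), where I = "{a}" and J = "{c',b'}" and O' = "{c}" and K = "{a,b,d,a',c,c',b',z}"])
      show "8 \<le> card {a,b,d,a',c,c',b',z}"
        using D(15-38) z z' \<open>z \<noteq> c'\<close> by auto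
      show "\<exists>z\<in>{c',b'}. adj y z" if "y \<in> {c',b'}" for y using that bD by auto
      fix F' assume F': "mds V F'" "isolated V F' a \<and> c \<notin> F'"
      then have "b' \<in> F'" "c' \<in> F'" using F[OF F'(1)] by blast+
      then show "{a} \<subseteq> F' \<and> {c',b'} \<subseteq> F' \<and> {c} \<inter> F' = {} \<and> (\<forall>v\<in>{a}. nb V v \<inter> F' = {})" using F' by auto
    qed (use D(3-9,11) z zV in auto)
    then show ?thesis using False by simp
  qed
  have "count_le V (\<lambda>F. (isolated V F a \<and> isolated V F c \<or> isolated V F a \<and> c \<in> F \<and> c' \<in> F) \<or> isolated V F a \<and> c \<notin> F)
    (g (int (card V) - 6) + g (int (card V) - 8) + (if d' \<in> nb V c' then 0 else g (int (card V) - 8)))"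
    using count_le_or[OF count_le_or[OF 1 2 D(1)] 3 D(1)] by simp
  then show ?thesis
  proof (rule count_le_mono)
    fix F assume "mds V F" "isolated V F a"
    then show "(isolated V F a \<and> isolated V F c \<or> isolated V F a \<and> c \<in> F \<and> c' \<in> F) \<or> isolated V F a \<and> c \<notin> F"
      using D(11,13) by auto
  qed (use D(1) in auto)
qed

text \<open>A partner \<open>b'\<close> or \<open>d'\<close> of \<open>a'\<close> costs a deleted
  vertex in \<open>cubic_C4_match\<close>; \<open>cubic_C4_iso\<close> makes up for it because
  \<open>c'\<close> is adjacent to \<open>b'\<close> or \<open>d'\<close> too. \<open>less\<close>
  says that \<open>a'\<close> has no more such neighbours than \<open>c'\<close>, which can be
  arranged by exchanging \<open>a\<close> and \<open>c\<close>.\<close>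

lemma cubic_C4_side_near:
  assumes q: "cubic_C4 V a b c d a' b' c' d'" and n: "int (card V) = 4 * k + 2"
    and ac: "c' \<notin> nb V a'" and bc: "b' \<in> nb V c' \<or> d' \<in> nb V c'"
    and less: "b' \<in> nb V a' \<and> d' \<in> nb V a' \<Longrightarrow> b' \<in> nb V c' \<and> d' \<in> nb V c'"
  shows "count_le V (\<lambda>F. b \<notin> F \<and> d \<notin> F) (31/99 * g (int (card V)))"
proof -
  note D = quadD[OF q]
  note t = g_table2[OF n] g_pos[of "int (card V)"]
  have xa: "count_le V (\<lambda>F. isolated V F a) (g (int (card V) - 6) + g (int (card V) - 8) + (if b' \<in> nb V c' \<and> d' \<in> nb V c' then 0 else g (int (card V) - 8)))"
  proof (cases "b' \<in> nb V c'")
    case True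
    then show ?thesis using cubic_C4_iso[OF q True ac] by simp
  next
    case False
    then have "d' \<in> nb V c'" using bc by blast
    then show ?thesis using cubic_C4_iso[OF cubic_C4_swap(2)[OF q] _ ac] False by simp
  qed
  have "card (nb V a' - {a}) = 2" using cubic_C4_deg[OF q D(7)] D(1,43) by simp
  then obtain p r where pr: "nb V a' - {a} = {p,r}" "p \<noteq> r" by (auto simp: card_2_iff)
  then have na: "nb V a' = {a,p,r}" "p \<noteq> a" "r \<noteq> a" "p \<in> nb V a' - {a}" "r \<in> nb V a' - {a}" using D(43) by auto
  note rule = cubic_C4_side_rule[OF q xa na(1) pr(2) na(2,3)]
  show ?thesis
  proof (cases "b' \<in> nb V c' \<and> d' \<in> nb V c'")
    case True
    have "count_le V (\<lambda>F. b \<notin> F \<and> d \<notin> F) (g (int (card V) - 6) + g (int (card V) - 8) + 0 + g (int (card V) - 6) + g (int (card V) - 7) + g (int (card V) - 7))"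
      using rule[OF cubic_C4_match(2)[OF q na(4)] cubic_C4_match(2)[OF q na(5)]] True by simp
    then show ?thesis using t by (simp add: count_le_def)
  next
    case False
    then have "\<exists>x\<in>{p,r}. x \<noteq> b' \<and> x \<noteq> d'"
      using less pr na by (metis D(35) D(39) insertE insertI1 insert_commute insert_iff)
    then have "count_le V (\<lambda>F. b \<notin> F \<and> d \<notin> F) (g (int (card V) - 6) + g (int (card V) - 8) + g (int (card V) - 8) + g (int (card V) - 6) + g (int (card V) - 7) + g (int (card V) - 8))"
    proof (elim bexE insertE conjE emptyE)
      fix x assume x: "x = p" "x \<noteq> b'" "x \<noteq> d'"
      then show ?thesis
        using rule[OF cubic_C4_match(1)[OF q na(4)] cubic_C4_match(2)[OF q na(5)]] False by (simp add: algebra_simps)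
    next
      fix x assume x: "x = r" "x \<noteq> b'" "x \<noteq> d'"
      then show ?thesis
        using rule[OF cubic_C4_match(2)[OF q na(4)] cubic_C4_match(1)[OF q na(5)]] False by (simp add: algebra_simps)
    qed
    then show ?thesis using t by (simp add: count_le_def)
  qed
qed

lemma cubic_C4_side:
  assumes q: "cubic_C4 V a b c d a' b' c' d'" and n: "int (card V) = 4 * k + 2"
  shows "count_le V (\<lambda>F. b \<notin> F \<and> d \<notin> F) (31/99 * g (int (card V)))"
proof -
  note D = quadD[OF q]
  note q' = cubic_C4_swap(1)[OF q]
  have sy: "c' \<in> nb V a' \<longleftrightarrow> a' \<in> nb V c'" using nbD[of c' V a'] nbD[of a' V c'] D(7,8) by blast
  consider "c' \<in> nb V a' \<or> b' \<notin> nb V a' \<and> d' \<notin> nb V a'" | "b' \<notin> nb V c' \<and> d' \<notin> nb V c'"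
    | "c' \<notin> nb V a'" "b' \<in> nb V a' \<or> d' \<in> nb V a'" "b' \<in> nb V c' \<or> d' \<in> nb V c'" by blast
  then show ?thesis
  proof cases
    case 1
    then show ?thesis by (rule cubic_C4_side_far[OF q n])
  next
    case 2
    then show ?thesis by (intro cubic_C4_side_far[OF q' n]) blast
  next
    case 3
    show ?thesis
    proof (cases "b' \<in> nb V a' \<and> d' \<in> nb V a' \<longrightarrow> b' \<in> nb V c' \<and> d' \<in> nb V c'")
      case True
      then show ?thesis using cubic_C4_side_near[OF q n 3(1,3)] by blast
    next
      case False
      then show ?thesis using cubic_C4_side_near[OF q' n _ 3(2)] 3(1) sy by blast
    qed
  qed
qed

text \<open>A set meeting both diagonals of the 4-cycle contains one of its edges. The four edges
  contribute 4/11 and each missed diagonal 31/99, in total 98/99.\<close>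

lemma cubic_C4_less:
  assumes q: "cubic_C4 V a b c d a' b' c' d'" and n: "int (card V) = 4 * k + 2"
  shows "real (num_mds V) < g (int (card V))"
proof -
  note D = quadD[OF q]
  note t = g_table2[OF n] g_pos[of "int (card V)"]
  have s1: "count_le V (\<lambda>F. b \<notin> F \<and> d \<notin> F) (31/99 * g (int (card V)))" by (rule cubic_C4_side[OF q n])
  have s2: "count_le V (\<lambda>F. c \<notin> F \<and> a \<notin> F) (31/99 * g (int (card V)))" by (rule cubic_C4_side[OF cubic_C4_swap(3)[OF q] n])
  have m: "b \<in> nb V a" "d \<in> nb V a" "b \<in> nb V c" "d \<in> nb V c" using D(11,13) by auto
  note pr = cubic_C4_pair[OF q D(3) m(1)] cubic_C4_pair[OF q D(3) m(2)] cubic_C4_pair[OF q D(5) m(3)] cubic_C4_pair[OF q D(5) m(4)]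
  have "real (num_mds V) \<le> g (int (card V) - 6) + g (int (card V) - 6) + g (int (card V) - 6) + g (int (card V) - 6)
    + 31/99 * g (int (card V)) + 31/99 * g (int (card V))"
  proof (rule count_le_num_mds)
    show "count_le V (\<lambda>F. ((((a \<in> F \<and> b \<in> F \<or> a \<in> F \<and> d \<in> F) \<or> c \<in> F \<and> b \<in> F) \<or> c \<in> F \<and> d \<in> F) \<or> b \<notin> F \<and> d \<notin> F) \<or> c \<notin> F \<and> a \<notin> F)
      (g (int (card V) - 6) + g (int (card V) - 6) + g (int (card V) - 6) + g (int (card V) - 6)
    + 31/99 * g (int (card V)) + 31/99 * g (int (card V)))"
      by (intro count_le_or pr s1 s2 D(1))
  qed (use D(1) in auto)
  then show ?thesis using t by simp
qed

lemma no_extremal_component_residue2: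
  assumes p: "no_extremal_component V" and n: "int (card V) = 4 * q + 2"
  shows "real (num_mds V) < g (int (card V))"
proof (cases "\<forall>x\<in>V. deg V x = 3")
  case False
  then show ?thesis by (rule no_extremal_component_residue2_not_cubic[OF p n])
next
  case True
  then have d3: "deg V x = 3" if "x \<in> V" for x using that by blast
  note P = plainD[OF p]
  show ?thesis
  proof (cases "\<exists>v\<in>V. \<exists>w\<in>V. v \<noteq> w \<and> nb V v = nb V w")
    case twins: True
    then obtain v w where vw: "v \<in> V" "w \<in> V" "v \<noteq> w" "nb V v = nb V w" by blast
    show ?thesis by (rule cubic_twins[OF p n d3 vw])
  next
    case no_twins: False
    show ?thesis
    proof (cases "\<forall>x\<in>V. \<forall>y\<in>V. x \<noteq> y \<longrightarrow> (\<forall>p\<in>nb V x \<inter> nb V y. \<forall>q\<in>nb V x \<inter> nb V y. p = q)")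
      case noC4: True
      have "V \<noteq> {}" using n by auto presburger
      then show ?thesis by (rule cubic_girth5[OF P(1,2) n True noC4])
    next
      case False
      then obtain a c b d where ac: "a \<in> V" "c \<in> V" "a \<noteq> c" and count_le: "b \<in> nb V a" "b \<in> nb V c" "d \<in> nb V a" "d \<in> nb V c" "b \<noteq> d"
        by auto
      have bdV: "b \<in> V" "d \<in> V" "a \<in> nb V b" "c \<in> nb V b" "a \<in> nb V d" "c \<in> nb V d"
        using nbD[OF count_le(1) ac(1)] nbD[OF count_le(2) ac(2)] nbD[OF count_le(3) ac(1)] nbD[OF count_le(4) ac(2)] by auto
      obtain a' where a': "nb V a = {b,d,a'}" using deg3_third[OF P(1) d3[OF ac(1)] count_le(1,3,5)] by (elim exE conjE)
      obtain c' where c': "nb V c = {b,d,c'}" using deg3_third[OF P(1) d3[OF ac(2)] count_le(2,4,5)] by (elim exE conjE)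
      obtain b' where b': "nb V b = {a,c,b'}" using deg3_third[OF P(1) d3[OF bdV(1)] bdV(3,4) ac(3)] by (elim exE conjE)
      obtain d' where d': "nb V d = {a,c,d'}" using deg3_third[OF P(1) d3[OF bdV(2)] bdV(5,6) ac(3)] by (elim exE conjE)
      \<comment> \<open>Equal third neighbours would make opposite vertices of the 4-cycle
        twins.\<close>
      have ne: "nb V a \<noteq> nb V c" "nb V b \<noteq> nb V d" using no_twins ac bdV(1,2) count_le(5) by auto
      have "a' \<noteq> c'" "b' \<noteq> d'" using ne a' b' c' d' by auto
      then have "cubic_C4 V a b c d a' b' c' d'"
        unfolding cubic_C4_def using P(1,2) True ac bdV(1,2) a' b' c' d' by simp
      then show ?thesis by (rule cubic_C4_less[OF _ n])
    qed
  qed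
qed

end

section \<open>Induction over components\<close>

context sym_graph
begin

text \<open>The 4-cycles are added one at a time as K_{2,2}; their number is read off from the
  cardinality.\<close>

inductive C4_union :: "'a set \<Rightarrow> bool" where
  empty: "C4_union {}"
| add: "complete_bip X Y \<Longrightarrow> card X = 2 \<Longrightarrow> card Y = 2 \<Longrightarrow> separated (X \<union> Y) W \<Longrightarrow> C4_union W \<Longrightarrow> C4_union (X \<union> Y \<union> W)"

text \<open>One component K_{p,q} next to 4-cycles; P_3 appears as the case of sides 1 and
  2.\<close>

definition core_C4_union :: "nat \<Rightarrow> nat \<Rightarrow> 'a set \<Rightarrow> bool" where
  "core_C4_union p q V \<longleftrightarrow> (\<exists>X Y W. V = X \<union> Y \<union> W \<and> complete_bip X Y \<and> card X = p \<and> card Y = q \<and> separated (X \<union> Y) W \<and> C4_union W)"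

text \<open>The residue is not mentioned, since the cardinality tells the four shapes apart.\<close>

definition extremal :: "'a set \<Rightarrow> bool" where
  "extremal V \<longleftrightarrow> C4_union V \<or> core_C4_union 2 3 V \<or> core_C4_union 3 3 V \<or> core_C4_union 1 2 V"

lemma card_complete_bip_Un:
  assumes "complete_bip X Y" "0 < card X" "0 < card Y"
  shows "finite (X \<union> Y)" "card (X \<union> Y) = card X + card Y"
  using assms card_gt_0_iff[of X] card_gt_0_iff[of Y] by (auto simp: complete_bip_def card_Un_disjoint)

lemma C4_union_props: "C4_union V \<Longrightarrow> finite V \<and> (\<exists>t. card V = 4 * t \<and> num_mds V = 6 ^ t)"
proof (induction rule: C4_union.induct)
  case empty
  show ?case by (auto simp: num_mds_empty intro!: exI[of _ 0])
next
  case (add X Y W)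
  then obtain t where t: "finite W" "card W = 4 * t" "num_mds W = 6 ^ t" by blast
  have XY: "finite (X \<union> Y)" "card (X \<union> Y) = 4" using card_complete_bip_Un[OF add(1)] add(2,3) by auto
  have "num_mds (X \<union> Y \<union> W) = num_mds (X \<union> Y) * num_mds W" by (rule num_mds_separated[OF add(4) XY(1) t(1)])
  also have "num_mds (X \<union> Y) = 6" using num_mds_complete_bip[OF add(1)] add(2,3) by simp
  finally have "num_mds (X \<union> Y \<union> W) = 6 ^ Suc t" using t by simp
  moreover have "card (X \<union> Y \<union> W) = 4 * Suc t"
    using card_Un_disjoint[OF XY(1) t(1)] add(4) XY(2) t(2) by (simp add: separated_def)
  ultimately show ?case using XY(1) t(1) by blast
qed

lemma core_C4_union_props:
  assumes e: "core_C4_union p q V" and pq: "0 < p" "0 < q" and m: "\<And>X Y. complete_bip X Y \<Longrightarrow> card X = p \<Longrightarrow> card Y = q \<Longrightarrow> num_mds (X \<union> Y) = m"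
  shows "finite V \<and> (\<exists>t. card V = p + q + 4 * t \<and> num_mds V = m * 6 ^ t)"
proof -
  obtain X Y W where V: "V = X \<union> Y \<union> W" and k: "complete_bip X Y" "card X = p" "card Y = q" and s: "separated (X \<union> Y) W" and c: "C4_union W"
    using e by (auto simp: core_C4_union_def)
  obtain t where t: "finite W" "card W = 4 * t" "num_mds W = 6 ^ t" using C4_union_props[OF c] by blast
  have XY: "finite (X \<union> Y)" "card (X \<union> Y) = p + q" using card_complete_bip_Un[OF k(1)] k pq by auto
  have "num_mds V = num_mds (X \<union> Y) * num_mds W" unfolding V by (rule num_mds_separated[OF s XY(1) t(1)])
  then have "num_mds V = m * 6 ^ t" using m[OF k] t by simp
  moreover have "card V = p + q + 4 * t"
    using card_Un_disjoint[OF XY(1) t(1)] s XY(2) t(2) V by (simp add: separated_def)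
  ultimately show ?thesis using XY(1) t(1) V by blast
qed

lemma ext23_props: "core_C4_union 2 3 V \<Longrightarrow> finite V \<and> (\<exists>t. card V = 5 + 4 * t \<and> num_mds V = 8 * 6 ^ t)"
  using core_C4_union_props[of 2 3 V 8] num_mds_complete_bip by simp

lemma ext33_props: "core_C4_union 3 3 V \<Longrightarrow> finite V \<and> (\<exists>t. card V = 6 + 4 * t \<and> num_mds V = 11 * 6 ^ t)"
  using core_C4_union_props[of 3 3 V 11] num_mds_complete_bip by simp

lemma ext12_props: "core_C4_union 1 2 V \<Longrightarrow> finite V \<and> (\<exists>t. card V = 3 + 4 * t \<and> num_mds V = 3 * 6 ^ t)"
proof -
  assume e: "core_C4_union 1 2 V"
  have "finite V \<and> (\<exists>t. card V = 1 + 2 + 4 * t \<and> num_mds V = 3 * 6 ^ t)"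
  proof (rule core_C4_union_props[OF e])
    fix X Y assume k: "complete_bip X Y" "card X = 1" "card Y = 2"
    then obtain x where "X = {x}" by (auto simp: card_1_singleton_iff)
    then show "num_mds (X \<union> Y) = 3" using num_mds_complete_bip_star[of x Y] k by simp
  qed simp_all
  then obtain t where "finite V" "card V = 1 + 2 + 4 * t" "num_mds V = 3 * 6 ^ t" by (elim conjE exE)
  moreover from this(2) have "card V = 3 + 4 * t" by linarith
  ultimately show ?thesis by (intro conjI exI[of _ t])
qed

lemma separated_Un: "separated A (B \<union> C) \<longleftrightarrow> separated A B \<and> separated A C"
  unfolding separated_def by blast

lemma separated_sym: "separated A B \<Longrightarrow> separated B A"
  unfolding separated_def using sym by blast

text \<open>The new 4-cycle is moved past the core into the part made of 4-cycles.\<close>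

lemma core_C4_union_add:
  assumes k: "complete_bip X Y" "card X = 2" "card Y = 2" and s: "separated (X \<union> Y) W" and e: "core_C4_union p q W"
  shows "core_C4_union p q (X \<union> Y \<union> W)"
proof -
  obtain X' Y' W' where W: "W = X' \<union> Y' \<union> W'" and k': "complete_bip X' Y'" "card X' = p" "card Y' = q"
    and s': "separated (X' \<union> Y') W'" and c: "C4_union W'"
    using e by (auto simp: core_C4_union_def)
  have s2: "separated (X \<union> Y) (X' \<union> Y')" "separated (X \<union> Y) W'" using s unfolding W separated_Un by auto
  have "C4_union (X \<union> Y \<union> W')" by (rule C4_union.add[OF k s2(2) c])
  moreover have "separated (X' \<union> Y') (X \<union> Y \<union> W')"
    using separated_sym[OF s2(1)] s' separated_Un by blast
  moreover have "X \<union> Y \<union> W = X' \<union> Y' \<union> (X \<union> Y \<union> W')" unfolding W by auto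
  ultimately show ?thesis unfolding core_C4_union_def using k' by blast
qed

lemma extremal_add:
  assumes "complete_bip X Y" "card X = 2" "card Y = 2" "separated (X \<union> Y) W" "extremal W"
  shows "extremal (X \<union> Y \<union> W)"
  using assms(5) C4_union.add[OF assms(1-4)] core_C4_union_add[OF assms(1-4)] unfolding extremal_def by blast

lemma extremal_mod4: "extremal V \<Longrightarrow> 4 dvd card V \<Longrightarrow> C4_union V"
proof -
  assume e: "extremal V" and d: "4 dvd card V"
  have "\<not> core_C4_union 2 3 V"
  proof
    assume "core_C4_union 2 3 V"
    then obtain t where "card V = 5 + 4 * t" using ext23_props by blast
    then show False using d by presburger
  qed
  moreover have "\<not> core_C4_union 3 3 V"
  proof
    assume "core_C4_union 3 3 V"
    then obtain t where "card V = 6 + 4 * t" using ext33_props by blast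
    then show False using d by presburger
  qed
  moreover have "\<not> core_C4_union 1 2 V"
  proof
    assume "core_C4_union 1 2 V"
    then obtain t where "card V = 3 + 4 * t" using ext12_props by blast
    then show False using d by presburger
  qed
  ultimately show ?thesis using e by (simp add: extremal_def)
qed

end

context tf_graph
begin

text \<open>Counts multiply over the component and the rest. So equality for \<open>V\<close> forces
  equality in \<open>num\<close>, which determines the residue, and equality for the rest, which is
  then extremal by induction.\<close>

lemma component_step:
  assumes fin: "finite V" and IH: "\<And>W. W \<subset> V \<Longrightarrow> real (num_mds W) \<le> g (int (card W)) \<and> (real (num_mds W) = g (int (card W)) \<longrightarrow> extremal W)"
    and k: "bip_component V X Y" and m: "num_mds (X \<union> Y) = m" and s: "card X + card Y = s" and m0: "0 < m"
    and num: "real m * g (int (card V) - int s) \<le> g (int (card V))"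
    and eq: "real m * g (int (card V) - int s) = g (int (card V)) \<Longrightarrow> extremal (V - (X \<union> Y)) \<Longrightarrow> extremal V"
  shows "real (num_mds V) \<le> g (int (card V)) \<and> (real (num_mds V) = g (int (card V)) \<longrightarrow> extremal V)"
proof -
  let ?W = "V - (X \<union> Y)"
  have W: "int (card ?W) = int (card V) - int s" "?W \<subset> V"
    using card_bip_component[OF fin k] s by (auto simp: algebra_simps)
  note I = IH[OF W(2), unfolded W(1)]
  have e: "real (num_mds V) = real m * real (num_mds ?W)" using num_mds_bip_component[OF fin k] m by simp
  then have le: "real (num_mds V) \<le> real m * g (int (card V) - int s)" using I by (simp add: mult_left_mono)
  have "extremal V" if eqV: "real (num_mds V) = g (int (card V))"
  proof (rule eq)
    show 1: "real m * g (int (card V) - int s) = g (int (card V))" using le num eqV by linarith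
    have "real m * real (num_mds ?W) = real m * g (int (card V) - int s)" using e eqV 1 by linarith
    then have "real (num_mds ?W) = g (int (card V) - int s)" using m0 by auto
    then show "extremal ?W" using I by blast
  qed
  then show ?thesis using le num by linarith
qed

text \<open>The rest has a number of vertices divisible by 4, so among the extremal shapes it can
  only be a union of 4-cycles.\<close>

lemma core_extremal:
  assumes fin: "finite V" and k: "bip_component V X Y" and c: "card X = p" "card Y = q"
    and e: "extremal (V - (X \<union> Y))" and d: "int (card V) - int p - int q = 4 * j"
  shows "core_C4_union p q V"
proof -
  have "int (card (V - (X \<union> Y))) = 4 * j" using card_bip_component(1)[OF fin k] c d by simp
  then have "4 dvd card (V - (X \<union> Y))" by presburger
  then have "C4_union (V - (X \<union> Y))" using extremal_mod4 e by blast
  then show ?thesis unfolding core_C4_union_def using bip_component_complete_bip[OF k] c by blast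
qed

section \<open>Strict bounds at vertices of degree at most one, and the assembled induction\<close>

lemma deg0_less:
  assumes "finite V" "subsets_bounded V" "x \<in> V" "deg V x = 0"
  shows "real (num_mds V) < g (int (card V))"
  using isolated_num[OF assms] g_strict_mono[of "int (card V) - 1" "int (card V)"] by simp

lemma K2_less:
  assumes fin: "finite V" and h: "subsets_bounded V" and u: "u \<in> V" "nb V u = {v}" and v: "nb V v = {u}"
  shows "real (num_mds V) < g (int (card V))"
proof -
  have uv: "v \<in> V" "adj u v" using u(2) by (auto simp: nb_def)
  have "count_le V (\<lambda>F. u \<in> F \<and> v \<in> F) (g (int (card V) - 2))"
    using cell_pair[OF fin h u(1) uv] u(2) v by simp
  then have "real (num_mds V) \<le> g (int (card V) - 2)"
  proof (rule count_le_num_mds)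
    fix F assume F: "mds V F"
    show "u \<in> F \<and> v \<in> F"
      using mds_blocked'[OF F u(1)] mds_blocked'[OF F uv(1)] u(2) v by auto
  qed fact
  then show ?thesis using g_strict_mono[of "int (card V) - 2" "int (card V)"] by simp
qed

lemma leaf_sum_less: "g (n - 2) + g (n - 3) + g (n - 4) < g n"
proof (cases n rule: residue4_cases)
  case (1 q)
  then show ?thesis using g_table0[OF 1] g_pos[of n] by simp
next
  case (2 q)
  then show ?thesis using g_table1[OF 2] g_pos[of n] by simp
next
  case (3 q)
  then show ?thesis using g_table2[OF 3] g_pos[of n] by simp
next
  case (4 q)
  then show ?thesis using g_table3[OF 4] g_pos[of n] by simp
qed

lemma leaf3_less:
  assumes "finite V" "subsets_bounded V" "v \<in> V" "u \<in> nb V v" "deg V u = 1" "3 \<le> deg V v"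
  shows "real (num_mds V) < g (int (card V))"
proof (cases "int (card V)" rule: residue4_cases)
  case (1 q)
  then show ?thesis using leaf3(1)[OF assms, of q] g_pos[of "int (card V)"] by linarith
next
  case (2 q)
  then show ?thesis using leaf3(2)[OF assms, of q] g_pos[of "int (card V)"] by linarith
next
  case (3 q)
  then show ?thesis using leaf3(3)[OF assms, of q] g_pos[of "int (card V)"] by linarith
next
  case (4 q)
  then show ?thesis using leaf3(4)[OF assms, of q] g_pos[of "int (card V)"] by linarith
qed

lemma no_extremal_component_less:
  assumes p: "no_extremal_component V" and ne: "V \<noteq> {}"
  shows "real (num_mds V) < g (int (card V))"
proof (cases "int (card V)" rule: residue4_cases)
  case (1 q)
  then show ?thesis by (rule no_extremal_component_residue0[OF p _ ne])
next
  case (2 q)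
  then show ?thesis by (rule no_extremal_component_residue1[OF p])
next
  case (3 q)
  then show ?thesis by (rule no_extremal_component_residue2[OF p])
next
  case (4 q)
  then show ?thesis by (rule no_extremal_component_residue3[OF p])
qed

text \<open>A vertex of degree at most 1 gives a strict inequality except in a component P_3, and so
  does a nonempty graph without extremal components. Equality is therefore handed down through
  split-off components to the empty graph.\<close>

lemma num_mds_le_g:
  assumes "finite V"
  shows "real (num_mds V) \<le> g (int (card V)) \<and> (real (num_mds V) = g (int (card V)) \<longrightarrow> extremal V)"
  using assms
proof (induction rule: finite_psubset_induct)
  case (psubset V)
  note fin = psubset.hyps
  have h: "subsets_bounded V" using psubset.IH by (simp add: subsets_bounded_def)
  note step = component_step[OF fin psubset.IH]
  have less: ?case if "real (num_mds V) < g (int (card V))" using that by simp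
  define n where "n = int (card V)"
  have res: "(\<exists>q. n = 4 * q) \<or> (\<exists>q. n = 4 * q + 1) \<or> (\<exists>q. n = 4 * q + 2) \<or> (\<exists>q. n = 4 * q + 3)"
    using residue4_cases[of n] by metis
  note tab = g_table0[of n] g_table1[of n] g_table2[of n] g_table3[of n]
  show ?case
  proof (cases "V = {}")
    case True
    then show ?thesis using C4_union.empty g_eval(1)[of 0] by (simp add: num_mds_empty extremal_def)
  next
    case ne: False
    show ?thesis
    proof (cases "\<exists>x\<in>V. deg V x \<le> 1")
      case True
      then obtain u where u: "u \<in> V" "deg V u \<le> 1" by blast
      show ?thesis
      proof (cases "deg V u = 0")
        case True
        then show ?thesis using less deg0_less[OF fin h u(1)] by blast
      next
        case False
        then have d1: "deg V u = 1" using u by linarith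
        then obtain v where nu: "nb V u = {v}" by (auto simp: card_1_singleton_iff)
        have v: "v \<in> V" "u \<in> nb V v" using nbD[of v V u] nu u(1) by auto
        have "deg V v \<noteq> 0" using v fin by auto
        then consider "deg V v = 1" | "deg V v = 2" | "3 \<le> deg V v" by linarith
        then show ?thesis
        proof cases
          case 1
          then have "nb V v = {u}" using v(2) by (auto simp: card_1_singleton_iff)
          then show ?thesis using less K2_less[OF fin h u(1) nu] by blast
        next
          case 3
          then show ?thesis using less leaf3_less[OF fin h v d1] by blast
        next
          case 2
          obtain w where w: "nb V v = {u,w}" "u \<noteq> w" using deg2_other[OF fin 2 v(2)] by (elim exE conjE)
          have wv: "w \<in> V" "v \<in> nb V w" using nbD[of w V v] w v(1) by auto
          show ?thesis
          proof (cases "deg V w = 1")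
            case False
            then show ?thesis using less leaf2[OF fin h v(1) w d1] leaf_sum_less[of "int (card V)"] by simp
          next
            case True
            then have nw: "nb V w = {v}" using wv(2) by (auto simp: card_1_singleton_iff)
            have k: "bip_component V {v} {u,w}" unfolding bip_component_def using u(1) v wv nu w nw by auto
            have c: "card {v} = 1" "card {u,w} = 2" using w(2) by auto
            have p3: "num_mds ({v} \<union> {u,w}) = 3" using num_mds_complete_bip_star[OF bip_component_complete_bip(1)[OF k]] c by simp
            \<comment> \<open>The ratio of the two sides is 2/3, 11/16, 9/11, 1 in the residues 0 to
              3.\<close>
            have num: "real 3 * g (int (card V) - int 3) \<le> g (int (card V)) \<and>
                (real 3 * g (int (card V) - int 3) = g (int (card V)) \<longrightarrow> (\<exists>q. n = 4 * q + 3))"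
              using res tab g_pos[of n] unfolding n_def[symmetric] by (elim disjE exE) auto
            show ?thesis
            proof (rule step[OF _ k p3])
              show "card {v} + card {u,w} = 3" using c by simp
              show "real 3 * g (int (card V) - int 3) \<le> g (int (card V))" using num by blast
              assume e: "real 3 * g (int (card V) - int 3) = g (int (card V))" "extremal (V - ({v} \<union> {u,w}))"
              then obtain q where "n = 4 * q + 3" using num by blast
              then have "core_C4_union 1 2 V" using core_extremal[OF fin k c e(2), of q] by (simp add: n_def)
              then show "extremal V" by (simp add: extremal_def)
            qed auto
          qed
        qed
      qed
    next
      case False
      then have d2: "2 \<le> deg V x" if "x \<in> V" for x using that by force
      show ?thesis
      proof (cases "no_extremal_component V")
        case True
        then show ?thesis using less no_extremal_component_less[OF True ne] by blast
      next
        case False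
        then obtain X Y where k: "bip_component V X Y" and c: "(card X, card Y) \<in> {(2,2),(2,3),(3,3)}"
          using fin h d2 unfolding no_extremal_component_def by blast
        note complete_bip = bip_component_complete_bip[OF k]
        consider "card X = 2" "card Y = 2" | "card X = 2" "card Y = 3" | "card X = 3" "card Y = 3" using c by auto
        then show ?thesis
        proof cases
          case 1
          have m: "num_mds (X \<union> Y) = 6" using num_mds_complete_bip[OF complete_bip(1)] 1 by simp
          show ?thesis
          proof (rule step[OF _ k m])
            show "card X + card Y = 4" using 1 by simp
            show "real 6 * g (int (card V) - int 4) \<le> g (int (card V))" using g_minus4[of n] by (simp add: n_def)
            assume "extremal (V - (X \<union> Y))"
            then have "extremal (X \<union> Y \<union> (V - (X \<union> Y)))" by (rule extremal_add[OF complete_bip(1) 1 complete_bip(2)])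
            then show "extremal V" using complete_bip(3) by simp
          qed auto
        next
          case 2
          have m: "num_mds (X \<union> Y) = 8" using num_mds_complete_bip[OF complete_bip(1)] 2 by simp
          \<comment> \<open>The ratio is 2/3, 1, 32/33, 22/27 in the residues 0 to 3.\<close>
          have num: "real 8 * g (int (card V) - int 5) \<le> g (int (card V)) \<and>
              (real 8 * g (int (card V) - int 5) = g (int (card V)) \<longrightarrow> (\<exists>q. n = 4 * q + 1))"
            using res tab g_pos[of n] unfolding n_def[symmetric] by (elim disjE exE) auto
          show ?thesis
          proof (rule step[OF _ k m])
            show "card X + card Y = 5" using 2 by simp
            show "real 8 * g (int (card V) - int 5) \<le> g (int (card V))" using num by blast
            assume e: "real 8 * g (int (card V) - int 5) = g (int (card V))" "extremal (V - (X \<union> Y))"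
            then obtain q where "n = 4 * q + 1" using num by blast
            then have "core_C4_union 2 3 V" using core_extremal[OF fin k 2 e(2), of "q - 1"] by (simp add: n_def)
            then show "extremal V" by (simp add: extremal_def)
          qed auto
        next
          case 3
          have m: "num_mds (X \<union> Y) = 11" using num_mds_complete_bip[OF complete_bip(1)] 3 by simp
          \<comment> \<open>The ratio is 121/216, 11/16, 1, 22/27 in the residues 0 to 3.\<close>
          have num: "real 11 * g (int (card V) - int 6) \<le> g (int (card V)) \<and>
              (real 11 * g (int (card V) - int 6) = g (int (card V)) \<longrightarrow> (\<exists>q. n = 4 * q + 2))"
            using res tab g_pos[of n] unfolding n_def[symmetric] by (elim disjE exE) auto
          show ?thesis
          proof (rule step[OF _ k m])
            show "card X + card Y = 6" using 3 by simp
            show "real 11 * g (int (card V) - int 6) \<le> g (int (card V))" using num by blast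
            assume e: "real 11 * g (int (card V) - int 6) = g (int (card V))" "extremal (V - (X \<union> Y))"
            then obtain q where "n = 4 * q + 2" using num by blast
            then have "core_C4_union 3 3 V" using core_extremal[OF fin k 3 e(2), of "q - 1"] by (simp add: n_def)
            then show "extremal V" by (simp add: extremal_def)
          qed auto
        qed
      qed
    qed
  qed
qed

end

section \<open>Isomorphism with the extremal graphs\<close>

text \<open>Two adjacency relations over different vertex types, for comparing a given graph with
  its model.\<close>

locale sym_graph_pair = G: sym_graph adj1 + H: sym_graph adj2
  for adj1 :: "'a \<Rightarrow> 'a \<Rightarrow> bool" and adj2 :: "'b \<Rightarrow> 'b \<Rightarrow> bool"
begin

definition giso :: "'a set \<Rightarrow> 'b set \<Rightarrow> bool" where
  "giso A B \<longleftrightarrow> (\<exists>f. bij_betw f A B \<and> (\<forall>u\<in>A. \<forall>v\<in>A. adj1 u v \<longleftrightarrow> adj2 (f u) (f v)))"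

lemma num_mds_giso:
  assumes "giso A B"
  shows "G.num_mds A = H.num_mds B"
proof -
  obtain f where f: "inj_on f A" "f ` A = B" and a: "\<And>u v. u \<in> A \<Longrightarrow> v \<in> A \<Longrightarrow> adj1 u v \<longleftrightarrow> adj2 (f u) (f v)"
    using assms unfolding giso_def bij_betw_def by blast
  have dissoc: "G.dissoc F \<longleftrightarrow> H.dissoc (f ` F)" if F: "F \<subseteq> A" for F
  proof -
    have "(adj1 v x \<and> adj1 v y \<longrightarrow> x = y) \<longleftrightarrow> (adj2 (f v) (f x) \<and> adj2 (f v) (f y) \<longrightarrow> f x = f y)"
      if "v \<in> F" "x \<in> F" "y \<in> F" for v x y
      using a[of v x] a[of v y] inj_on_eq_iff[OF f(1), of x y] that F by (simp add: subset_iff)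
    then show ?thesis unfolding G.dissoc_def H.dissoc_def by (simp add: ball_simps)
  qed
  have mds: "G.mds A F \<longleftrightarrow> H.mds B (f ` F)" if F: "F \<subseteq> A" for F
  proof -
    have "G.dissoc (insert x F) \<longleftrightarrow> H.dissoc (insert (f x) (f ` F))" if "x \<in> A - F" for x
      using dissoc[of "insert x F"] that F by simp
    moreover have "B - f ` F = f ` (A - F)" using inj_on_image_set_diff[OF f(1), of A F] F f(2) by simp
    ultimately show ?thesis unfolding G.mds_def H.mds_def using dissoc[OF F] F f(2) by auto
  qed
  have "bij_betw ((`) f) {F. G.mds A F} {F. H.mds B F}"
  proof (rule bij_betw_imageI)
    show "inj_on ((`) f) {F. G.mds A F}"
      by (rule inj_on_subset[OF inj_on_image_Pow[OF f(1)]]) (auto dest: G.mds_subset)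
    show "(`) f ` {F. G.mds A F} = {F. H.mds B F}"
    proof (rule equalityI[OF subsetI subsetI])
      fix K assume "K \<in> (`) f ` {F. G.mds A F}"
      then obtain F where "G.mds A F" "K = f ` F" by blast
      then show "K \<in> {F. H.mds B F}" using mds[of F] G.mds_subset[of A F] by simp
    next
      fix K assume K: "K \<in> {F. H.mds B F}"
      then have "K \<subseteq> f ` A" using H.mds_subset f(2) by simp
      then obtain F where "F \<subseteq> A" "K = f ` F" by (auto simp: subset_image_iff)
      then show "K \<in> (`) f ` {F. G.mds A F}" using K mds[of F] by simp
    qed
  qed
  then show ?thesis unfolding G.num_mds_def H.num_mds_def by (rule bij_betw_same_card)
qed

lemma giso_Un:
  assumes A: "giso A1 A2" and B: "giso B1 B2" and s: "G.separated A1 B1" "H.separated A2 B2"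
  shows "giso (A1 \<union> B1) (A2 \<union> B2)"
proof -
  obtain f where f: "bij_betw f A1 A2" "\<And>u v. u \<in> A1 \<Longrightarrow> v \<in> A1 \<Longrightarrow> adj1 u v \<longleftrightarrow> adj2 (f u) (f v)"
    using A unfolding giso_def by blast
  obtain h where h: "bij_betw h B1 B2" "\<And>u v. u \<in> B1 \<Longrightarrow> v \<in> B1 \<Longrightarrow> adj1 u v \<longleftrightarrow> adj2 (h u) (h v)"
    using B unfolding giso_def by blast
  let ?k = "\<lambda>x. if x \<in> A1 then f x else h x"
  have d: "A1 \<inter> B1 = {}" "A2 \<inter> B2 = {}" using s by (auto simp: G.separated_def H.separated_def)
  have kB: "?k x = h x" if "x \<in> B1" for x using that d by auto
  have "bij_betw ?k A1 A2" using f(1) by (simp cong: bij_betw_cong)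
  moreover have "bij_betw ?k B1 B2" using h(1) kB bij_betw_cong[of B1 ?k h B2] by blast
  ultimately have "bij_betw ?k (A1 \<union> B1) (A2 \<union> B2)" using d(2) by (rule bij_betw_combine)
  moreover have "adj1 u v \<longleftrightarrow> adj2 (?k u) (?k v)" if u: "u \<in> A1 \<union> B1" and v: "v \<in> A1 \<union> B1" for u v
  proof -
    have n1: "\<not> adj1 x y" "\<not> adj1 y x" if "x \<in> A1" "y \<in> B1" for x y
      using s(1) that G.sym[of y x] unfolding G.separated_def by blast+
    have n2: "\<not> adj2 (f x) (h y)" "\<not> adj2 (h y) (f x)" if "x \<in> A1" "y \<in> B1" for x y
    proof -
      have "f x \<in> A2" "h y \<in> B2" using bij_betwE[OF f(1)] bij_betwE[OF h(1)] that by auto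
      then show "\<not> adj2 (f x) (h y)" "\<not> adj2 (h y) (f x)"
        using s(2) H.sym[of "h y" "f x"] unfolding H.separated_def by blast+
    qed
    show ?thesis
    proof (cases "u \<in> A1"; cases "v \<in> A1")
      assume "u \<in> A1" "v \<in> A1"
      then show ?thesis using f(2) by simp
    next
      assume "u \<in> A1" "v \<notin> A1"
      then show ?thesis using n1 n2 v by simp
    next
      assume "u \<notin> A1" "v \<in> A1"
      then show ?thesis using n1 n2 u by simp
    next
      assume "u \<notin> A1" "v \<notin> A1"
      then show ?thesis using h(2) u v by simp
    qed
  qed
  ultimately show ?thesis unfolding giso_def by blast
qed

lemma giso_complete_bip:
  assumes k: "G.complete_bip X1 Y1" "H.complete_bip X2 Y2" and c: "card X1 = card X2" "card Y1 = card Y2"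
    and p: "0 < card X1" "0 < card Y1"
  shows "giso (X1 \<union> Y1) (X2 \<union> Y2)"
proof -
  have fin: "finite X1" "finite X2" "finite Y1" "finite Y2"
    using p c by (auto intro: card_ge_0_finite)
  obtain f where f: "bij_betw f X1 X2" using finite_same_card_bij[OF fin(1,2) c(1)] by blast
  obtain h where h: "bij_betw h Y1 Y2" using finite_same_card_bij[OF fin(3,4) c(2)] by blast
  let ?k = "\<lambda>x. if x \<in> X1 then f x else h x"
  have d: "X1 \<inter> Y1 = {}" "X2 \<inter> Y2 = {}" using k by (auto simp: G.complete_bip_def H.complete_bip_def)
  have kX: "?k x \<in> X2" if "x \<in> X1" for x using that bij_betwE[OF f] by auto
  have kY: "?k x = h x" "?k x \<in> Y2" if "x \<in> Y1" for x using that d bij_betwE[OF h] by auto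
  have "bij_betw ?k X1 X2" using f by (simp cong: bij_betw_cong)
  moreover have "bij_betw ?k Y1 Y2" using h kY(1) bij_betw_cong[of Y1 ?k h Y2] by blast
  ultimately have "bij_betw ?k (X1 \<union> Y1) (X2 \<union> Y2)" using d(2) by (rule bij_betw_combine)
  moreover have "adj1 u v \<longleftrightarrow> adj2 (?k u) (?k v)" if u: "u \<in> X1 \<union> Y1" and v: "v \<in> X1 \<union> Y1" for u v
  proof -
    note kx = kX[of u] kX[of v] kY(2)[of u] kY(2)[of v]
    note e1 = k(1)[unfolded G.complete_bip_def] G.sym[of u v] G.sym[of v u]
    note e2 = k(2)[unfolded H.complete_bip_def] H.sym[of "?k u" "?k v"] H.sym[of "?k v" "?k u"]
    \<comment> \<open>On the union of the two sides adjacency means lying on different sides, and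
      this equivalence says so without cases.\<close>
    have "adj1 u v \<longleftrightarrow> (u \<in> X1 \<longleftrightarrow> v \<in> Y1)" using u v e1 d(1) by blast
    moreover have "adj2 (?k u) (?k v) \<longleftrightarrow> (?k u \<in> X2 \<longleftrightarrow> ?k v \<in> Y2)"
    proof -
      have "?k u \<in> X2 \<union> Y2" "?k v \<in> X2 \<union> Y2" using u v kx by blast+
      then show ?thesis using e2 d(2) by blast
    qed
    moreover have "?k u \<in> X2 \<longleftrightarrow> u \<in> X1" using u kx d by blast
    moreover have "?k v \<in> Y2 \<longleftrightarrow> v \<in> Y1" using v kx d by blast
    ultimately show ?thesis by blast
  qed
  ultimately show ?thesis unfolding giso_def by blast
qed

text \<open>Any 4-cycle of one union may be paired with any of the other, so one component is peeled
  off on each side.\<close>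

lemma giso_C4_union: "G.C4_union A \<Longrightarrow> H.C4_union B \<Longrightarrow> card A = card B \<Longrightarrow> giso A B"
proof (induction arbitrary: B rule: G.C4_union.induct)
  case empty
  then have "B = {}" using H.C4_union_props[of B] by simp
  then show ?case by (simp add: giso_def bij_betw_def)
next
  case (add X Y W)
  have c: "card (X \<union> Y \<union> W) = 4 + card W"
  proof -
    have "finite W" using G.C4_union_props[OF add(5)] by blast
    then show ?thesis using card_Un_disjoint[of "X \<union> Y" W] G.card_complete_bip_Un[OF add(1)] add(2-4)
      by (simp add: G.separated_def)
  qed
  from add.prems(1) show ?case
  proof (cases rule: H.C4_union.cases)
    case empty
    then show ?thesis using add.prems(2) c by simp
  next
    case b: (add X' Y' W')
    have "finite W'" using H.C4_union_props[OF b(6)] by blast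
    then have "card B = 4 + card W'" using card_Un_disjoint[of "X' \<union> Y'" W'] H.card_complete_bip_Un[OF b(2)] b
      by (simp add: H.separated_def)
    then have "giso W W'" using add.IH[OF b(6)] add.prems(2) c by simp
    then show ?thesis unfolding b(1) using giso_Un giso_complete_bip[OF add(1) b(2)] add(2-4) b(3-5) by simp
  qed
qed

lemma giso_core_C4_union:
  assumes e: "G.core_C4_union p q A" "H.core_C4_union p q B" and c: "card A = card B" and pq: "0 < p" "0 < q"
  shows "giso A B"
proof -
  obtain X Y W where A: "A = X \<union> Y \<union> W" and k: "G.complete_bip X Y" "card X = p" "card Y = q" and s: "G.separated (X \<union> Y) W" and w: "G.C4_union W"
    using e(1) by (auto simp: G.core_C4_union_def)
  obtain X' Y' W' where B: "B = X' \<union> Y' \<union> W'" and k': "H.complete_bip X' Y'" "card X' = p" "card Y' = q" and s': "H.separated (X' \<union> Y') W'" and w': "H.C4_union W'"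
    using e(2) by (auto simp: H.core_C4_union_def)
  have "finite W" "finite W'" using G.C4_union_props[OF w] H.C4_union_props[OF w'] by blast+
  then have "card A = p + q + card W" "card B = p + q + card W'"
    using card_Un_disjoint[of "X \<union> Y" W] card_Un_disjoint[of "X' \<union> Y'" W'] G.card_complete_bip_Un[OF k(1)] H.card_complete_bip_Un[OF k'(1)]
      k k' pq s s' A B by (simp_all add: G.separated_def H.separated_def)
  then have "giso W W'" using giso_C4_union[OF w w'] c by simp
  then show ?thesis unfolding A B using giso_Un[OF giso_complete_bip[OF k(1) k'(1)]] k k' pq s s' by simp
qed

end

section \<open>Passing between edge sets and adjacency relations\<close>

lemma sym_graph_edges: "sym_graph (\<lambda>u v. {u, v} \<in> E)"
  by unfold_locales (simp add: insert_commute)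

lemma graph_iso_giso:
  "graph_iso V1 E1 V2 E2 \<longleftrightarrow> sym_graph_pair.giso (\<lambda>u v. {u, v} \<in> E1) (\<lambda>u v. {u, v} \<in> E2) V1 V2"
proof -
  interpret sym_graph_pair "\<lambda>u v. {u, v} \<in> E1" "\<lambda>u v. {u, v} \<in> E2"
    by (simp add: sym_graph_pair_def sym_graph_edges)
  show ?thesis by (simp add: graph_iso_def giso_def)
qed

text \<open>A strictly larger dissociation set contains some \<open>insert x F\<close>, so both
  notions of maximality agree.\<close>

lemma phi_eq_num_mds:
  assumes fin: "finite V"
  shows "phi V E = sym_graph.num_mds (\<lambda>u v. {u, v} \<in> E) V"
proof -
  interpret sym_graph "\<lambda>u v. {u, v} \<in> E" by (rule sym_graph_edges)
  have ds: "dissociation_set V E F \<longleftrightarrow> F \<subseteq> V \<and> dissoc F" for F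
  proof (cases "F \<subseteq> V")
    case True
    then have "finite F" using fin by (rule finite_subset)
    then have "card {u \<in> F. {u, v} \<in> E} \<le> 1 \<longleftrightarrow> (\<forall>x\<in>F. \<forall>y\<in>F. {v, x} \<in> E \<and> {v, y} \<in> E \<longrightarrow> x = y)" for v
      by (simp add: card_le_Suc0_iff_eq insert_commute) blast
    then show ?thesis using True unfolding dissociation_set_def dissoc_def by simp
  qed (simp add: dissociation_set_def)
  have "maximal_dissociation_set V E F \<longleftrightarrow> mds V F" for F
  proof
    assume m: "maximal_dissociation_set V E F"
    then have F: "F \<subseteq> V" "dissoc F" and mx: "\<And>F'. F' \<subseteq> V \<Longrightarrow> dissoc F' \<Longrightarrow> F \<subseteq> F' \<Longrightarrow> F' = F"
      by (auto simp: maximal_dissociation_set_def ds)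
    have "\<not> dissoc (insert x F)" if "x \<in> V - F" for x
    proof
      assume "dissoc (insert x F)"
      then have "insert x F = F" using mx[of "insert x F"] that F(1) by blast
      then show False using that by blast
    qed
    then show "mds V F" using F by (simp add: mds_def)
  next
    assume m: "mds V F"
    have "F' = F" if F': "F' \<subseteq> V" "dissoc F'" "F \<subseteq> F'" for F'
    proof (rule ccontr)
      assume "F' \<noteq> F"
      then obtain x where x: "x \<in> F'" "x \<notin> F" using F'(3) by blast
      then have "dissoc (insert x F)" using dissoc_mono[OF F'(2), of "insert x F"] F'(3) by blast
      then show False using m x F'(1) unfolding mds_def by blast
    qed
    then show "maximal_dissociation_set V E F" using m by (simp add: maximal_dissociation_set_def ds mds_def)
  qed
  then show ?thesis by (simp add: phi_def num_mds_def)
qed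

section \<open>The model graphs built from copies of the 4-cycle\<close>

lemma C4_edge_iff: "{u, v} \<in> C4_E \<longleftrightarrow> (u, v) \<in> {(0,1),(1,0),(1,2),(2,1),(2,3),(3,2),(3,0),(0,3)}"
  by (auto simp: C4_E_def doubleton_eq_iff)

lemma copies_edge_iff: "{(i, u), (j, v)} \<in> copies_E l E \<longleftrightarrow> i = j \<and> i < l \<and> {u, v} \<in> E"
  unfolding copies_E_def by (auto simp: doubleton_eq_iff insert_commute)

lemma dunion_edge_iff:
  "{Inl a, Inl b} \<in> dunion_E E1 E2 \<longleftrightarrow> {a, b} \<in> E1"
  "{Inr c, Inr d} \<in> dunion_E E1 E2 \<longleftrightarrow> {c, d} \<in> E2"
  "{Inl a, Inr d} \<notin> dunion_E E1 E2"
proof -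
  have l: "{Inl a, Inl b} = Inl ` {a, b}" and r: "{Inr c, Inr d} = Inr ` {c, d}" for a b c d by simp_all
  have "{Inl a, Inl b} \<noteq> Inr ` e" "{Inr c, Inr d} \<noteq> Inl ` e'" for e e' by auto
  then show "{Inl a, Inl b} \<in> dunion_E E1 E2 \<longleftrightarrow> {a, b} \<in> E1"
    "{Inr c, Inr d} \<in> dunion_E E1 E2 \<longleftrightarrow> {c, d} \<in> E2"
    unfolding dunion_E_def Un_iff image_iff l r inj_image_eq_iff[OF inj_Inl] inj_image_eq_iff[OF inj_Inr] by blast+
  show "{Inl a, Inr d} \<notin> dunion_E E1 E2" unfolding dunion_E_def by blast
qed

text \<open>\<open>f\<close> is the identity for plain copies and \<open>Inr\<close> inside a
  disjoint union. The induction runs over the first \<open>k\<close> copies, while the adjacency is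
  that of all \<open>l\<close>.\<close>

lemma (in sym_graph) C4_union_copies:
  assumes f: "inj f" and adj: "\<And>i j u v. adj (f (i, u)) (f (j, v)) \<longleftrightarrow> i = j \<and> i < l \<and> {u, v} \<in> C4_E"
  shows "k \<le> l \<Longrightarrow> C4_union (f ` copies_V k C4_V)"
proof (induction k)
  case 0
  then show ?case using C4_union.empty by (simp add: copies_V_def)
next
  case (Suc k)
  \<comment> \<open>The sides of the 4-cycle, seen as K_{2,2}, are its pairs of opposite
    vertices.\<close>
  let ?X = "f ` {(k,0),(k,2)}" and ?Y = "f ` {(k,1),(k,3)}"
  have "copies_V (Suc k) C4_V = {(k,0),(k,2)} \<union> {(k,1),(k,3)} \<union> copies_V k C4_V"
    by (auto simp: copies_V_def C4_V_def less_Suc_eq)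
  then have e: "f ` copies_V (Suc k) C4_V = ?X \<union> ?Y \<union> f ` copies_V k C4_V" by (simp only: image_Un)
  have inj: "f x = f y \<longleftrightarrow> x = y" for x y using f by (simp add: inj_eq)
  have "complete_bip ?X ?Y" using Suc.prems unfolding complete_bip_def by (simp add: adj inj C4_edge_iff del: insert_absorb2)
  moreover have "card ?X = 2" "card ?Y = 2" by (simp_all add: inj)
  moreover have "separated (?X \<union> ?Y) (f ` copies_V k C4_V)"
    unfolding separated_def by (auto simp: adj inj copies_V_def)
  moreover have "C4_union (f ` copies_V k C4_V)" using Suc by simp
  ultimately show ?case unfolding e by (rule C4_union.add)
qed

lemma C4_union_copies_C4: "sym_graph.C4_union (\<lambda>u v. {u, v} \<in> copies_E l C4_E) (copies_V l C4_V)"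
proof -
  interpret sym_graph "\<lambda>u v. {u, v} \<in> copies_E l C4_E" by (rule sym_graph_edges)
  show ?thesis using C4_union_copies[of id l l] by (simp add: copies_edge_iff)
qed

lemma core_C4_union_dunion_copies_C4:
  assumes V1: "V1 = X \<union> Y" "X \<inter> Y = {}"
    and E1: "\<And>u v. u \<in> V1 \<Longrightarrow> v \<in> V1 \<Longrightarrow> {u, v} \<in> E1 \<longleftrightarrow> (u \<in> X \<longleftrightarrow> v \<in> Y)"
    and c: "card X = p" "card Y = q"
  shows "sym_graph.core_C4_union (\<lambda>u v. {u, v} \<in> dunion_E E1 (copies_E l C4_E)) p q (dunion_V V1 (copies_V l C4_V))"
proof -
  interpret sym_graph "\<lambda>u v. {u, v} \<in> dunion_E E1 (copies_E l C4_E)" by (rule sym_graph_edges)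
  have "complete_bip (Inl ` X) (Inl ` Y)" unfolding complete_bip_def using V1 E1 by (auto simp: dunion_edge_iff simp del: insert_absorb2)
  moreover have "card ((Inl :: _ \<Rightarrow> _ + nat \<times> nat) ` X) = p" "card ((Inl :: _ \<Rightarrow> _ + nat \<times> nat) ` Y) = q"
    using c by (simp_all add: card_image)
  moreover have "separated (Inl ` X \<union> Inl ` Y) (Inr ` copies_V l C4_V)"
    unfolding separated_def by (auto simp: dunion_edge_iff)
  moreover have "C4_union (Inr ` copies_V l C4_V)"
    using C4_union_copies[of Inr l l] by (simp add: dunion_edge_iff copies_edge_iff)
  ultimately show ?thesis unfolding core_C4_union_def dunion_V_def V1 image_Un by blast
qed

lemma core_C4_union_dunion_Kbip:
  "sym_graph.core_C4_union (\<lambda>u v. {u, v} \<in> dunion_E (Kbip_E a b) (copies_E l C4_E)) a b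
    (dunion_V (Kbip_V a b) (copies_V l C4_V))"
proof (rule core_C4_union_dunion_copies_C4[where X = "{0..<a}" and Y = "{a..<a+b}"])
  fix u v assume "u \<in> Kbip_V a b" "v \<in> Kbip_V a b"
  moreover have "{u, v} \<in> Kbip_E a b \<longleftrightarrow> u < a \<and> a \<le> v \<and> v < a + b \<or> v < a \<and> a \<le> u \<and> u < a + b"
    unfolding Kbip_E_def mem_Collect_eq doubleton_eq_iff by blast
  ultimately show "{u, v} \<in> Kbip_E a b \<longleftrightarrow> (u \<in> {0..<a} \<longleftrightarrow> v \<in> {a..<a+b})"
    by (auto simp: Kbip_V_def)
qed (auto simp: Kbip_V_def)

lemma core_C4_union_dunion_P3:
  "sym_graph.core_C4_union (\<lambda>u v. {u, v} \<in> dunion_E P3_E (copies_E l C4_E)) 1 2 (dunion_V P3_V (copies_V l C4_V))"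
proof (rule core_C4_union_dunion_copies_C4[where X = "{1}" and Y = "{0,2}"])
  fix u v assume "u \<in> P3_V" "v \<in> P3_V"
  then show "{u, v} \<in> P3_E \<longleftrightarrow> (u \<in> {1} \<longleftrightarrow> v \<in> {0,2})"
    by (auto simp: P3_V_def P3_E_def doubleton_eq_iff)
qed (auto simp: P3_V_def)

lemma card_copies_C4: "card (copies_V l C4_V) = 4 * l" "finite (copies_V l C4_V)"
proof -
  have "copies_V l C4_V = {..<l} \<times> C4_V" by (auto simp: copies_V_def)
  then show "card (copies_V l C4_V) = 4 * l" "finite (copies_V l C4_V)"
    by (simp_all add: card_cartesian_product C4_V_def)
qed

lemma card_dunion: "finite A \<Longrightarrow> finite B \<Longrightarrow> card (dunion_V A B) = card A + card B"
  unfolding dunion_V_def by (subst card_Un_disjoint) (auto simp: card_image)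

theorem theorem5p2:
  fixes V :: "'a set" and E :: "'a set set" and t r :: nat
  assumes "graph V E" and "triangle_free E"
    and "card V \<ge> 4" and "card V = 4 * t + r" and "t \<ge> 1" and "r < 4"
  shows "(r = 0 \<longrightarrow> phi V E \<le> 6 ^ t \<and>
            (phi V E = 6 ^ t \<longleftrightarrow> graph_iso V E (copies_V t C4_V) (copies_E t C4_E)))
       \<and> (r = 1 \<longrightarrow> phi V E \<le> 8 * 6 ^ (t - 1) \<and>
            (phi V E = 8 * 6 ^ (t - 1) \<longleftrightarrow>
               graph_iso V E (dunion_V (Kbip_V 2 3) (copies_V (t - 1) C4_V))
                             (dunion_E (Kbip_E 2 3) (copies_E (t - 1) C4_E))))
       \<and> (r = 2 \<longrightarrow> phi V E \<le> 11 * 6 ^ (t - 1) \<and>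
            (phi V E = 11 * 6 ^ (t - 1) \<longleftrightarrow>
               graph_iso V E (dunion_V (Kbip_V 3 3) (copies_V (t - 1) C4_V))
                             (dunion_E (Kbip_E 3 3) (copies_E (t - 1) C4_E))))
       \<and> (r = 3 \<longrightarrow> phi V E \<le> 3 * 6 ^ t \<and>
            (phi V E = 3 * 6 ^ t \<longleftrightarrow>
               graph_iso V E (dunion_V P3_V (copies_V t C4_V))
                             (dunion_E P3_E (copies_E t C4_E))))"
proof -
  let ?a = "\<lambda>u v. {u, v} \<in> E"
  have fin: "finite V" using assms(1) by (simp add: graph_def)
  interpret tf_graph ?a
  proof (rule tf_graph.intro[OF sym_graph_edges], unfold_locales)
    fix x y z
    show "{x, x} \<notin> E"
    proof
      assume "{x, x} \<in> E"
      then have "\<exists>u v. {x, x} = {u, v} \<and> u \<noteq> v" using assms(1) unfolding graph_def by blast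
      then show False by (simp add: doubleton_eq_iff)
    qed
    show "{x, y} \<in> E \<Longrightarrow> {y, z} \<in> E \<Longrightarrow> {x, z} \<notin> E" using assms(2) unfolding triangle_free_def by blast
  qed
  note phi = phi_eq_num_mds[OF fin, of E]
  note main = num_mds_le_g[OF fin]
  \<comment> \<open>For \<open>r = 1\<close> and \<open>r = 2\<close> the core has 5 or 6 vertices,
    which leaves \<open>s\<close> 4-cycles.\<close>
  obtain s where t: "t = Suc s" using assms(5) by (cases t) auto
  have pow: "6 powi int k = (6::real) ^ k" for k by simp
  have pair: "sym_graph_pair ?a (\<lambda>u v. {u, v} \<in> E')" for E' :: "'c set set"
    by (simp add: sym_graph_pair_def sym_graph_edges)
  \<comment> \<open>Common pattern of the four residues, with \<open>P\<close> the shape expected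
    for \<open>V\<close>. Equality leads through \<open>extremal V\<close> and \<open>P\<close> to
    the isomorphism; conversely the count is invariant and equals \<open>m\<close> on the
    model.\<close>
  have iff: "phi V E \<le> m \<and> (phi V E = m \<longleftrightarrow> graph_iso V E V' E')"
    if val: "g (int (card V)) = real m"
      and cl: "extremal V \<Longrightarrow> P"
      and iso: "P \<Longrightarrow> graph_iso V E V' E'"
      and num_mds: "sym_graph.num_mds (\<lambda>u v. {u, v} \<in> E') V' = m" for m P and V' :: "'c set" and E'
  proof -
    have "phi V E = m" if "graph_iso V E V' E'"
      using sym_graph_pair.num_mds_giso[OF pair that[unfolded graph_iso_giso]] num_mds phi by simp
    then show ?thesis using main val cl iso unfolding phi by auto
  qed
  have c4: "extremal V \<Longrightarrow> r = 0 \<Longrightarrow> C4_union V" using extremal_mod4 assms(4) by simp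
  \<comment> \<open>This and the next three facts discard the shapes whose cardinality has the wrong
    residue.\<close>
  have nc4: "\<not> C4_union V" if "r \<noteq> 0"
  proof
    assume "C4_union V"
    then obtain t' where "card V = 4 * t'" using C4_union_props by blast
    then show False using that assms(4,6) by presburger
  qed
  have n23: "\<not> core_C4_union 2 3 V" if "r \<noteq> 1"
  proof
    assume "core_C4_union 2 3 V"
    then obtain t' where "card V = 5 + 4 * t'" using ext23_props by blast
    then show False using that assms(4,6) by presburger
  qed
  have n33: "\<not> core_C4_union 3 3 V" if "r \<noteq> 2"
  proof
    assume "core_C4_union 3 3 V"
    then obtain t' where "card V = 6 + 4 * t'" using ext33_props by blast
    then show False using that assms(4,6) by presburger
  qed
  have n12: "\<not> core_C4_union 1 2 V" if "r \<noteq> 3"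
  proof
    assume "core_C4_union 1 2 V"
    then obtain t' where "card V = 3 + 4 * t'" using ext12_props by blast
    then show False using that assms(4,6) by presburger
  qed
  show ?thesis
  proof (intro conjI[OF _ conjI[OF _ conjI]] impI)
    assume r: "r = 0"
    interpret H: sym_graph "\<lambda>u v. {u, v} \<in> copies_E t C4_E" by (rule sym_graph_edges)
    show "phi V E \<le> 6 ^ t \<and> (phi V E = 6 ^ t \<longleftrightarrow> graph_iso V E (copies_V t C4_V) (copies_E t C4_E))"
    proof (rule iff[of _ "C4_union V"])
      show "g (int (card V)) = real (6 ^ t)" using g_eval(1)[of "int t"] r assms(4) by simp
      show "graph_iso V E (copies_V t C4_V) (copies_E t C4_E)" if "C4_union V"
        unfolding graph_iso_giso using sym_graph_pair.giso_C4_union[OF pair that C4_union_copies_C4] card_copies_C4(1) r assms(4) by simp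
      show "H.num_mds (copies_V t C4_V) = 6 ^ t" using H.C4_union_props[OF C4_union_copies_C4] card_copies_C4(1) by auto
    qed (use c4 r in blast)
  next
    assume r: "r = 1"
    let ?V' = "dunion_V (Kbip_V 2 3) (copies_V (t - 1) C4_V)" and ?E' = "dunion_E (Kbip_E 2 3) (copies_E (t - 1) C4_E)"
    interpret H: sym_graph "\<lambda>u v. {u, v} \<in> ?E'" by (rule sym_graph_edges)
    have c: "card ?V' = 4 * s + 5" using t by (simp add: card_dunion card_copies_C4 Kbip_V_def)
    show "phi V E \<le> 8 * 6 ^ (t - 1) \<and> (phi V E = 8 * 6 ^ (t - 1) \<longleftrightarrow> graph_iso V E ?V' ?E')"
    proof (rule iff[of _ "core_C4_union 2 3 V"])
      show "g (int (card V)) = real (8 * 6 ^ (t - 1))" using g_eval(2)[of "int t"] r assms(4) t pow[of "Suc s"] by simp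
      show "graph_iso V E ?V' ?E'" if "core_C4_union 2 3 V"
        unfolding graph_iso_giso using sym_graph_pair.giso_core_C4_union[OF pair that core_C4_union_dunion_Kbip] c t r assms(4) by simp
      show "H.num_mds ?V' = 8 * 6 ^ (t - 1)" using H.ext23_props[OF core_C4_union_dunion_Kbip] c t by auto
    qed (use nc4 n33 n12 r in \<open>simp add: extremal_def\<close>)
  next
    assume r: "r = 2"
    let ?V' = "dunion_V (Kbip_V 3 3) (copies_V (t - 1) C4_V)" and ?E' = "dunion_E (Kbip_E 3 3) (copies_E (t - 1) C4_E)"
    interpret H: sym_graph "\<lambda>u v. {u, v} \<in> ?E'" by (rule sym_graph_edges)
    have c: "card ?V' = 4 * s + 6" using t by (simp add: card_dunion card_copies_C4 Kbip_V_def)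
    show "phi V E \<le> 11 * 6 ^ (t - 1) \<and> (phi V E = 11 * 6 ^ (t - 1) \<longleftrightarrow> graph_iso V E ?V' ?E')"
    proof (rule iff[of _ "core_C4_union 3 3 V"])
      show "g (int (card V)) = real (11 * 6 ^ (t - 1))" using g_eval(3)[of "int t"] r assms(4) t pow[of "Suc s"] by simp
      show "graph_iso V E ?V' ?E'" if "core_C4_union 3 3 V"
        unfolding graph_iso_giso using sym_graph_pair.giso_core_C4_union[OF pair that core_C4_union_dunion_Kbip] c t r assms(4) by simp
      show "H.num_mds ?V' = 11 * 6 ^ (t - 1)" using H.ext33_props[OF core_C4_union_dunion_Kbip] c t by auto
    qed (use nc4 n23 n12 r in \<open>simp add: extremal_def\<close>)
  next
    assume r: "r = 3"
    let ?V' = "dunion_V P3_V (copies_V t C4_V)" and ?E' = "dunion_E P3_E (copies_E t C4_E)"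
    interpret H: sym_graph "\<lambda>u v. {u, v} \<in> ?E'" by (rule sym_graph_edges)
    have c: "card ?V' = 4 * t + 3" by (simp add: card_dunion card_copies_C4 P3_V_def)
    show "phi V E \<le> 3 * 6 ^ t \<and> (phi V E = 3 * 6 ^ t \<longleftrightarrow> graph_iso V E ?V' ?E')"
    proof (rule iff[of _ "core_C4_union 1 2 V"])
      show "g (int (card V)) = real (3 * 6 ^ t)" using g_eval(4)[of "int t"] r assms(4) by simp
      show "graph_iso V E ?V' ?E'" if "core_C4_union 1 2 V"
        unfolding graph_iso_giso using sym_graph_pair.giso_core_C4_union[OF pair that core_C4_union_dunion_P3] c r assms(4) by simp
      show "H.num_mds ?V' = 3 * 6 ^ t" using H.ext12_props[OF core_C4_union_dunion_P3] c by auto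
    qed (use nc4 n23 n33 r in \<open>simp add: extremal_def\<close>)
  qed
qed

end
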